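(* Let $(\mu,r)\in\Lambda=P^+\times\mathbb Z_+$ and $N=\dim\mathfrak g$. The sequence $$0\longrightarrow P_N(\mu,r)\xrightarrow{d_N}P_{N-1}(\mu,r)\xrightarrow{d_{N-1}}\cdots\xrightarrow{d_2}P_1(\mu,r)\xrightarrow{d_1}P(\mu,r)\xrightarrow{d_0}V(\mu,r)\longrightarrow0$$ is a projective resolution of $V(\mu,r)$ in the category $\mathcal G_2$.
   Context: $\mathfrak g$ is a finite-dimensional complex simple Lie algebra, $P^+$ its dominant integral weights, $V(\mu)$ the simple $\mathfrak g$-module of highest weight $\mu$. $\mathfrak g\ltimes\mathfrak g_{\mathrm{ad}}$ is $\mathfrak g\oplus\mathfrak g$ with bracket $[(x,y),(x',y')]=([x,x'],[x,y']+[y,x'])$; $\mathfrak g$ has degree $0$ and the abelian ideal $\mathfrak g_{\mathrm{ad}}=\{(0,y)\}$ has degree $1$. $\mathcal G_2$ is the category of $\mathbb Z_+$-graded $\mathfrak g\ltimes\mathfrak g_{\mathrm{ad}}$-modules with finite-dimensional graded pieces and grading-preserving module maps. $V(\mu,r)$ is $V(\mu)$ placed in degree $r$ with $\mathfrak g_{\mathrm{ad}}$ acting by zero. If $W$ is a finite-dimensional $\mathfrak g$-module placed in a single degree, $S(\mathfrak g_{\mathrm{ad}})\otimes W\cong U(\mathfrak g\ltimes\mathfrak g_{\mathrm{ad}})\otimes_{U(\mathfrak g)}W$ is regarded as a graded module with $\mathfrak g$ acting diagonally, $\mathfrak g_{\mathrm{ad}}$ acting by multiplication on the first factor, and the total grading.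 For $0\le j\le N$, $P_j(\mu,r)=S(\mathfrak g_{\mathrm{ad}})\otimes(\bigwedge^j\mathfrak g_{\mathrm{ad}}\otimes V(\mu))[j+r]$, where $(\bigwedge^j\mathfrak g_{\mathrm{ad}}\otimes V(\mu))[j+r]$ is placed in degree $j+r$; $P(\mu,r)=P_0(\mu,r)=S(\mathfrak g_{\mathrm{ad}})\otimes V(\mu,r)$. The maps are: for $j>0$, $$d_j(u\otimes(x_1\wedge\cdots\wedge x_j)\otimes v)=\sum_{s=1}^j(-1)^{s-1}ux_s\otimes(x_1\wedge\cdots\wedge x_{s-1}\wedge x_{s+1}\wedge\cdots\wedge x_j)\otimes v,$$ and $d_0(u\otimes v)=uv$ (the action of $u$ on $v\in V(\mu,r)$), for $u\in S(\mathfrak g_{\mathrm{ad}})$, $x_s\in\mathfrak g_{\mathrm{ad}}$. *)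

theory Defs
  imports Complex_Main "HOL-Library.Multiset" "HOL-Library.Poly_Mapping" "HOL-Library.Product_Plus"
begin

section \<open>Complex vector spaces\<close>

class complex_vector = ab_group_add +
  fixes scaleC :: "complex \<Rightarrow> 'a \<Rightarrow> 'a"  (infixr "*\<^sub>C" 75)
  assumes scaleC_add_right: "c *\<^sub>C (x + y) = c *\<^sub>C x + c *\<^sub>C y"
    and scaleC_add_left: "(c + d) *\<^sub>C x = c *\<^sub>C x + d *\<^sub>C x"
    and scaleC_scaleC: "c *\<^sub>C d *\<^sub>C x = (c * d) *\<^sub>C x"
    and scaleC_one: "1 *\<^sub>C x = x"

global_interpretation cvs: vector_space "scaleC :: complex \<Rightarrow> 'a \<Rightarrow> 'a::complex_vector"
  by unfold_locales (simp_all add: scaleC_add_right scaleC_add_left scaleC_scaleC scaleC_one)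

instantiation complex :: complex_vector
begin
definition scaleC_complex_def: "c *\<^sub>C (z :: complex) = c * z"
instance by standard (simp_all add: scaleC_complex_def algebra_simps)
end

instantiation prod :: (complex_vector, complex_vector) complex_vector
begin
definition scaleC_prod_def: "c *\<^sub>C p = (c *\<^sub>C fst p, c *\<^sub>C snd p)"
instance
  by standard
    (simp_all add: scaleC_prod_def scaleC_add_right scaleC_add_left scaleC_scaleC scaleC_one)
end

instantiation poly_mapping :: (type, complex_vector) complex_vector
begin
lift_definition scaleC_poly_mapping :: "complex \<Rightarrow> ('a \<Rightarrow>\<^sub>0 'b) \<Rightarrow> ('a \<Rightarrow>\<^sub>0 'b)"
  is "\<lambda>c f k. c *\<^sub>C f k"
  by (erule rev_finite_subset) auto
instance
  by standard
    (transfer, simp add: scaleC_add_right scaleC_add_left scaleC_scaleC scaleC_one fun_eq_iff)+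
end

lemma lookup_scaleC: "Poly_Mapping.lookup (c *\<^sub>C p) k = c *\<^sub>C Poly_Mapping.lookup p k"
  by transfer simp

definition fin_dim :: "'a::complex_vector set \<Rightarrow> bool" where
  "fin_dim S \<longleftrightarrow> (\<exists>B. finite B \<and> S \<subseteq> cvs.span B)"

definition clinear :: "('a::complex_vector \<Rightarrow> 'b::complex_vector) \<Rightarrow> bool" where
  "clinear f \<longleftrightarrow> (\<forall>x y. f (x + y) = f x + f y) \<and> (\<forall>c x. f (c *\<^sub>C x) = c *\<^sub>C f x)"

text \<open>\<open>'k \<Rightarrow>\<^sub>0 complex\<close> is the free vector space on the set \<open>'k\<close>; \<open>lin_ext f\<close> is the linear
  extension of \<open>f\<close> to it.\<close>

definition lin_ext :: "('k \<Rightarrow> 'c::complex_vector) \<Rightarrow> ('k \<Rightarrow>\<^sub>0 complex) \<Rightarrow> 'c" where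
  "lin_ext f p = (\<Sum>k\<in>Poly_Mapping.keys p. Poly_Mapping.lookup p k *\<^sub>C f k)"

abbreviation basis_vec :: "'k \<Rightarrow> ('k \<Rightarrow>\<^sub>0 complex)" where
  "basis_vec k \<equiv> Poly_Mapping.single k 1"

lemma lin_ext_superset:
  assumes "finite A" "Poly_Mapping.keys p \<subseteq> A"
  shows "lin_ext f p = (\<Sum>k\<in>A. Poly_Mapping.lookup p k *\<^sub>C f k)"
  unfolding lin_ext_def
  by (rule sum.mono_neutral_left) (use assms in \<open>auto simp: in_keys_iff\<close>)

lemma lin_ext_add: "lin_ext f (p + q) = lin_ext f p + lin_ext f q"
proof -
  let ?A = "Poly_Mapping.keys p \<union> Poly_Mapping.keys q"
  have A: "finite ?A" by simp
  have k: "Poly_Mapping.keys (p + q) \<subseteq> ?A" by (rule Poly_Mapping.keys_add)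
  show ?thesis
    by (simp add: lin_ext_superset[OF A k] lin_ext_superset[OF A, of p] lin_ext_superset[OF A, of q]
        lookup_add scaleC_add_left sum.distrib)
qed

lemma lin_ext_scaleC: "lin_ext f (c *\<^sub>C p) = c *\<^sub>C lin_ext f p"
proof -
  have k: "Poly_Mapping.keys (c *\<^sub>C p) \<subseteq> Poly_Mapping.keys p"
    by (auto simp: in_keys_iff lookup_scaleC)
  have "lin_ext f (c *\<^sub>C p) = (\<Sum>k\<in>Poly_Mapping.keys p. Poly_Mapping.lookup (c *\<^sub>C p) k *\<^sub>C f k)"
    by (rule lin_ext_superset[OF finite_keys k])
  then show ?thesis
    by (simp add: lin_ext_def lookup_scaleC cvs.scale_sum_right scaleC_complex_def)
qed

lemma lin_ext_diff: "lin_ext f (p - q) = lin_ext f p - lin_ext f q"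
  using lin_ext_add[of f "p - q" q] by simp

lemma lin_ext_single: "lin_ext f (Poly_Mapping.single k c) = c *\<^sub>C f k"
  by (cases "c = 0") (simp_all add: lin_ext_def)

lemma lin_ext_span_zero:
  assumes "\<And>r. r \<in> R \<Longrightarrow> lin_ext f r = 0" "p \<in> cvs.span R"
  shows "lin_ext f p = 0"
  using assms(2)
  by (induction rule: cvs.span_induct_alt)
    (simp_all add: lin_ext_add lin_ext_scaleC assms(1), simp add: lin_ext_def)

lemma equivp_span: "equivp (\<lambda>p q :: 'k::complex_vector. p - q \<in> cvs.span R)"
proof (rule equivpI)
  show "reflp (\<lambda>p q. p - q \<in> cvs.span R)" by (rule reflpI) (simp add: cvs.span_zero)
  show "symp (\<lambda>p q. p - q \<in> cvs.span R)"
  proof (rule sympI)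
    fix p q :: 'k assume "p - q \<in> cvs.span R"
    then have "- (p - q) \<in> cvs.span R" by (rule cvs.span_neg)
    then show "q - p \<in> cvs.span R" by simp
  qed
  show "transp (\<lambda>p q. p - q \<in> cvs.span R)"
  proof (rule transpI)
    fix p q s :: 'k assume "p - q \<in> cvs.span R" "q - s \<in> cvs.span R"
    then have "(p - q) + (q - s) \<in> cvs.span R" by (rule cvs.span_add)
    then show "p - s \<in> cvs.span R" by simp
  qed
qed

lemma span_respects_add:
  assumes "p - p' \<in> cvs.span R" "q - q' \<in> cvs.span R"
  shows "(p + q) - (p' + q') \<in> cvs.span R"
  using cvs.span_add[OF assms] by (simp add: algebra_simps)

lemma span_respects_diff:
  assumes "p - p' \<in> cvs.span R" "q - q' \<in> cvs.span R"
  shows "(p - q) - (p' - q') \<in> cvs.span R"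
  using cvs.span_diff[OF assms] by (simp add: algebra_simps)

lemma span_respects_uminus:
  assumes "p - p' \<in> cvs.span R"
  shows "(- p) - (- p') \<in> cvs.span R"
  using cvs.span_neg[OF assms] by (simp add: algebra_simps)

lemma span_respects_scaleC:
  assumes "p - p' \<in> cvs.span R"
  shows "c *\<^sub>C p - c *\<^sub>C p' \<in> cvs.span R"
  using cvs.span_scale[OF assms] by (simp add: cvs.scale_right_diff_distrib)

section \<open>Tensor products\<close>

definition tensor_rel :: "('a::complex_vector \<times> 'b::complex_vector \<Rightarrow>\<^sub>0 complex) set" where
  "tensor_rel =
     {basis_vec (a + a', b) - basis_vec (a, b) - basis_vec (a', b) | a a' b. True} \<union>
     {basis_vec (a, b + b') - basis_vec (a, b) - basis_vec (a, b') | a b b'. True} \<union>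
     {basis_vec (c *\<^sub>C a, b) - c *\<^sub>C basis_vec (a, b) | c a b. True} \<union>
     {basis_vec (a, c *\<^sub>C b) - c *\<^sub>C basis_vec (a, b) | c a b. True}"

quotient_type (overloaded) ('a, 'b) tensor =
  "'a::complex_vector \<times> 'b::complex_vector \<Rightarrow>\<^sub>0 complex" /
  "\<lambda>p q. p - q \<in> cvs.span tensor_rel"
  by (rule equivp_span)

instantiation tensor :: (complex_vector, complex_vector) complex_vector
begin
lift_definition zero_tensor :: "('a, 'b) tensor" is 0 .
lift_definition plus_tensor :: "('a, 'b) tensor \<Rightarrow> ('a, 'b) tensor \<Rightarrow> ('a, 'b) tensor"
  is "(+)" by (rule span_respects_add)
lift_definition minus_tensor :: "('a, 'b) tensor \<Rightarrow> ('a, 'b) tensor \<Rightarrow> ('a, 'b) tensor"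
  is "(-)" by (rule span_respects_diff)
lift_definition uminus_tensor :: "('a, 'b) tensor \<Rightarrow> ('a, 'b) tensor"
  is uminus by (rule span_respects_uminus)
lift_definition scaleC_tensor :: "complex \<Rightarrow> ('a, 'b) tensor \<Rightarrow> ('a, 'b) tensor"
  is scaleC by (rule span_respects_scaleC)
instance
  by standard
    (transfer, simp add: cvs.span_zero algebra_simps scaleC_add_right scaleC_add_left
      scaleC_scaleC scaleC_one)+
end

lift_definition tensor_prod ::
  "'a::complex_vector \<Rightarrow> 'b::complex_vector \<Rightarrow> ('a, 'b) tensor"  (infixr "\<otimes>\<^sub>C" 70)
  is "\<lambda>a b. basis_vec (a, b)" .

text \<open>The linear map \<open>a \<otimes>\<^sub>C b \<mapsto> f a b\<close>, meaningful for bilinear \<open>f\<close>; see \<open>tensor_lift_prod\<close>.\<close>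

definition tensor_lift ::
  "('a::complex_vector \<Rightarrow> 'b::complex_vector \<Rightarrow> 'c::complex_vector) \<Rightarrow> ('a, 'b) tensor \<Rightarrow> 'c" where
  "tensor_lift f t = lin_ext (\<lambda>(a, b). f a b) (rep_tensor t)"

definition tensor_map ::
  "('a::complex_vector \<Rightarrow> 'c::complex_vector) \<Rightarrow> ('b::complex_vector \<Rightarrow> 'd::complex_vector) \<Rightarrow>
   ('a, 'b) tensor \<Rightarrow> ('c, 'd) tensor" where
  "tensor_map f g = tensor_lift (\<lambda>a b. f a \<otimes>\<^sub>C g b)"

text \<open>The diagonal action of one Lie algebra element, given its actions \<open>f\<close> and \<open>g\<close> on the two
  factors.\<close>

definition tensor_diag ::
  "('a::complex_vector \<Rightarrow> 'a) \<Rightarrow> ('b::complex_vector \<Rightarrow> 'b) \<Rightarrow> ('a, 'b) tensor \<Rightarrow> ('a, 'b) tensor" where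
  "tensor_diag f g t = tensor_map f id t + tensor_map id g t"

lemma tensor_lift_abs:
  fixes f :: "'a::complex_vector \<Rightarrow> 'b::complex_vector \<Rightarrow> 'c::complex_vector"
  assumes "\<And>b. clinear (\<lambda>a. f a b)" "\<And>a. clinear (f a)"
  shows "tensor_lift f (abs_tensor p) = lin_ext (\<lambda>(a, b). f a b) p"
proof -
  have "rep_tensor (abs_tensor p) - p \<in> cvs.span tensor_rel"
    using Quotient_rep_abs[OF Quotient_tensor, of p] by (simp add: cvs.span_zero)
  moreover have "lin_ext (\<lambda>(a, b). f a b) r = 0" if "r \<in> tensor_rel" for r
    using that assms
    by (auto simp: tensor_rel_def lin_ext_diff lin_ext_scaleC lin_ext_single clinear_def scaleC_one)
  ultimately have "lin_ext (\<lambda>(a, b). f a b) (rep_tensor (abs_tensor p) - p) = 0"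
    by (rule lin_ext_span_zero[rotated])
  then show ?thesis by (simp add: tensor_lift_def lin_ext_diff)
qed

lemma tensor_lift_clinear:
  fixes f :: "'a::complex_vector \<Rightarrow> 'b::complex_vector \<Rightarrow> 'c::complex_vector"
  assumes "\<And>b. clinear (\<lambda>a. f a b)" "\<And>a. clinear (f a)"
  shows "clinear (tensor_lift f)"
  unfolding clinear_def
proof (intro conjI allI)
  fix s t :: "('a, 'b) tensor" and c :: complex
  obtain p q where s: "s = abs_tensor p" and t: "t = abs_tensor q"
    by (metis Quotient_abs_rep[OF Quotient_tensor])
  show "tensor_lift f (s + t) = tensor_lift f s + tensor_lift f t"
    unfolding s t plus_tensor.abs_eq tensor_lift_abs[OF assms] lin_ext_add ..
  show "tensor_lift f (c *\<^sub>C s) = c *\<^sub>C tensor_lift f s"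
    unfolding s scaleC_tensor.abs_eq tensor_lift_abs[OF assms] lin_ext_scaleC ..
qed

lemma tensor_lift_prod:
  fixes f :: "'a::complex_vector \<Rightarrow> 'b::complex_vector \<Rightarrow> 'c::complex_vector"
  assumes "\<And>b. clinear (\<lambda>a. f a b)" "\<And>a. clinear (f a)"
  shows "tensor_lift f (a \<otimes>\<^sub>C b) = f a b"
  unfolding tensor_prod.abs_eq tensor_lift_abs[OF assms] by (simp add: lin_ext_single scaleC_one)

section \<open>The symmetric algebra\<close>

text \<open>\<open>'a multiset \<Rightarrow>\<^sub>0 complex\<close> is the polynomial ring with one variable for each element of
  \<open>'a\<close>. The span of \<open>sym_rel\<close> is the ideal generated by the relations expressing that the
  variable depends linearly on the element, so the quotient is \<open>S('a)\<close>.\<close>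

definition sym_rel :: "('a::complex_vector multiset \<Rightarrow>\<^sub>0 complex) set" where
  "sym_rel =
     {basis_vec (add_mset (x + y) M) - basis_vec (add_mset x M) - basis_vec (add_mset y M) | x y M. True} \<union>
     {basis_vec (add_mset (c *\<^sub>C x) M) - c *\<^sub>C basis_vec (add_mset x M) | c x M. True}"

lemma scaleC_mult_poly_mapping:
  fixes p q :: "'k::comm_monoid_add \<Rightarrow>\<^sub>0 complex"
  shows "(c *\<^sub>C p) * q = c *\<^sub>C (p * q)" "p * (c *\<^sub>C q) = c *\<^sub>C (p * q)"
proof -
  have s: "c *\<^sub>C p = Poly_Mapping.single 0 c * p" for c and p :: "'k \<Rightarrow>\<^sub>0 complex"
  proof -
    have "c *\<^sub>C p = Poly_Mapping.map ((*) c) p"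
      by (rule poly_mapping_eqI)
        (simp add: lookup_scaleC scaleC_complex_def Poly_Mapping.map.rep_eq when_def)
    then show ?thesis by (simp add: mult_map_scale_conv_mult)
  qed
  show "(c *\<^sub>C p) * q = c *\<^sub>C (p * q)" "p * (c *\<^sub>C q) = c *\<^sub>C (p * q)"
    unfolding s[of c] by (simp_all add: algebra_simps)
qed

lemma lin_ext_basis_vec: "lin_ext basis_vec p = p"
proof (rule poly_mapping_eqI)
  fix k
  have sum: "Poly_Mapping.lookup (\<Sum>x\<in>A. g x) k = (\<Sum>x\<in>A. Poly_Mapping.lookup (g x) k)"
    if "finite A" for A and g :: "'a \<Rightarrow> 'a \<Rightarrow>\<^sub>0 complex"
    using that by (induction A) (simp_all add: lookup_add)
  show "Poly_Mapping.lookup (lin_ext basis_vec p) k = Poly_Mapping.lookup p k"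
    by (simp add: lin_ext_def sum lookup_scaleC scaleC_complex_def lookup_single when_def
        if_distrib[of "\<lambda>z. _ * z"] sum.delta in_keys_iff cong: if_cong)
qed

lemma sym_rel_mult_basis_vec:
  assumes "r \<in> sym_rel" shows "basis_vec N * r \<in> sym_rel"
proof -
  have "(\<exists>x y M. r = basis_vec (add_mset (x + y) M) - basis_vec (add_mset x M) - basis_vec (add_mset y M)) \<or>
        (\<exists>c x M. r = basis_vec (add_mset (c *\<^sub>C x) M) - c *\<^sub>C basis_vec (add_mset x M))"
    using assms by (auto simp: sym_rel_def)
  then show ?thesis
  proof (elim disjE exE)
    fix x y M assume "r = basis_vec (add_mset (x + y) M) - basis_vec (add_mset x M) - basis_vec (add_mset y M)"
    then have "basis_vec N * r = basis_vec (add_mset (x + y) (N + M)) - basis_vec (add_mset x (N + M))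
        - basis_vec (add_mset y (N + M))"
      by (simp add: right_diff_distrib mult_single)
    then show ?thesis unfolding sym_rel_def by blast
  next
    fix c x M assume "r = basis_vec (add_mset (c *\<^sub>C x) M) - c *\<^sub>C basis_vec (add_mset x M)"
    then have "basis_vec N * r = basis_vec (add_mset (c *\<^sub>C x) (N + M)) - c *\<^sub>C basis_vec (add_mset x (N + M))"
      by (simp add: right_diff_distrib scaleC_mult_poly_mapping mult_single)
    then show ?thesis unfolding sym_rel_def by blast
  qed
qed

lemma span_sym_rel_mult:
  assumes "r \<in> cvs.span sym_rel" shows "q * r \<in> cvs.span sym_rel"
proof -
  have mono: "basis_vec N * r \<in> cvs.span sym_rel" for N
    using assms
    by (induction rule: cvs.span_induct_alt)
      (simp_all add: cvs.span_zero distrib_left scaleC_mult_poly_mapping cvs.span_add cvs.span_scale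
        cvs.span_base sym_rel_mult_basis_vec)
  have "q * r = lin_ext basis_vec q * r" by (simp add: lin_ext_basis_vec)
  also have "\<dots> = (\<Sum>k\<in>Poly_Mapping.keys q. Poly_Mapping.lookup q k *\<^sub>C (basis_vec k * r))"
    by (simp add: lin_ext_def sum_distrib_right scaleC_mult_poly_mapping)
  also have "\<dots> \<in> cvs.span sym_rel"
    by (intro cvs.span_sum cvs.span_scale mono)
  finally show ?thesis .
qed

lemma one_notin_span_sym_rel: "1 \<notin> cvs.span sym_rel"
proof
  assume "1 \<in> cvs.span (sym_rel :: ('a multiset \<Rightarrow>\<^sub>0 complex) set)"
  then have "lin_ext (\<lambda>M. if M = {#} then 1 else 0 :: complex) (1 :: 'a multiset \<Rightarrow>\<^sub>0 complex) = 0"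
    by (rule lin_ext_span_zero[rotated])
      (auto simp: sym_rel_def lin_ext_diff lin_ext_scaleC lin_ext_single)
  then show False
    by (simp add: lin_ext_single scaleC_one flip: single_one)
qed

quotient_type (overloaded) 'a sym = "'a::complex_vector multiset \<Rightarrow>\<^sub>0 complex" /
  "\<lambda>p q. p - q \<in> cvs.span sym_rel"
  by (rule equivp_span)

instantiation sym :: (complex_vector) complex_vector
begin
lift_definition zero_sym :: "'a sym" is 0 .
lift_definition plus_sym :: "'a sym \<Rightarrow> 'a sym \<Rightarrow> 'a sym" is "(+)" by (rule span_respects_add)
lift_definition minus_sym :: "'a sym \<Rightarrow> 'a sym \<Rightarrow> 'a sym" is "(-)" by (rule span_respects_diff)
lift_definition uminus_sym :: "'a sym \<Rightarrow> 'a sym" is uminus by (rule span_respects_uminus)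
lift_definition scaleC_sym :: "complex \<Rightarrow> 'a sym \<Rightarrow> 'a sym" is scaleC by (rule span_respects_scaleC)
instance
  by standard
    (transfer, simp add: cvs.span_zero algebra_simps scaleC_add_right scaleC_add_left
      scaleC_scaleC scaleC_one)+
end

instantiation sym :: (complex_vector) comm_ring_1
begin
lift_definition one_sym :: "'a sym" is 1 .
lift_definition times_sym :: "'a sym \<Rightarrow> 'a sym \<Rightarrow> 'a sym" is "(*)"
proof -
  fix p p' q q' :: "'a multiset \<Rightarrow>\<^sub>0 complex"
  assume "p - p' \<in> cvs.span sym_rel" "q - q' \<in> cvs.span sym_rel"
  then have "q * (p - p') + p' * (q - q') \<in> cvs.span sym_rel"
    by (intro cvs.span_add span_sym_rel_mult)
  then show "p * q - p' * q' \<in> cvs.span sym_rel" by (simp add: algebra_simps)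
qed
instance
proof
  fix a b c :: "'a sym"
  show "a * b * c = a * (b * c)" by transfer (simp add: cvs.span_zero mult.assoc)
  show "a * b = b * a" by transfer (simp add: cvs.span_zero mult.commute)
  show "1 * a = a" by transfer (simp add: cvs.span_zero)
  show "(a + b) * c = a * c + b * c" by transfer (simp add: cvs.span_zero distrib_right)
  have "- (1 :: 'a multiset \<Rightarrow>\<^sub>0 complex) \<notin> cvs.span sym_rel"
    using one_notin_span_sym_rel cvs.span_neg[of "- 1 :: 'a multiset \<Rightarrow>\<^sub>0 complex" sym_rel] by auto
  then show "(0 :: 'a sym) \<noteq> 1" by transfer simp
qed
end

lift_definition sym_monom :: "'a::complex_vector multiset \<Rightarrow> 'a sym" is basis_vec .

abbreviation sym_gen :: "'a::complex_vector \<Rightarrow> 'a sym" where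
  "sym_gen x \<equiv> sym_monom {#x#}"

definition sym_pow :: "nat \<Rightarrow> 'a::complex_vector sym set" where
  "sym_pow p = cvs.span {sym_monom M | M. size M = p}"

text \<open>The linear map sending the product of the elements of \<open>M\<close> to \<open>f M\<close>, meaningful if \<open>f\<close> is
  multilinear; see \<open>sym_lift_monom\<close>.\<close>

definition sym_lift :: "('a::complex_vector multiset \<Rightarrow> 'c::complex_vector) \<Rightarrow> 'a sym \<Rightarrow> 'c" where
  "sym_lift f s = lin_ext f (rep_sym s)"

lemma sym_lift_abs:
  fixes f :: "'a::complex_vector multiset \<Rightarrow> 'c::complex_vector"
  assumes "\<And>M. clinear (\<lambda>x. f (add_mset x M))"
  shows "sym_lift f (abs_sym p) = lin_ext f p"
proof -
  have "rep_sym (abs_sym p) - p \<in> cvs.span sym_rel"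
    using Quotient_rep_abs[OF Quotient_sym, of p] by (simp add: cvs.span_zero)
  moreover have "lin_ext f r = 0" if "r \<in> sym_rel" for r
    using that assms
    by (auto simp: sym_rel_def lin_ext_diff lin_ext_scaleC lin_ext_single clinear_def scaleC_one)
  ultimately have "lin_ext f (rep_sym (abs_sym p) - p) = 0"
    by (rule lin_ext_span_zero[rotated])
  then show ?thesis by (simp add: sym_lift_def lin_ext_diff)
qed

lemma sym_lift_clinear:
  fixes f :: "'a::complex_vector multiset \<Rightarrow> 'c::complex_vector"
  assumes "\<And>M. clinear (\<lambda>x. f (add_mset x M))"
  shows "clinear (sym_lift f)"
  unfolding clinear_def
proof (intro conjI allI)
  fix s t :: "'a sym" and c :: complex
  obtain p q where s: "s = abs_sym p" and t: "t = abs_sym q"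
    by (metis Quotient_abs_rep[OF Quotient_sym])
  show "sym_lift f (s + t) = sym_lift f s + sym_lift f t"
    unfolding s t plus_sym.abs_eq sym_lift_abs[OF assms] lin_ext_add ..
  show "sym_lift f (c *\<^sub>C s) = c *\<^sub>C sym_lift f s"
    unfolding s scaleC_sym.abs_eq sym_lift_abs[OF assms] lin_ext_scaleC ..
qed

lemma sym_lift_monom:
  fixes f :: "'a::complex_vector multiset \<Rightarrow> 'c::complex_vector"
  assumes "\<And>M. clinear (\<lambda>x. f (add_mset x M))"
  shows "sym_lift f (sym_monom M) = f M"
  unfolding sym_monom.abs_eq sym_lift_abs[OF assms] by (simp add: lin_ext_single scaleC_one)

section \<open>The exterior algebra\<close>

text \<open>The underlying vector space of the exterior algebra, the direct sum of all
  \<open>\<And>\<^sup>j 'a\<close>: the free vector space on all words modulo multilinearity and the vanishing of words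
  with a repeated letter. The relations are homogeneous in the length of words.\<close>

definition ext_rel :: "('a::complex_vector list \<Rightarrow>\<^sub>0 complex) set" where
  "ext_rel =
     {basis_vec (xs @ (x + y) # ys) - basis_vec (xs @ x # ys) - basis_vec (xs @ y # ys) | x y xs ys. True} \<union>
     {basis_vec (xs @ (c *\<^sub>C x) # ys) - c *\<^sub>C basis_vec (xs @ x # ys) | c x xs ys. True} \<union>
     {basis_vec xs | xs. \<not> distinct xs}"

quotient_type (overloaded) 'a ext = "'a::complex_vector list \<Rightarrow>\<^sub>0 complex" /
  "\<lambda>p q. p - q \<in> cvs.span ext_rel"
  by (rule equivp_span)

instantiation ext :: (complex_vector) complex_vector
begin
lift_definition zero_ext :: "'a ext" is 0 .
lift_definition plus_ext :: "'a ext \<Rightarrow> 'a ext \<Rightarrow> 'a ext" is "(+)" by (rule span_respects_add)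
lift_definition minus_ext :: "'a ext \<Rightarrow> 'a ext \<Rightarrow> 'a ext" is "(-)" by (rule span_respects_diff)
lift_definition uminus_ext :: "'a ext \<Rightarrow> 'a ext" is uminus by (rule span_respects_uminus)
lift_definition scaleC_ext :: "complex \<Rightarrow> 'a ext \<Rightarrow> 'a ext" is scaleC by (rule span_respects_scaleC)
instance
  by standard
    (transfer, simp add: cvs.span_zero algebra_simps scaleC_add_right scaleC_add_left
      scaleC_scaleC scaleC_one)+
end

lift_definition wedge :: "'a::complex_vector list \<Rightarrow> 'a ext" is basis_vec .

definition ext_pow :: "nat \<Rightarrow> 'a::complex_vector ext set" where
  "ext_pow j = cvs.span {wedge xs | xs. length xs = j}"

text \<open>The linear map \<open>wedge xs \<mapsto> f xs\<close>, meaningful if \<open>f\<close> is multilinear and alternating; see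
  \<open>ext_lift_wedge\<close>.\<close>

definition ext_lift :: "('a::complex_vector list \<Rightarrow> 'c::complex_vector) \<Rightarrow> 'a ext \<Rightarrow> 'c" where
  "ext_lift f w = lin_ext f (rep_ext w)"

lemma ext_lift_abs:
  fixes f :: "'a::complex_vector list \<Rightarrow> 'c::complex_vector"
  assumes "\<And>xs ys. clinear (\<lambda>x. f (xs @ x # ys))" "\<And>xs. \<not> distinct xs \<Longrightarrow> f xs = 0"
  shows "ext_lift f (abs_ext p) = lin_ext f p"
proof -
  have "rep_ext (abs_ext p) - p \<in> cvs.span ext_rel"
    using Quotient_rep_abs[OF Quotient_ext, of p] by (simp add: cvs.span_zero)
  moreover have "lin_ext f r = 0" if "r \<in> ext_rel" for r
    using that assms
    by (auto simp: ext_rel_def lin_ext_diff lin_ext_scaleC lin_ext_single clinear_def scaleC_one)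
  ultimately have "lin_ext f (rep_ext (abs_ext p) - p) = 0"
    by (rule lin_ext_span_zero[rotated])
  then show ?thesis by (simp add: ext_lift_def lin_ext_diff)
qed

lemma ext_lift_clinear:
  fixes f :: "'a::complex_vector list \<Rightarrow> 'c::complex_vector"
  assumes "\<And>xs ys. clinear (\<lambda>x. f (xs @ x # ys))" "\<And>xs. \<not> distinct xs \<Longrightarrow> f xs = 0"
  shows "clinear (ext_lift f)"
  unfolding clinear_def
proof (intro conjI allI)
  fix s t :: "'a ext" and c :: complex
  have abs: "ext_lift f (abs_ext p) = lin_ext f p" for p
    by (rule ext_lift_abs) (use assms in auto)
  obtain p q where s: "s = abs_ext p" and t: "t = abs_ext q"
    by (metis Quotient_abs_rep[OF Quotient_ext])
  show "ext_lift f (s + t) = ext_lift f s + ext_lift f t"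
    unfolding s t plus_ext.abs_eq abs lin_ext_add ..
  show "ext_lift f (c *\<^sub>C s) = c *\<^sub>C ext_lift f s"
    unfolding s scaleC_ext.abs_eq abs lin_ext_scaleC ..
qed

lemma ext_lift_wedge:
  fixes f :: "'a::complex_vector list \<Rightarrow> 'c::complex_vector"
  assumes "\<And>xs ys. clinear (\<lambda>x. f (xs @ x # ys))" "\<And>xs. \<not> distinct xs \<Longrightarrow> f xs = 0"
  shows "ext_lift f (wedge xs) = f xs"
proof -
  have "ext_lift f (abs_ext (basis_vec xs)) = lin_ext f (basis_vec xs)"
    by (rule ext_lift_abs) (use assms in auto)
  then show ?thesis by (simp add: wedge.abs_eq lin_ext_single)
qed

section \<open>Lie algebras and their modules\<close>

definition lie_algebra :: "('g::complex_vector \<Rightarrow> 'g \<Rightarrow> 'g) \<Rightarrow> bool" where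
  "lie_algebra lb \<longleftrightarrow>
     (\<forall>y. clinear (\<lambda>x. lb x y)) \<and> (\<forall>x. clinear (lb x)) \<and> (\<forall>x. lb x x = 0) \<and>
     (\<forall>x y z. lb x (lb y z) + lb y (lb z x) + lb z (lb x y) = 0)"

definition lie_ideal :: "('g::complex_vector \<Rightarrow> 'g \<Rightarrow> 'g) \<Rightarrow> 'g set \<Rightarrow> bool" where
  "lie_ideal lb I \<longleftrightarrow> cvs.subspace I \<and> (\<forall>x. \<forall>y\<in>I. lb x y \<in> I)"

definition simple_lie_algebra :: "('g::complex_vector \<Rightarrow> 'g \<Rightarrow> 'g) \<Rightarrow> bool" where
  "simple_lie_algebra lb \<longleftrightarrow>
     lie_algebra lb \<and> fin_dim (UNIV :: 'g set) \<and> (\<exists>x y. lb x y \<noteq> 0) \<and>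
     (\<forall>I. lie_ideal lb I \<longrightarrow> I = {0} \<or> I = UNIV)"

definition lie_module_on ::
  "('l::complex_vector \<Rightarrow> 'l \<Rightarrow> 'l) \<Rightarrow> 'm::complex_vector set \<Rightarrow> ('l \<Rightarrow> 'm \<Rightarrow> 'm) \<Rightarrow> bool" where
  "lie_module_on lb C ac \<longleftrightarrow>
     cvs.subspace C \<and>
     (\<forall>x. \<forall>m\<in>C. ac x m \<in> C) \<and>
     (\<forall>x. \<forall>m\<in>C. \<forall>m'\<in>C. ac x (m + m') = ac x m + ac x m') \<and>
     (\<forall>x c. \<forall>m\<in>C. ac x (c *\<^sub>C m) = c *\<^sub>C ac x m) \<and>
     (\<forall>m\<in>C. clinear (\<lambda>x. ac x m)) \<and>
     (\<forall>x y. \<forall>m\<in>C. ac (lb x y) m = ac x (ac y m) - ac y (ac x m))"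

definition simple_module ::
  "('l::complex_vector \<Rightarrow> 'l \<Rightarrow> 'l) \<Rightarrow> ('l \<Rightarrow> 'm::complex_vector \<Rightarrow> 'm) \<Rightarrow> bool" where
  "simple_module lb ac \<longleftrightarrow>
     lie_module_on lb UNIV ac \<and> (UNIV :: 'm set) \<noteq> {0} \<and>
     (\<forall>C. cvs.subspace C \<and> (\<forall>x. \<forall>m\<in>C. ac x m \<in> C) \<longrightarrow> C = {0} \<or> C = UNIV)"

section \<open>Dominant integral weights and highest weight modules\<close>

text \<open>For semisimple Lie algebras, Cartan subalgebras are the self-centralizing abelian subalgebras
  all of whose elements are ad-diagonalizable.\<close>

definition cartan_subalgebra :: "('g::complex_vector \<Rightarrow> 'g \<Rightarrow> 'g) \<Rightarrow> 'g set \<Rightarrow> bool" where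
  "cartan_subalgebra lb H \<longleftrightarrow>
     cvs.subspace H \<and> (\<forall>h\<in>H. \<forall>h'\<in>H. lb h h' = 0) \<and>
     (\<forall>x. (\<forall>h\<in>H. lb h x = 0) \<longrightarrow> x \<in> H) \<and>
     (\<forall>h\<in>H. cvs.span {x. \<exists>c. lb h x = c *\<^sub>C x} = UNIV)"

text \<open>A linear functional on \<open>H\<close> is represented by the function extending it by zero outside
  \<open>H\<close>, so that functionals are equal iff the functions are.\<close>

definition dual_space :: "'g::complex_vector set \<Rightarrow> ('g \<Rightarrow> complex) set" where
  "dual_space H =
     {\<phi>. (\<forall>x\<in>H. \<forall>y\<in>H. \<phi> (x + y) = \<phi> x + \<phi> y) \<and> (\<forall>c. \<forall>x\<in>H. \<phi> (c *\<^sub>C x) = c * \<phi> x) \<and>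
         (\<forall>x. x \<notin> H \<longrightarrow> \<phi> x = 0)}"

definition root_space ::
  "('g::complex_vector \<Rightarrow> 'g \<Rightarrow> 'g) \<Rightarrow> 'g set \<Rightarrow> ('g \<Rightarrow> complex) \<Rightarrow> 'g set" where
  "root_space lb H \<alpha> = {x. \<forall>h\<in>H. lb h x = \<alpha> h *\<^sub>C x}"

definition roots :: "('g::complex_vector \<Rightarrow> 'g \<Rightarrow> 'g) \<Rightarrow> 'g set \<Rightarrow> ('g \<Rightarrow> complex) set" where
  "roots lb H = {\<alpha> \<in> dual_space H. \<alpha> \<noteq> (\<lambda>_. 0) \<and> root_space lb H \<alpha> \<noteq> {0}}"

definition positive_roots ::
  "('g::complex_vector \<Rightarrow> 'g \<Rightarrow> 'g) \<Rightarrow> 'g set \<Rightarrow> ('g \<Rightarrow> complex) set \<Rightarrow> ('g \<Rightarrow> complex) set" where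
  "positive_roots lb H \<Delta> =
     {\<beta> \<in> roots lb H. \<exists>n :: ('g \<Rightarrow> complex) \<Rightarrow> nat. \<beta> = (\<lambda>h. \<Sum>\<alpha>\<in>\<Delta>. of_nat (n \<alpha>) * \<alpha> h)}"

text \<open>\<open>\<Delta>\<close> is a set of simple roots: linearly independent roots such that every root or its negative
  is a nonnegative integral combination of them.\<close>

definition simple_roots ::
  "('g::complex_vector \<Rightarrow> 'g \<Rightarrow> 'g) \<Rightarrow> 'g set \<Rightarrow> ('g \<Rightarrow> complex) set \<Rightarrow> bool" where
  "simple_roots lb H \<Delta> \<longleftrightarrow>
     finite \<Delta> \<and> \<Delta> \<subseteq> roots lb H \<and>
     (\<forall>c :: ('g \<Rightarrow> complex) \<Rightarrow> complex. (\<forall>h\<in>H. (\<Sum>\<alpha>\<in>\<Delta>. c \<alpha> * \<alpha> h) = 0) \<longrightarrow> (\<forall>\<alpha>\<in>\<Delta>. c \<alpha> = 0)) \<and>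
     (\<forall>\<beta>\<in>roots lb H. \<beta> \<in> positive_roots lb H \<Delta> \<or> (\<lambda>h. - \<beta> h) \<in> positive_roots lb H \<Delta>)"

definition coroot :: "('g::complex_vector \<Rightarrow> 'g \<Rightarrow> 'g) \<Rightarrow> 'g set \<Rightarrow> ('g \<Rightarrow> complex) \<Rightarrow> 'g" where
  "coroot lb H \<alpha> =
     (THE h. h \<in> cvs.span {lb x y | x y. x \<in> root_space lb H \<alpha> \<and> y \<in> root_space lb H (\<lambda>h. - \<alpha> h)} \<and>
             \<alpha> h = 2)"

definition dominant_integral_weights ::
  "('g::complex_vector \<Rightarrow> 'g \<Rightarrow> 'g) \<Rightarrow> 'g set \<Rightarrow> ('g \<Rightarrow> complex) set \<Rightarrow> ('g \<Rightarrow> complex) set" where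
  "dominant_integral_weights lb H \<Delta> = {\<mu> \<in> dual_space H. \<forall>\<alpha>\<in>\<Delta>. \<mu> (coroot lb H \<alpha>) \<in> \<nat>}"

text \<open>The module given by \<open>\<rho>\<close> is a copy of the finite-dimensional simple module \<open>V(\<mu>)\<close> of highest
  weight \<open>\<mu>\<close>, where \<open>\<mu>\<close> is dominant integral (these are exactly the highest weights of
  finite-dimensional simple modules).\<close>

definition is_simple_highest_weight_module ::
  "('g::complex_vector \<Rightarrow> 'g \<Rightarrow> 'g) \<Rightarrow> 'g set \<Rightarrow> ('g \<Rightarrow> complex) set \<Rightarrow> ('g \<Rightarrow> complex) \<Rightarrow>
   ('g \<Rightarrow> 'v::complex_vector \<Rightarrow> 'v) \<Rightarrow> bool" where
  "is_simple_highest_weight_module lb H \<Delta> \<mu> \<rho> \<longleftrightarrow>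
     simple_module lb \<rho> \<and> fin_dim (UNIV :: 'v set) \<and>
     (\<exists>v. v \<noteq> 0 \<and> (\<forall>h\<in>H. \<rho> h v = \<mu> h *\<^sub>C v) \<and>
          (\<forall>\<alpha>\<in>positive_roots lb H \<Delta>. \<forall>x\<in>root_space lb H \<alpha>. \<rho> x v = 0))"

section \<open>The category of graded modules\<close>

text \<open>The bracket of the semidirect product of \<open>\<gg>\<close> with its adjoint module.\<close>

definition sd_bracket ::
  "('g::complex_vector \<Rightarrow> 'g \<Rightarrow> 'g) \<Rightarrow> 'g \<times> 'g \<Rightarrow> 'g \<times> 'g \<Rightarrow> 'g \<times> 'g" where
  "sd_bracket lb = (\<lambda>(x, y) (x', y'). (lb x x', lb x y' + lb y x'))"

record ('g, 'm) gmod =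
  piece :: "nat \<Rightarrow> 'm set"
  act :: "'g \<times> 'g \<Rightarrow> 'm \<Rightarrow> 'm"

definition gcarrier :: "('g, 'm::complex_vector) gmod \<Rightarrow> 'm set" where
  "gcarrier M = cvs.span (\<Union>k. piece M k)"

text \<open>Objects are subspaces of an ambient vector space \<open>'m\<close>; the action is only relevant on
  \<open>gcarrier\<close>, the direct sum of the graded pieces.\<close>

definition G2_object ::
  "('g::complex_vector \<Rightarrow> 'g \<Rightarrow> 'g) \<Rightarrow> ('g, 'm::complex_vector) gmod \<Rightarrow> bool" where
  "G2_object lb M \<longleftrightarrow>
     (\<forall>k. cvs.subspace (piece M k) \<and> fin_dim (piece M k)) \<and>
     (\<forall>n m. (\<forall>k\<le>n. m k \<in> piece M k) \<and> (\<Sum>k\<le>n. m k) = 0 \<longrightarrow> (\<forall>k\<le>n. m k = 0)) \<and>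
     lie_module_on (sd_bracket lb) (gcarrier M) (act M) \<and>
     (\<forall>k x. \<forall>m\<in>piece M k. act M (x, 0) m \<in> piece M k) \<and>
     (\<forall>k y. \<forall>m\<in>piece M k. act M (0, y) m \<in> piece M (k + 1))"

definition G2_morphism ::
  "('g, 'm::complex_vector) gmod \<Rightarrow> ('g, 'n::complex_vector) gmod \<Rightarrow> ('m \<Rightarrow> 'n) \<Rightarrow> bool" where
  "G2_morphism M N f \<longleftrightarrow>
     (\<forall>m\<in>gcarrier M. \<forall>m'\<in>gcarrier M. f (m + m') = f m + f m') \<and>
     (\<forall>c. \<forall>m\<in>gcarrier M. f (c *\<^sub>C m) = c *\<^sub>C f m) \<and>
     (\<forall>a. \<forall>m\<in>gcarrier M. f (act M a m) = act N a (f m)) \<and>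
     (\<forall>k. f ` piece M k \<subseteq> piece N k)"

text \<open>A formula cannot quantify over types, so the types containing the two test objects are
  arguments, to be left arbitrary.\<close>

definition G2_projective ::
  "('g::complex_vector \<Rightarrow> 'g \<Rightarrow> 'g) \<Rightarrow> 'm::complex_vector itself \<Rightarrow> 'n::complex_vector itself \<Rightarrow>
   ('g, 'p::complex_vector) gmod \<Rightarrow> bool" where
  "G2_projective lb _ _ P \<longleftrightarrow>
     G2_object lb P \<and>
     (\<forall>(M :: ('g, 'm) gmod) (N :: ('g, 'n) gmod) e f.
        G2_object lb M \<and> G2_object lb N \<and>
        G2_morphism M N e \<and> e ` gcarrier M = gcarrier N \<and> G2_morphism P N f \<longrightarrow>
        (\<exists>g. G2_morphism P M g \<and> (\<forall>p\<in>gcarrier P. e (g p) = f p)))"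

text \<open>\<open>0 \<rightarrow> P N \<rightarrow> \<dots> \<rightarrow> P 1 \<rightarrow> P 0 \<rightarrow> V \<rightarrow> 0\<close> with maps \<open>d N, \<dots>, d 1, d0\<close> is a projective resolution
  of \<open>V\<close>. The map \<open>d0\<close> is separate from \<open>d\<close> because \<open>V\<close> lives in another type.\<close>

definition G2_projective_resolution ::
  "('g::complex_vector \<Rightarrow> 'g \<Rightarrow> 'g) \<Rightarrow> 'm::complex_vector itself \<Rightarrow> 'n::complex_vector itself \<Rightarrow>
   nat \<Rightarrow> (nat \<Rightarrow> ('g, 'p::complex_vector) gmod) \<Rightarrow> (nat \<Rightarrow> 'p \<Rightarrow> 'p) \<Rightarrow> ('p \<Rightarrow> 'v) \<Rightarrow>
   ('g, 'v::complex_vector) gmod \<Rightarrow> bool" where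
  "G2_projective_resolution lb TM TN N P d d0 V \<longleftrightarrow>
     G2_object lb V \<and>
     (\<forall>j\<le>N. G2_projective lb TM TN (P j)) \<and>
     (\<forall>j\<in>{1..N}. G2_morphism (P j) (P (j - 1)) (d j)) \<and>
     G2_morphism (P 0) V d0 \<and>
     d0 ` gcarrier (P 0) = gcarrier V \<and>
     (\<forall>j\<le>N. {p \<in> gcarrier (P j). if j = 0 then d0 p = 0 else d j p = 0} =
             (if j < N then d (j + 1) ` gcarrier (P (j + 1)) else {0}))"

section \<open>The Koszul complex\<close>

text \<open>\<open>V(\<mu>, r)\<close>, the module \<open>\<rho>\<close> of \<open>\<gg>\<close> placed in degree \<open>r\<close>.\<close>

definition single_degree ::
  "('g \<Rightarrow> 'v::complex_vector \<Rightarrow> 'v) \<Rightarrow> nat \<Rightarrow> ('g, 'v) gmod" where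
  "single_degree \<rho> r = \<lparr>piece = (\<lambda>k. if k = r then UNIV else {0}), act = (\<lambda>(x, y) v. \<rho> x v)\<rparr>"

text \<open>The adjoint action on the symmetric algebra, by derivations, and on the exterior algebra.\<close>

definition sym_ad :: "('g::complex_vector \<Rightarrow> 'g \<Rightarrow> 'g) \<Rightarrow> 'g \<Rightarrow> 'g sym \<Rightarrow> 'g sym" where
  "sym_ad lb x = sym_lift (\<lambda>M. \<Sum>y\<in>#M. sym_monom (add_mset (lb x y) (M - {#y#})))"

definition ext_ad :: "('g::complex_vector \<Rightarrow> 'g \<Rightarrow> 'g) \<Rightarrow> 'g \<Rightarrow> 'g ext \<Rightarrow> 'g ext" where
  "ext_ad lb x = ext_lift (\<lambda>xs. \<Sum>i<length xs. wedge (xs[i := lb x (xs ! i)]))"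

text \<open>\<open>S(\<gg>\<^sub>a\<^sub>d) \<otimes> W\<close> for the submodule \<open>W\<close> of the \<open>\<gg>\<close>-module given by \<open>\<sigma>\<close>, with \<open>W\<close> placed in
  degree \<open>s\<close>.\<close>

definition free_gmod ::
  "('g::complex_vector \<Rightarrow> 'g \<Rightarrow> 'g) \<Rightarrow> 'w::complex_vector set \<Rightarrow> ('g \<Rightarrow> 'w \<Rightarrow> 'w) \<Rightarrow> nat \<Rightarrow>
   ('g, ('g sym, 'w) tensor) gmod" where
  "free_gmod lb W \<sigma> s =
     \<lparr>piece = (\<lambda>k. cvs.span {u \<otimes>\<^sub>C w | u w. \<exists>p. p + s = k \<and> u \<in> sym_pow p \<and> w \<in> W}),
      act = (\<lambda>(x, y) t. tensor_diag (sym_ad lb x) (\<sigma> x) t + tensor_map (\<lambda>u. sym_gen y * u) id t)\<rparr>"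

text \<open>\<open>P\<^sub>j(\<mu>, r)\<close>, where \<open>\<rho>\<close> is the action on \<open>V(\<mu>)\<close>. For \<open>j = 0\<close> the factor
  \<open>\<And>\<^sup>0 \<gg>\<^sub>a\<^sub>d = \<complex>\<close> is kept.\<close>

definition koszul_P ::
  "('g::complex_vector \<Rightarrow> 'g \<Rightarrow> 'g) \<Rightarrow> ('g \<Rightarrow> 'v::complex_vector \<Rightarrow> 'v) \<Rightarrow> nat \<Rightarrow> nat \<Rightarrow>
   ('g, ('g sym, ('g ext, 'v) tensor) tensor) gmod" where
  "koszul_P lb \<rho> r j =
     free_gmod lb (cvs.span {w \<otimes>\<^sub>C v | w v. w \<in> ext_pow j}) (\<lambda>x. tensor_diag (ext_ad lb x) (\<rho> x)) (j + r)"

text \<open>The differentials in positive degrees, given by one formula for all \<open>j > 0\<close>. List positions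
  start at 0, hence the sign \<open>(-1)\<^sup>s\<close>.\<close>

definition koszul_d ::
  "('g::complex_vector sym, ('g ext, 'v::complex_vector) tensor) tensor \<Rightarrow>
   ('g sym, ('g ext, 'v) tensor) tensor" where
  "koszul_d =
     tensor_lift (\<lambda>u. tensor_lift (\<lambda>w v. ext_lift (\<lambda>xs.
       \<Sum>s<length xs. (-1) ^ s *\<^sub>C
         ((u * sym_gen (xs ! s)) \<otimes>\<^sub>C (wedge (take s xs @ drop (Suc s) xs) \<otimes>\<^sub>C v))) w))"

text \<open>The action of \<open>S(\<gg>\<^sub>a\<^sub>d)\<close> on a module on which \<open>y \<in> \<gg>\<^sub>a\<^sub>d\<close> acts by \<open>a y\<close>.\<close>

definition sym_action ::
  "('g::complex_vector \<Rightarrow> 'v::complex_vector \<Rightarrow> 'v) \<Rightarrow> 'g sym \<Rightarrow> 'v \<Rightarrow> 'v" where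
  "sym_action a u v = sym_lift (\<lambda>M. fold_mset a v M) u"

text \<open>The augmentation \<open>u \<otimes> v \<mapsto> u v\<close>, with \<open>v\<close> identified with \<open>wedge [] \<otimes>\<^sub>C v\<close>.\<close>

definition koszul_d0 ::
  "('g, 'v) gmod \<Rightarrow> ('g::complex_vector sym, ('g ext, 'v::complex_vector) tensor) tensor \<Rightarrow> 'v" where
  "koszul_d0 V =
     tensor_lift (\<lambda>u. tensor_lift (\<lambda>w v. ext_lift (\<lambda>xs.
       if xs = [] then sym_action (\<lambda>y. act V (0, y)) u v else 0) w))"

end

theory Submission
  imports Defs "HOL-Library.Function_Algebras" "HOL-Computational_Algebra.Fundamental_Theorem_Algebra"
begin

text \<open>Exactness. Let \<open>m\<^sub>y\<close> be multiplication by \<open>y\<close> on the symmetric factor and \<open>l\<^sub>y\<close> wedge multiplication by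
  \<open>y\<close> on the exterior factor. The differential satisfies \<open>d l\<^sub>y + l\<^sub>y d = m\<^sub>y\<close> and commutes with \<open>m\<^sub>y\<close>, and the
  dual differential \<open>h\<close> satisfies \<open>h m\<^sub>y - m\<^sub>y h = l\<^sub>y\<close> and anticommutes with \<open>l\<^sub>y\<close>. Hence \<open>d h + h d\<close> is
  multiplication by \<open>p + j\<close> on the part of degree \<open>p\<close> in the symmetric and \<open>j\<close> in the exterior algebra, which is
  invertible unless \<open>p = j = 0\<close>.

  Projectivity. Since \<open>S(\<gg>\<^sub>a\<^sub>d) \<otimes> W\<close> is free over \<open>S(\<gg>\<^sub>a\<^sub>d)\<close>, one only has to lift \<open>\<gg>\<close>-maps from \<open>W\<close> along
  surjections of finite-dimensional \<open>\<gg>\<close>-modules with kernel \<open>K\<close>; the obstruction is a 1-cocycle with values in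
  \<open>Hom(W, K)\<close>, and it vanishes by Whitehead's lemma. The latter uses the Casimir operator of a trace form,
  whose nondegeneracy follows without Cartan's criterion from the given Cartan subalgebra: the root
  decomposition contains an \<open>\<ss>\<ll>\<^sub>2\<close>-triple \<open>t, e, f\<close>, the eigenvalues of \<open>t\<close> are integers, and so \<open>tr(t\<^sup>2) = 0\<close>
  would make \<open>t\<close> nilpotent and \<open>e\<close> zero, contrary to the faithfulness of nontrivial modules.\<close>

section \<open>Linear algebra over the complex numbers\<close>

text \<open>Why the lifting problem is finite-dimensional: all generators of a free module sit in
  one degree \<open>s\<close>, a graded surjection is onto in each degree separately, and the graded
  pieces are finite-dimensional.

  Whitehead's lemma is needed for modules that are not assumed simple. The trace form of the module
  at hand, rather than the Killing form, gives a Casimir operator whose trace is the dimension of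
  the Lie algebra, hence nonzero. It may still be singular on the module, so its generalized kernel
  is treated by induction on the dimension. The induction ends at modules with zero action, where a
  cocycle vanishes on all brackets and thus everywhere.

  The obstacle that shapes many statements: modules are subspaces of ambient types, and actions and
  morphisms are controlled on these subspaces only. Composition with a linear projection onto the
  subspace turns them into total linear maps, to which extensionality on generators applies.\<close>

instantiation "fun" :: (type, complex_vector) complex_vector
begin
text \<open>Functions form a vector space here because \<open>Hom(W, K)\<close> is later realised as
  a subspace of a function type.\<close>

definition scaleC_fun_def: "c *\<^sub>C f = (\<lambda>x. c *\<^sub>C f x)"
instance
  by standard
    (simp_all add: scaleC_fun_def fun_eq_iff scaleC_add_right scaleC_add_left scaleC_scaleC scaleC_one)
end

lemma scaleC_fun_apply [simp]: "(c *\<^sub>C f) x = c *\<^sub>C f x"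
  by (simp add: scaleC_fun_def)

declare scaleC_scaleC [simp]

lemma sum_fun_apply: "(\<Sum>i\<in>I. f i) x = (\<Sum>i\<in>I. f i x :: 'b::comm_monoid_add)"
  by (induction I rule: infinite_finite_induct) auto

lemma clinearI:
  assumes "\<And>x y. f (x + y) = f x + f y" "\<And>c x. f (c *\<^sub>C x) = c *\<^sub>C f x"
  shows "clinear f"
  using assms by (simp add: clinear_def)

lemma clinear_add: "clinear f \<Longrightarrow> f (x + y) = f x + f y"
  and clinear_scaleC: "clinear f \<Longrightarrow> f (c *\<^sub>C x) = c *\<^sub>C f x"
  by (auto simp: clinear_def)

lemma clinear_iff_linear: "clinear f \<longleftrightarrow> Vector_Spaces.linear scaleC scaleC f"
  unfolding clinear_def Vector_Spaces.linear_iff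
  by (simp add: cvs.vector_space_axioms)

lemmas clinearD = clinear_iff_linear[THEN iffD1] and linearD = clinear_iff_linear[THEN iffD2]

global_interpretation cvp: vector_space_pair
  "scaleC :: complex \<Rightarrow> 'a \<Rightarrow> 'a::complex_vector" "scaleC :: complex \<Rightarrow> 'b \<Rightarrow> 'b::complex_vector"
  by unfold_locales

lemma clinear_0: "clinear f \<Longrightarrow> f 0 = 0"
  using clinear_scaleC[of f 0 0] by simp

lemma clinear_neg: "clinear f \<Longrightarrow> f (- x) = - f x"
  using clinear_scaleC[of f "-1" x] by simp

lemma clinear_diff: "clinear f \<Longrightarrow> f (x - y) = f x - f y"
  using clinear_add[of f x "- y"] clinear_neg[of f y] by simp

lemma clinear_sum: "clinear f \<Longrightarrow> f (\<Sum>i\<in>I. g i) = (\<Sum>i\<in>I. f (g i))"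
  by (induction I rule: infinite_finite_induct) (auto simp: clinear_0 clinear_add)

lemma clinear_id: "clinear (\<lambda>x. x)"
  and clinear_zero: "clinear (\<lambda>x. 0)"
  and clinear_scale: "clinear (\<lambda>x. c *\<^sub>C x)"
  by (auto intro!: clinearI simp: scaleC_add_right mult.commute)

lemma clinear_compose: "clinear f \<Longrightarrow> clinear g \<Longrightarrow> clinear (\<lambda>x. f (g x))"
  by (auto intro!: clinearI simp: clinear_add clinear_scaleC)

lemma clinear_plus: "clinear f \<Longrightarrow> clinear g \<Longrightarrow> clinear (\<lambda>x. f x + g x)"
  by (auto intro!: clinearI simp: clinear_add clinear_scaleC scaleC_add_right)

lemma clinear_minus: "clinear f \<Longrightarrow> clinear g \<Longrightarrow> clinear (\<lambda>x. f x - g x)"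
  by (auto intro!: clinearI simp: clinear_add clinear_scaleC cvs.scale_right_diff_distrib)

lemma clinear_commutator: "clinear f \<Longrightarrow> clinear g \<Longrightarrow> clinear (\<lambda>x. f (g x) - g (f x))"
  by (rule clinear_minus[OF clinear_compose[of f g] clinear_compose[of g f]])

lemma clinear_scaleC_fun: "clinear f \<Longrightarrow> clinear (\<lambda>x. c *\<^sub>C f x)"
  by (auto intro!: clinearI simp: clinear_add clinear_scaleC scaleC_add_right mult.commute)

lemma clinear_scaleC_left: "clinear f \<Longrightarrow> clinear (\<lambda>x. f x *\<^sub>C v)"
  by (auto intro!: clinearI simp: clinear_add clinear_scaleC scaleC_add_left scaleC_complex_def)

lemma clinear_sum_fun: "(\<And>i. i \<in> I \<Longrightarrow> clinear (f i)) \<Longrightarrow> clinear (\<lambda>x. \<Sum>i\<in>I. f i x)"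
  by (induction I rule: infinite_finite_induct) (auto intro: clinear_zero clinear_plus)

lemma clinear_uminus: "clinear f \<Longrightarrow> clinear (\<lambda>x. - f x)"
  using clinear_minus[OF clinear_zero, of f] by simp

lemma clinear_fst: "clinear fst" and clinear_snd: "clinear snd"
  by (auto intro!: clinearI simp: scaleC_prod_def)

lemma clinear_Pair: "clinear f \<Longrightarrow> clinear g \<Longrightarrow> clinear (\<lambda>x. (f x, g x))"
  by (auto intro!: clinearI simp: clinear_add clinear_scaleC scaleC_prod_def)

lemma clinear_funpow: fixes f :: "'a::complex_vector \<Rightarrow> 'a" shows "clinear f \<Longrightarrow> clinear (f ^^ n)"
proof (induction n)
  case 0 then show ?case using clinear_id by (simp add: id_def)
next
  case (Suc n) then show ?case using clinear_compose by (fastforce simp: o_def)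
qed

lemmas clinear_intros = clinear_id clinear_zero clinear_plus clinear_minus
  clinear_scaleC_fun clinear_sum_fun clinear_uminus clinear_Pair

lemma clinear_eq_on_span:
  assumes "clinear f" "clinear g" "\<And>b. b \<in> B \<Longrightarrow> f b = g b" "x \<in> cvs.span B"
  shows "f x = g x"
  by (rule cvp.linear_eq_on[OF clinearD clinearD, of f g x B]) (use assms in auto)

lemma clinear_span_image_subset:
  assumes "clinear f" "\<And>b. b \<in> B \<Longrightarrow> f b \<in> cvs.span C" "x \<in> cvs.span B"
  shows "f x \<in> cvs.span C"
  using assms(3)
  by (induction rule: cvs.span_induct_alt)
    (auto simp: clinear_0[OF assms(1)] clinear_add[OF assms(1)] clinear_scaleC[OF assms(1)]
      intro: cvs.span_zero cvs.span_add cvs.span_scale assms(2))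

lemma clinear_image_subspace: "clinear f \<Longrightarrow> cvs.subspace S \<Longrightarrow> cvs.subspace (f ` S)"
  by (rule cvp.linear_subspace_image[OF clinearD])

lemma clinear_kernel_subspace:
  assumes "clinear f" "cvs.subspace S" shows "cvs.subspace {x \<in> S. f x = 0}"
  unfolding cvs.subspace_def
  using assms by (auto simp: clinear_add clinear_scaleC clinear_0 cvs.subspace_0 cvs.subspace_add cvs.subspace_scale)

lemma clinear_extension:
  fixes f :: "'a::complex_vector \<Rightarrow> 'b::complex_vector"
  assumes "cvs.independent B"
  obtains g where "clinear g" "\<And>b. b \<in> B \<Longrightarrow> g b = f b" "range g \<subseteq> cvs.span (f ` B)"
  using cvp.linear_independent_extend_subspace[OF assms, of f] that linearD by blast

text \<open>Composing with such a projection extends a map that is linear on \<open>S\<close> only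
  to a linear map on the whole type.\<close>

lemma clinear_projection:
  fixes S :: "'a::complex_vector set"
  assumes "cvs.subspace S"
  obtains p where "clinear p" "\<And>x. p x \<in> S" "\<And>x. x \<in> S \<Longrightarrow> p x = x"
proof -
  obtain B where B: "B \<subseteq> S" "cvs.independent B" "S \<subseteq> cvs.span B"
    by (meson cvs.maximal_independent_subset)
  obtain g :: "'a \<Rightarrow> 'a" where g: "clinear g" "\<And>b. b \<in> B \<Longrightarrow> g b = b" "range g \<subseteq> cvs.span ((\<lambda>b. b) ` B)"
    using clinear_extension[OF B(2), of "\<lambda>b. b"] by blast
  have "cvs.span B = S" using B assms by (meson cvs.span_minimal subset_antisym)
  then show thesis
    using that[of g] g clinear_eq_on_span[OF g(1) clinear_id, of B] by auto
qed

lemma fin_dim_subset: "fin_dim T \<Longrightarrow> S \<subseteq> T \<Longrightarrow> fin_dim S"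
  unfolding fin_dim_def by blast

lemma fin_dim_basis:
  assumes "fin_dim S" "cvs.subspace S"
  obtains B where "finite B" "cvs.independent B" "cvs.span B = S" "card B = cvs.dim S"
proof -
  obtain A where A: "finite A" "S \<subseteq> cvs.span A" using assms unfolding fin_dim_def by blast
  obtain B where B: "B \<subseteq> S" "cvs.independent B" "S \<subseteq> cvs.span B" "card B = cvs.dim S"
    by (meson cvs.basis_exists)
  have "finite B" using cvs.independent_span_bound[OF A(1) B(2)] B(1) A(2) by blast
  moreover have "cvs.span B = S" using B assms by (meson cvs.span_minimal subset_antisym)
  ultimately show thesis using that B by blast
qed

lemma fin_dim_extend_basis:
  assumes "fin_dim S" "cvs.subspace S" "A \<subseteq> S" "cvs.independent A"
  obtains B where "finite B" "A \<subseteq> B" "cvs.independent B" "cvs.span B = S" "card B = cvs.dim S"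
proof -
  obtain B where B: "A \<subseteq> B" "B \<subseteq> S" "cvs.independent B" "S \<subseteq> cvs.span B"
    by (meson cvs.maximal_independent_subset_extend assms)
  obtain C where C: "finite C" "S \<subseteq> cvs.span C" using assms unfolding fin_dim_def by blast
  have "finite B" using cvs.independent_span_bound[OF C(1) B(3)] B(2) C(2) by blast
  moreover have S: "cvs.span B = S" using B assms by (meson cvs.span_minimal subset_antisym)
  moreover have "card B = cvs.dim S" using cvs.dim_eq_card[OF _ B(3), of S] S by (metis cvs.span_span)
  ultimately show thesis using that B by blast
qed

lemma dim_less:
  assumes "fin_dim X" "cvs.subspace X" "cvs.subspace Y" "Y \<subset> X"
  shows "cvs.dim Y < cvs.dim X"
proof -
  obtain A where A: "finite A" "cvs.independent A" "cvs.span A = Y" "card A = cvs.dim Y"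
    using fin_dim_basis fin_dim_subset assms by (metis psubset_imp_subset)
  have "A \<subseteq> X" using A(3) assms(4) cvs.span_superset[of A] by blast
  then obtain B where B: "finite B" "A \<subseteq> B" "cvs.independent B" "cvs.span B = X" "card B = cvs.dim X"
    using fin_dim_extend_basis[OF assms(1,2) _ A(2)] by blast
  have "A \<noteq> B" using A(3) B(4) assms(4) by blast
  then have "card A < card B" using B by (intro psubset_card_mono) auto
  then show ?thesis using A B by simp
qed

lemma subspace_eqI_dim:
  assumes "fin_dim X" "cvs.subspace X" "cvs.subspace Y" "Y \<subseteq> X" "cvs.dim X \<le> cvs.dim Y"
  shows "Y = X"
  using dim_less[OF assms(1-3)] assms(4,5) by fastforce

lemma inj_imp_surj_on:
  assumes "clinear f" "fin_dim X" "cvs.subspace X" "f ` X \<subseteq> X" "\<And>x. x \<in> X \<Longrightarrow> f x = 0 \<Longrightarrow> x = 0"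
  shows "f ` X = X"
proof -
  obtain B where B: "finite B" "cvs.independent B" "cvs.span B = X" "card B = cvs.dim X"
    using fin_dim_basis assms by metis
  have lin: "Vector_Spaces.linear scaleC scaleC f" using assms(1) clinear_iff_linear by blast
  have inj: "inj_on f X"
  proof (rule inj_onI)
    fix x y assume "x \<in> X" "y \<in> X" "f x = f y"
    then have "f (x - y) = 0" "x - y \<in> X"
      using assms(3) by (auto simp: clinear_diff[OF assms(1)] cvs.subspace_diff)
    then show "x = y" using assms(5) by fastforce
  qed
  then have ind: "cvs.independent (f ` B)"
    using cvp.linear_independent_injective_image[OF lin B(2)] B(3) by auto
  have "card (f ` B) = card B"
    by (rule card_image, rule inj_on_subset[OF inj]) (use B(3) cvs.span_superset[of B] in simp)
  moreover have "cvs.span (f ` B) = f ` X" using cvp.linear_span_image[OF lin, of B] B(3) by simp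
  ultimately have "cvs.dim (f ` X) = cvs.dim X"
    using cvs.dim_span_eq_card_independent[OF ind] B(4) by simp
  then show ?thesis
    using subspace_eqI_dim[OF assms(2,3) clinear_image_subspace[OF assms(1,3)] assms(4)] by simp
qed

subsection \<open>Eigenvalues\<close>

definition eigenvalue_on :: "'a::complex_vector set \<Rightarrow> ('a \<Rightarrow> 'a) \<Rightarrow> complex \<Rightarrow> bool" where
  "eigenvalue_on X T c \<longleftrightarrow> (\<exists>v\<in>X. v \<noteq> 0 \<and> T v = c *\<^sub>C v)"

definition poly_op :: "('a::complex_vector \<Rightarrow> 'a) \<Rightarrow> complex poly \<Rightarrow> 'a \<Rightarrow> 'a" where
  "poly_op T p v = (\<Sum>i\<le>degree p. coeff p i *\<^sub>C (T ^^ i) v)"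

text \<open>Padding with zero coefficients gives polynomials of different degrees a common range of
  summation.\<close>

lemma poly_op_sup: assumes "degree p \<le> n" shows "poly_op T p v = (\<Sum>i\<le>n. coeff p i *\<^sub>C (T ^^ i) v)"
  unfolding poly_op_def
  by (rule sum.mono_neutral_left) (use assms in \<open>auto simp: coeff_eq_0\<close>)

lemma poly_op_add: "poly_op T (p + q) v = poly_op T p v + poly_op T q v"
proof -
  let ?n = "max (degree p) (degree q)"
  show ?thesis
    using poly_op_sup[of p ?n T v] poly_op_sup[of q ?n T v] poly_op_sup[of "p + q" ?n T v]
    by (simp add: degree_add_le_max scaleC_add_left sum.distrib)
qed

lemma poly_op_smult: "poly_op T (smult c p) v = c *\<^sub>C poly_op T p v"
  using poly_op_sup[of "smult c p" "degree p" T v]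
  by (simp add: poly_op_def cvs.scale_sum_right)

lemma poly_op_monom: "poly_op T (monom c k) v = c *\<^sub>C (T ^^ k) v"
proof -
  have "poly_op T (monom c k) v = (\<Sum>i\<le>k. coeff (monom c k) i *\<^sub>C (T ^^ i) v)"
    by (rule poly_op_sup) (rule degree_monom_le)
  also have "\<dots> = (\<Sum>i\<le>k. if i = k then c *\<^sub>C (T ^^ i) v else 0)"
    by (rule sum.cong) auto
  finally show ?thesis by simp
qed

lemma poly_op_pCons_0: assumes "clinear T" shows "poly_op T (pCons 0 p) v = T (poly_op T p v)"
proof -
  have "poly_op T (pCons 0 p) v = (\<Sum>i\<le>Suc (degree p). coeff (pCons 0 p) i *\<^sub>C (T ^^ i) v)"
    by (rule poly_op_sup) (rule degree_pCons_le)
  also have "\<dots> = (\<Sum>i\<le>degree p. coeff p i *\<^sub>C T ((T ^^ i) v))"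
    by (subst sum.atMost_Suc_shift) simp
  finally show ?thesis by (simp add: poly_op_def clinear_sum[OF assms] clinear_scaleC[OF assms])
qed

lemma poly_op_in:
  assumes "cvs.subspace X" "T ` X \<subseteq> X" "v \<in> X" shows "poly_op T p v \<in> X"
proof -
  have "(T ^^ i) v \<in> X" for i by (induction i) (use assms in auto)
  then show ?thesis unfolding poly_op_def by (intro cvs.subspace_sum cvs.subspace_scale assms(1))
qed

text \<open>Split off a linear factor, \<open>p = (X - z) q\<close>. Either \<open>q(T) v\<close> is
  nonzero and an eigenvector for \<open>z\<close>, or \<open>q\<close> is an annihilating polynomial
  of smaller degree.\<close>

lemma eigenvalue_on_if_poly:
  assumes T: "clinear T" "cvs.subspace X" "T ` X \<subseteq> X" and v: "v \<in> X" "v \<noteq> 0"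
  shows "p \<noteq> 0 \<Longrightarrow> poly_op T p v = 0 \<Longrightarrow> \<exists>c. eigenvalue_on X T c"
proof (induction "degree p" arbitrary: p)
  case 0
  then obtain a where "p = [:a:]" using degree_0_id by metis
  then show ?case using 0 v by (simp add: poly_op_def)
next
  case (Suc n)
  then have "\<not> constant (poly p)" by (simp add: constant_degree)
  then obtain z where "poly p z = 0" using fundamental_theorem_of_algebra by blast
  then obtain q where p: "p = [:-z, 1:] * q" using poly_eq_0_iff_dvd by blast
  then have q: "q \<noteq> 0" "degree q = n" using Suc by (auto simp: degree_mult_eq simp del: mult_pCons_left)
  have "poly_op T p v = T (poly_op T q v) - z *\<^sub>C poly_op T q v"
  proof -
    have p': "p = smult (-z) q + pCons 0 q" using p by simp
    show ?thesis unfolding p' poly_op_add poly_op_smult poly_op_pCons_0[OF T(1)] by simp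
  qed
  then have e: "T (poly_op T q v) = z *\<^sub>C poly_op T q v" using Suc by simp
  show ?case
  proof (cases "poly_op T q v = 0")
    case True
    then show ?thesis using Suc.hyps(1)[of q] q by simp
  next
    case False
    then show ?thesis using e poly_op_in[OF T(2,3) v(1), of q] unfolding eigenvalue_on_def by blast
  qed
qed

text \<open>The iterates \<open>v, T v, T (T v), ...\<close> of a nonzero vector are eventually
  dependent, and a dependence relation is a polynomial in \<open>T\<close> that annihilates
  \<open>v\<close>.\<close>

lemma eigenvalue_on_exists:
  assumes T: "clinear T" "cvs.subspace X" "T ` X \<subseteq> X" and X: "fin_dim X" "X \<noteq> {0}"
  shows "\<exists>c. eigenvalue_on X T c"
proof -
  obtain v where v: "v \<in> X" "v \<noteq> 0" using X(2) T(2) cvs.subspace_0 by blast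
  let ?f = "\<lambda>i. (T ^^ i) v"
  have fX: "?f i \<in> X" for i by (induction i) (use T(3) v(1) in \<open>simp_all add: image_subset_iff\<close>)
  obtain A where A: "finite A" "X \<subseteq> cvs.span A" using X unfolding fin_dim_def by blast
  have "\<exists>k. ?f k \<in> cvs.span (?f ` {..<k})"
  proof (rule ccontr)
    assume n: "\<not> ?thesis"
    have ind: "cvs.independent (?f ` {..<k}) \<and> card (?f ` {..<k}) = k" for k
    proof (induction k)
      case 0 then show ?case by (simp add: cvs.dependent_def)
    next
      case (Suc k)
      have "?f k \<notin> cvs.span (?f ` {..<k})" using n by blast
      moreover from this have "?f k \<notin> ?f ` {..<k}" by (metis cvs.span_base)
      ultimately show ?case
        using Suc by (simp only: lessThan_Suc image_insert cvs.independent_insert if_False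
          card_insert_disjoint finite_imageI finite_lessThan simp_thms)
    qed
    have "card (?f ` {..<Suc (card A)}) \<le> card A"
      by (rule cvs.independent_span_bound[OF A(1) conjunct1[OF ind], THEN conjunct2]) (use fX A(2) in blast)
    then have "Suc (card A) \<le> card A" by (simp only: conjunct2[OF ind])
    then show False by simp
  qed
  then obtain k where k: "?f k \<in> cvs.span (?f ` {..<k})" by blast
  \<comment> \<open>Combinations of the first \<open>k\<close> iterates are the values
    \<open>q(T) v\<close> with \<open>q\<close> of degree below \<open>k\<close>; the bound makes
    the polynomial \<open>X^k - q\<close> monic, hence nonzero.\<close>
  have "\<exists>q. (\<forall>i\<ge>k. coeff q i = 0) \<and> x = poly_op T q v" if "x \<in> cvs.span (?f ` {..<k})" for x
    using that
  proof (induction rule: cvs.span_induct_alt)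
    case base then show ?case by (intro exI[of _ 0]) (simp add: poly_op_def)
  next
    case (step c x y)
    then obtain i q where i: "i < k" "x = ?f i" and q: "\<forall>i\<ge>k. coeff q i = 0" "y = poly_op T q v" by blast
    show ?case
      by (intro exI[of _ "monom c i + q"]) (use i(1) in \<open>simp add: poly_op_add poly_op_monom i(2) q\<close>)
  qed
  from this[OF k] obtain q where q: "\<forall>i\<ge>k. coeff q i = 0" "?f k = poly_op T q v" by (elim exE conjE)
  let ?p = "monom 1 k + smult (-1) q"
  have "coeff ?p k = 1" using q by simp
  then have "?p \<noteq> 0" by (metis coeff_0 zero_neq_one)
  moreover have "poly_op T ?p v = 0" unfolding poly_op_add poly_op_monom poly_op_smult using q by simp
  ultimately show ?thesis by (rule eigenvalue_on_if_poly[OF T v])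
qed

text \<open>Families indexed by \<open>I\<close> with zero entries allowed, for a whole set
  \<open>H\<close> of operators: different pairs of weights may be separated by different elements
  of \<open>H\<close>. This covers both the eigenspaces of one operator and the root spaces.\<close>

lemma eigenvectors_independent:
  fixes T :: "'h \<Rightarrow> 'a::complex_vector \<Rightarrow> 'a" and w :: "'i \<Rightarrow> 'h \<Rightarrow> complex"
  assumes "finite I" "\<And>h. h \<in> H \<Longrightarrow> clinear (T h)"
    and "\<And>i h. i \<in> I \<Longrightarrow> h \<in> H \<Longrightarrow> T h (x i) = w i h *\<^sub>C x i"
    and "\<And>i j. i \<in> I \<Longrightarrow> j \<in> I \<Longrightarrow> i \<noteq> j \<Longrightarrow> \<exists>h\<in>H. w i h \<noteq> w j h"
    and "(\<Sum>i\<in>I. x i) = 0"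
  shows "\<forall>i\<in>I. x i = 0"
  using assms(1) assms(3-)
proof (induction I arbitrary: x rule: finite_induct)
  case (insert k I)
  have s0: "x k + (\<Sum>i\<in>I. x i) = 0" using insert by simp
  \<comment> \<open>Applying \<open>T h - w k h\<close> to the relation removes the term of
    \<open>k\<close> and rescales the others, so the induction hypothesis applies.\<close>
  have z: "(w i h - w k h) *\<^sub>C x i = 0" if h: "h \<in> H" and i: "i \<in> I" for i h
  proof -
    let ?y = "\<lambda>i. (w i h - w k h) *\<^sub>C x i"
    have "T h (x k + (\<Sum>i\<in>I. x i)) = 0" using s0 clinear_0[OF assms(2)[OF h]] by simp
    then have "w k h *\<^sub>C x k + (\<Sum>i\<in>I. w i h *\<^sub>C x i) = 0"
      using insert.prems(1)[OF _ h]
      by (simp add: clinear_add[OF assms(2)[OF h]] clinear_sum[OF assms(2)[OF h]])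
    moreover have "(\<Sum>i\<in>I. ?y i) = (\<Sum>i\<in>I. w i h *\<^sub>C x i) - w k h *\<^sub>C (\<Sum>i\<in>I. x i)"
      by (simp add: cvs.scale_left_diff_distrib sum_subtractf cvs.scale_sum_right)
    moreover have "(\<Sum>i\<in>I. x i) = - x k" using s0 by (simp add: add_eq_0_iff)
    ultimately have "(\<Sum>i\<in>I. ?y i) = 0" by (simp add: add.commute)
    moreover have "T h' (?y i) = w i h' *\<^sub>C ?y i" if "i \<in> I" "h' \<in> H" for i h'
      unfolding clinear_scaleC[OF assms(2)[OF that(2)]] using insert.prems(1)[of i h'] that
      by (simp only: insert_iff simp_thms scaleC_scaleC mult.commute)
    ultimately have "\<forall>i\<in>I. ?y i = 0"
      by (intro insert.IH) (use insert.prems(2) in blast)+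
    then show ?thesis using i by blast
  qed
  have "x i = 0" if i: "i \<in> I" for i
  proof -
    obtain h where "h \<in> H" "w i h \<noteq> w k h" using insert.prems(2)[of i k] insert.hyps i by auto
    then show ?thesis using z[OF _ i] by auto
  qed
  moreover from this have "(\<Sum>i\<in>I. x i) = 0" by (intro sum.neutral) blast
  then have "x k = 0" using s0 by (simp only: add_0_right)
  ultimately show ?case by blast
qed blast

subsection \<open>The trace on a finite-dimensional invariant subspace\<close>

text \<open>Total linear maps with an invariant subspace: passing to a smaller invariant subspace
  keeps the same function, as inductions on the dimension require.\<close>

definition endo_on :: "'a::complex_vector set \<Rightarrow> ('a \<Rightarrow> 'a) \<Rightarrow> bool" where
  "endo_on X T \<longleftrightarrow> clinear T \<and> T ` X \<subseteq> X"

lemma endo_on_clinear: "endo_on X T \<Longrightarrow> clinear T"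
  and endo_on_in: "endo_on X T \<Longrightarrow> x \<in> X \<Longrightarrow> T x \<in> X"
  by (auto simp: endo_on_def)

lemma endo_on_compose: "endo_on X S \<Longrightarrow> endo_on X T \<Longrightarrow> endo_on X (\<lambda>x. S (T x))"
  by (auto simp: endo_on_def intro: clinear_compose)

lemma endo_on_id: "endo_on X (\<lambda>x. x)"
  by (auto simp: endo_on_def clinear_id)

lemma endo_on_add: "cvs.subspace X \<Longrightarrow> endo_on X S \<Longrightarrow> endo_on X T \<Longrightarrow> endo_on X (\<lambda>x. S x + T x)"
  by (auto simp: endo_on_def image_subset_iff intro!: clinear_intros cvs.subspace_add)

lemma endo_on_diff: "cvs.subspace X \<Longrightarrow> endo_on X S \<Longrightarrow> endo_on X T \<Longrightarrow> endo_on X (\<lambda>x. S x - T x)"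
  by (auto simp: endo_on_def image_subset_iff intro!: clinear_intros cvs.subspace_diff)

lemma endo_on_scale: "cvs.subspace X \<Longrightarrow> endo_on X T \<Longrightarrow> endo_on X (\<lambda>x. c *\<^sub>C T x)"
  by (auto simp: endo_on_def image_subset_iff intro!: clinear_intros cvs.subspace_scale)

lemma endo_on_sum:
  "cvs.subspace X \<Longrightarrow> (\<And>i. i \<in> I \<Longrightarrow> endo_on X (T i)) \<Longrightarrow> endo_on X (\<lambda>x. \<Sum>i\<in>I. T i x)"
  by (auto simp: endo_on_def image_subset_iff intro!: clinear_intros cvs.subspace_sum)

definition basis_trace :: "'a::complex_vector set \<Rightarrow> ('a \<Rightarrow> 'a) \<Rightarrow> complex" where
  "basis_trace B T = (\<Sum>b\<in>B. cvs.representation B (T b) b)"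

text \<open>The choice of basis is harmless by \<open>ctrace_eq\<close>.\<close>

definition ctrace :: "'a::complex_vector set \<Rightarrow> ('a \<Rightarrow> 'a) \<Rightarrow> complex" where
  "ctrace X T = basis_trace (SOME B. finite B \<and> cvs.independent B \<and> cvs.span B = X) T"

lemma representation_clinear_expand:
  assumes B: "finite B" "cvs.independent B" "cvs.span B = X"
    and C: "finite C" "cvs.independent C" "cvs.span C = X"
    and S: "endo_on X S" and x: "x \<in> X"
  shows "cvs.representation B (S x) b = (\<Sum>c\<in>C. cvs.representation C x c * cvs.representation B (S c) b)"
proof -
  have e: "(\<Sum>c\<in>C. cvs.representation C x c *\<^sub>C c) = x"
    by (rule cvs.sum_representation_eq) (use C x in auto)
  have CX: "c \<in> C \<Longrightarrow> S c \<in> cvs.span B" for c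
    using S C(3) B(3) cvs.span_base[of c C] by (auto dest: endo_on_in)
  have "S x = (\<Sum>c\<in>C. cvs.representation C x c *\<^sub>C S c)"
    by (subst e[symmetric]) (simp add: clinear_sum[OF endo_on_clinear[OF S]] clinear_scaleC[OF endo_on_clinear[OF S]])
  then have "cvs.representation B (S x) b = (\<Sum>c\<in>C. cvs.representation B (cvs.representation C x c *\<^sub>C S c) b)"
    using cvs.representation_sum[OF B(2), of C "\<lambda>c. cvs.representation C x c *\<^sub>C S c"] CX
    by (simp add: cvs.span_scale)
  also have "\<dots> = (\<Sum>c\<in>C. cvs.representation C x c * cvs.representation B (S c) b)"
    by (rule sum.cong) (simp_all add: cvs.representation_scale[OF B(2) CX])
  finally show ?thesis .
qed

lemma endo_on_basis_in: "endo_on X T \<Longrightarrow> cvs.span B = X \<Longrightarrow> b \<in> B \<Longrightarrow> T b \<in> X"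
  using cvs.span_base[of b B] by (auto dest: endo_on_in)

text \<open>Expanding one product in \<open>B\<close> and the other in \<open>C\<close> gives the
  same double sum. Allowing two bases yields at once the independence of the basis (one factor the
  identity) and the cyclicity of the trace.\<close>

lemma basis_trace_comm:
  assumes B: "finite B" "cvs.independent B" "cvs.span B = X"
    and C: "finite C" "cvs.independent C" "cvs.span C = X"
    and S: "endo_on X S" and T: "endo_on X T"
  shows "basis_trace B (\<lambda>x. S (T x)) = basis_trace C (\<lambda>x. T (S x))"
proof -
  have "basis_trace B (\<lambda>x. S (T x))
      = (\<Sum>b\<in>B. \<Sum>c\<in>C. cvs.representation C (T b) c * cvs.representation B (S c) b)"
    unfolding basis_trace_def
    by (intro sum.cong refl representation_clinear_expand[OF B C S])
      (rule endo_on_basis_in[OF T B(3)])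
  also have "\<dots> = (\<Sum>c\<in>C. \<Sum>b\<in>B. cvs.representation B (S c) b * cvs.representation C (T b) c)"
    by (subst sum.swap) (simp add: mult.commute)
  also have "\<dots> = basis_trace C (\<lambda>x. T (S x))"
    unfolding basis_trace_def
    by (intro sum.cong refl representation_clinear_expand[OF C B T, symmetric])
      (rule endo_on_basis_in[OF S C(3)])
  finally show ?thesis .
qed

lemma ctrace_eq:
  assumes "finite B" "cvs.independent B" "cvs.span B = X" "endo_on X T"
  shows "ctrace X T = basis_trace B T"
proof -
  let ?P = "\<lambda>B. finite B \<and> cvs.independent B \<and> cvs.span B = X"
  have "?P (Eps ?P)" by (rule someI[of ?P B]) (use assms in simp)
  then show ?thesis
    unfolding ctrace_def using basis_trace_comm[of "Eps ?P" X B "\<lambda>x. x" T] assms endo_on_id by blast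
qed

locale fd_subspace =
  fixes X :: "'a::complex_vector set"
  assumes sub: "cvs.subspace X" and fd: "fin_dim X"
begin

lemma ctrace_comm: "endo_on X S \<Longrightarrow> endo_on X T \<Longrightarrow> ctrace X (\<lambda>x. S (T x)) = ctrace X (\<lambda>x. T (S x))"
  using basis_trace_comm ctrace_eq endo_on_compose by (metis fd sub fin_dim_basis)

lemma ctrace_cong:
  assumes "endo_on X S" "endo_on X T" "\<And>x. x \<in> X \<Longrightarrow> S x = T x"
  shows "ctrace X S = ctrace X T"
proof -
  obtain B where B: "finite B" "cvs.independent B" "cvs.span B = X" using fd sub fin_dim_basis by metis
  show ?thesis
    unfolding ctrace_eq[OF B assms(1)] ctrace_eq[OF B assms(2)] basis_trace_def
    by (rule sum.cong) (use assms(3) B(3) cvs.span_base[of _ B] in auto)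
qed

lemma ctrace_add:
  assumes "endo_on X S" "endo_on X T"
  shows "ctrace X (\<lambda>x. S x + T x) = ctrace X S + ctrace X T"
proof -
  obtain B where B: "finite B" "cvs.independent B" "cvs.span B = X" using fd sub fin_dim_basis by metis
  have "b \<in> B \<Longrightarrow> S b \<in> cvs.span B \<and> T b \<in> cvs.span B" for b
    using assms B(3) cvs.span_base[of b B] by (auto dest: endo_on_in)
  then show ?thesis
    unfolding ctrace_eq[OF B assms(1)] ctrace_eq[OF B assms(2)] ctrace_eq[OF B endo_on_add[OF sub assms]]
      basis_trace_def
    by (simp add: cvs.representation_add[OF B(2)] sum.distrib)
qed

lemma ctrace_scale:
  assumes "endo_on X T"
  shows "ctrace X (\<lambda>x. c *\<^sub>C T x) = c * ctrace X T"
proof -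
  obtain B where B: "finite B" "cvs.independent B" "cvs.span B = X" using fd sub fin_dim_basis by metis
  have "b \<in> B \<Longrightarrow> T b \<in> cvs.span B" for b
    using assms B(3) cvs.span_base[of b B] by (auto dest: endo_on_in)
  then show ?thesis
    unfolding ctrace_eq[OF B assms(1)] ctrace_eq[OF B endo_on_scale[OF sub assms]] basis_trace_def
    by (simp add: cvs.representation_scale[OF B(2)] sum_distrib_left)
qed

lemma ctrace_diff:
  assumes "endo_on X S" "endo_on X T"
  shows "ctrace X (\<lambda>x. S x - T x) = ctrace X S - ctrace X T"
  using ctrace_add[OF assms(1) endo_on_scale[OF sub assms(2), of "-1"]] ctrace_scale[OF assms(2), of "-1"]
  by simp

lemma ctrace_zero: "ctrace X (\<lambda>x. 0) = 0"
  using ctrace_scale[OF endo_on_id, of 0] by simp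

lemma ctrace_sum:
  "(\<And>i. i \<in> I \<Longrightarrow> endo_on X (T i)) \<Longrightarrow> ctrace X (\<lambda>x. \<Sum>i\<in>I. T i x) = (\<Sum>i\<in>I. ctrace X (T i))"
  by (induction I rule: infinite_finite_induct) (simp_all add: ctrace_zero ctrace_add endo_on_sum[OF sub])

lemma ctrace_id: "ctrace X (\<lambda>x. x) = of_nat (cvs.dim X)"
proof -
  obtain B where B: "finite B" "cvs.independent B" "cvs.span B = X" "card B = cvs.dim X"
    using fd sub fin_dim_basis by metis
  show ?thesis
    unfolding ctrace_eq[OF B(1-3) endo_on_id] basis_trace_def
    by (simp add: cvs.representation_basis[OF B(2)] B(4))
qed

text \<open>The trace of a commutator is 0, that of the scalar \<open>c\<close> is \<open>c\<close>
  times the nonzero dimension.\<close>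

lemma commutator_scalar:
  assumes "endo_on X S" "endo_on X T" "X \<noteq> {0}" "\<And>x. x \<in> X \<Longrightarrow> S (T x) - T (S x) = c *\<^sub>C x"
  shows "c = 0"
proof -
  obtain B where B: "finite B" "cvs.independent B" "cvs.span B = X" "card B = cvs.dim X"
    using fd sub fin_dim_basis by metis
  have "B \<noteq> {}" using B(3) assms(3) by auto
  then have d: "cvs.dim X \<noteq> 0" using B(1,4) card_0_eq by metis
  have "ctrace X (\<lambda>x. S (T x) - T (S x)) = ctrace X (\<lambda>x. c *\<^sub>C x)"
    by (rule ctrace_cong[OF endo_on_diff[OF sub endo_on_compose[OF assms(1,2)] endo_on_compose[OF assms(2,1)]]
          endo_on_scale[OF sub endo_on_id] assms(4)])
  then have "c * of_nat (cvs.dim X) = 0"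
    unfolding ctrace_diff[OF endo_on_compose[OF assms(1,2)] endo_on_compose[OF assms(2,1)]]
      ctrace_comm[OF assms(1,2)] ctrace_scale[OF endo_on_id, of c] ctrace_id by simp
  then show ?thesis using d by simp
qed

end

text \<open>Any hyperplane containing the image of \<open>T - c\<close> is invariant.\<close>

lemma invariant_hyperplane:
  assumes X: "cvs.subspace X" "fin_dim X" and T: "endo_on X T" and c: "eigenvalue_on X T c"
  shows "\<exists>Y. cvs.subspace Y \<and> Y \<subseteq> X \<and> Suc (cvs.dim Y) = cvs.dim X \<and> endo_on Y T \<and>
    (\<forall>x\<in>X. T x - c *\<^sub>C x \<in> Y) \<and>
    (\<forall>S e. endo_on X S \<and> S ` Y \<subseteq> Y \<and> (\<forall>x\<in>X. S x - e *\<^sub>C x \<in> Y) \<longrightarrow> ctrace X S = e + ctrace Y S)"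
proof -
  let ?N = "\<lambda>x. T x - c *\<^sub>C x"
  have N: "endo_on X ?N" using endo_on_diff[OF X(1) T endo_on_scale[OF X(1) endo_on_id]] .
  have sI: "cvs.subspace (?N ` X)" by (rule clinear_image_subspace[OF endo_on_clinear[OF N] X(1)])
  have I: "?N ` X \<subseteq> X" using N by (simp add: endo_on_def)
  \<comment> \<open>A basis containing the eigenvector \<open>v\<close> loses at least one vector
    under \<open>T - c\<close>, so the image has smaller dimension.\<close>
  have "?N ` X \<noteq> X"
  proof
    assume eq: "?N ` X = X"
    obtain v where v: "v \<in> X" "v \<noteq> 0" "?N v = 0" using c by (auto simp: eigenvalue_on_def)
    obtain B where B: "finite B" "{v} \<subseteq> B" "cvs.independent B" "cvs.span B = X" "card B = cvs.dim X"
      using fin_dim_extend_basis[OF X(2,1), of "{v}"] v by auto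
    have "X \<subseteq> cvs.span (?N ` (B - {v}))"
    proof
      fix y assume "y \<in> X"
      then obtain x where x: "x \<in> cvs.span B" "y = ?N x" using eq B(4) by blast
      show "y \<in> cvs.span (?N ` (B - {v}))" unfolding x(2)
      proof (rule clinear_span_image_subset[OF endo_on_clinear[OF N] _ x(1)])
        fix b assume "b \<in> B"
        then show "?N b \<in> cvs.span (?N ` (B - {v}))"
          by (cases "b = v") (auto simp: v(3) cvs.span_zero intro: cvs.span_base)
      qed
    qed
    then have "cvs.dim X \<le> card (?N ` (B - {v}))" by (rule cvs.dim_le_card) (use B in simp)
    also have "\<dots> \<le> card (B - {v})" by (rule card_image_le) (use B in simp)
    also have "\<dots> < card B" using B by (intro psubset_card_mono) auto
    finally show False using B(5) by simp
  qed
  then have I': "?N ` X \<subset> X" using I by blast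
  obtain A where A: "finite A" "cvs.independent A" "cvs.span A = ?N ` X"
    using fin_dim_basis[OF fin_dim_subset[OF X(2) I] sI] by metis
  have "A \<subseteq> X" using A(3) I cvs.span_superset[of A] by blast
  then obtain B where B: "finite B" "A \<subseteq> B" "cvs.independent B" "cvs.span B = X" "card B = cvs.dim X"
    using fin_dim_extend_basis[OF X(2,1) _ A(2)] by metis
  have "A \<noteq> B" using A(3) B(4) I' by blast
  then obtain b where b: "b \<in> B" "b \<notin> A" using B(2) by blast
  \<comment> \<open>A basis of the image is extended to one of \<open>X\<close>; omitting a single
    vector \<open>b\<close> outside the former leaves a hyperplane that contains the image.\<close>
  define C Y where "C = B - {b}" and "Y = cvs.span C"
  have C: "finite C" "cvs.independent C" "cvs.span C = Y" "insert b C = B" "b \<notin> C"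
    using B b cvs.independent_mono[of B C] by (auto simp: C_def Y_def)
  have bY: "b \<notin> Y" using C cvs.independent_insert[of b C] B(3) by simp
  have sY: "cvs.subspace Y" by (simp add: Y_def)
  have YX: "Y \<subseteq> X" unfolding Y_def B(4)[symmetric] by (rule cvs.span_mono) (auto simp: C_def)
  have IY: "?N x \<in> Y" if "x \<in> X" for x
    using that A(3) cvs.span_mono[of A C] b B(2) unfolding C_def Y_def by blast
  have TY: "endo_on Y T"
    unfolding endo_on_def
  proof (intro conjI endo_on_clinear[OF T] subsetI)
    fix y assume "y \<in> T ` Y"
    then obtain x where x: "x \<in> Y" "y = T x" by blast
    have "T x = ?N x + c *\<^sub>C x" by simp
    then show "y \<in> Y" unfolding x(2)
      using IY[of x] x(1) YX cvs.subspace_add[OF sY] cvs.subspace_scale[OF sY x(1)] by (metis subsetD)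
  qed
  have dY: "Suc (cvs.dim Y) = cvs.dim X"
    using cvs.dim_span_eq_card_independent[OF C(2)] C B(5) card_insert_disjoint[OF C(1,5)] by simp
  \<comment> \<open>The condition says that \<open>S\<close> acts on the line \<open>X/Y\<close> as
    the scalar \<open>e\<close>. It is proved for general \<open>S\<close> because both
    \<open>T\<close> and its square are needed, with scalars \<open>c\<close> and
    \<open>c * c\<close>.\<close>
  have tr: "ctrace X S = e + ctrace Y S"
    if S: "endo_on X S" "S ` Y \<subseteq> Y" and e: "\<And>x. x \<in> X \<Longrightarrow> S x - e *\<^sub>C x \<in> Y" for S e
  proof -
    have SY: "endo_on Y S" using S by (simp add: endo_on_def)
    have ext: "cvs.representation B y = cvs.representation C y" if "y \<in> Y" for y
      using cvs.representation_extend[OF B(3), of y C] that C by auto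
    have r0: "cvs.representation C y b = 0" for y
      using cvs.representation_ne_zero[of C y b] C(5) by blast
    have bX: "b \<in> X" using b B(4) cvs.span_base by blast
    have "S b = (S b - e *\<^sub>C b) + e *\<^sub>C b" by simp
    then have "cvs.representation B (S b) b = cvs.representation B ((S b - e *\<^sub>C b) + e *\<^sub>C b) b" by simp
    also have "\<dots> = cvs.representation B (S b - e *\<^sub>C b) b + e * cvs.representation B b b"
      using cvs.representation_add[OF B(3), of "S b - e *\<^sub>C b" "e *\<^sub>C b"] cvs.representation_scale[OF B(3), of b e]
        e[OF bX] YX bX B(4) by (auto simp: cvs.span_scale)
    also have "\<dots> = e"
      using ext[OF e[OF bX]] r0 cvs.representation_basis[OF B(3) b(1)] by simp
    finally have rb: "cvs.representation B (S b) b = e" .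
    have "x \<in> C \<Longrightarrow> S x \<in> Y" for x using S(2) C(3) cvs.span_base[of x C] by blast
    then show ?thesis
      unfolding ctrace_eq[OF B(1,3,4) S(1)] ctrace_eq[OF C(1-3) SY] basis_trace_def C(4)[symmetric]
      by (simp add: C(1,5) rb[folded C(4)] ext[folded C(4)])
  qed
  have tr': "\<forall>S e. endo_on X S \<and> S ` Y \<subseteq> Y \<and> (\<forall>x\<in>X. S x - e *\<^sub>C x \<in> Y) \<longrightarrow> ctrace X S = e + ctrace Y S"
    by (intro allI impI, elim conjE, rule tr) (assumption | blast)+
  have "\<forall>x\<in>X. T x - c *\<^sub>C x \<in> Y" by (rule ballI, rule IY)
  with tr' show ?thesis
    by (intro exI[of _ Y] conjI sY YX dY TY)
qed

text \<open>The list \<open>es\<close> is the diagonal of a triangular form of \<open>T\<close>,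
  built by descending through invariant hyperplanes. Only the facts used later are recorded: the
  traces of \<open>T\<close> and of its square, and nilpotency if the diagonal is zero.\<close>

lemma trace_eigenvalues:
  assumes "cvs.subspace X" "fin_dim X" "endo_on X T"
  shows "\<exists>es. (\<forall>c\<in>set es. eigenvalue_on X T c) \<and> ctrace X T = sum_list es \<and>
    ctrace X (\<lambda>x. T (T x)) = (\<Sum>c\<leftarrow>es. c\<^sup>2) \<and>
    (set es \<subseteq> {0} \<longrightarrow> (\<forall>x\<in>X. (T ^^ cvs.dim X) x = 0))"
  using assms
proof (induction "cvs.dim X" arbitrary: X)
  case 0
  interpret fd_subspace X using 0 by unfold_locales
  obtain B where B: "finite B" "cvs.independent B" "cvs.span B = X" "card B = cvs.dim X"
    using fd sub fin_dim_basis by metis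
  then have X: "X = {0}" using 0 by simp
  have "ctrace X S = 0" if "endo_on X S" for S
    using ctrace_cong[OF that endo_on_scale[OF sub endo_on_id, of 0]] ctrace_zero
    by (simp add: X clinear_0[OF endo_on_clinear[OF that]])
  then show ?case
    using 0 X endo_on_compose[OF 0(4,4)] by (intro exI[of _ "[]"]) simp
next
  case (Suc n)
  interpret fd_subspace X using Suc by unfold_locales
  have "X \<noteq> {0}" 
  proof
    assume "X = {0}"
    then show False using Suc(2) cvs.dim_le_card[of X "{}"] by simp
  qed
  then obtain c where c: "eigenvalue_on X T c"
    using eigenvalue_on_exists[OF endo_on_clinear[OF Suc(5)] sub _ fd \<open>X \<noteq> {0}\<close>] Suc(5)
    unfolding endo_on_def by blast
  obtain Y where Y: "cvs.subspace Y" "Y \<subseteq> X" "Suc (cvs.dim Y) = cvs.dim X" "endo_on Y T"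
    "\<forall>x\<in>X. T x - c *\<^sub>C x \<in> Y"
    and tr': "\<forall>S e. endo_on X S \<and> S ` Y \<subseteq> Y \<and> (\<forall>x\<in>X. S x - e *\<^sub>C x \<in> Y) \<longrightarrow> ctrace X S = e + ctrace Y S"
    using invariant_hyperplane[OF sub fd Suc(5) c] by (elim exE conjE)
  note tr = tr'[rule_format, OF conjI, OF _ conjI]
  have fY: "fin_dim Y" using fd Y(2) fin_dim_subset by blast
  obtain es where es: "\<forall>c\<in>set es. eigenvalue_on Y T c" "ctrace Y T = sum_list es"
    "ctrace Y (\<lambda>x. T (T x)) = (\<Sum>c\<leftarrow>es. c\<^sup>2)" "set es \<subseteq> {0} \<Longrightarrow> \<forall>x\<in>Y. (T ^^ cvs.dim Y) x = 0"
    using Suc(1)[of Y] Suc(2) Y fY by auto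
  have T: "clinear T" using Suc(5) endo_on_clinear by blast
  have tr1: "ctrace X T = c + ctrace Y T"
    by (rule tr[OF Suc(5)]) (use Y in \<open>auto simp: endo_on_def\<close>)
  have tr2: "ctrace X (\<lambda>x. T (T x)) = c\<^sup>2 + ctrace Y (\<lambda>x. T (T x))"
  proof (rule tr[OF endo_on_compose[OF Suc(5,5)] _ ballI])
    show "(\<lambda>x. T (T x)) ` Y \<subseteq> Y" using Y(4) by (auto simp: endo_on_def)
    fix x assume x: "x \<in> X"
    \<comment> \<open>The factorization of \<open>T^2 - c^2\<close> as
      \<open>(T + c)(T - c)\<close>, where \<open>T - c\<close> already maps into
      \<open>Y\<close>.\<close>
    have "T (T x) - c\<^sup>2 *\<^sub>C x = T (T x - c *\<^sub>C x) + c *\<^sub>C (T x - c *\<^sub>C x)"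
      by (simp add: clinear_diff[OF T] clinear_scaleC[OF T] cvs.scale_right_diff_distrib power2_eq_square)
    then show "T (T x) - c\<^sup>2 *\<^sub>C x \<in> Y"
      by (simp only:) (intro cvs.subspace_add[OF Y(1)] cvs.subspace_scale[OF Y(1)] endo_on_in[OF Y(4)] Y(5)[rule_format, OF x])
  qed
  \<comment> \<open>If \<open>c = 0\<close>, one application of \<open>T\<close> enters
    \<open>Y\<close>, which accounts for the one extra power.\<close>
  have nil: "\<forall>x\<in>X. (T ^^ cvs.dim X) x = 0" if "set (c # es) \<subseteq> {0}"
  proof
    fix x assume "x \<in> X"
    from Y(5)[rule_format, OF this] have "T x \<in> Y" using that by simp
    then show "(T ^^ cvs.dim X) x = 0"
      using es(4) that by (simp add: Y(3)[symmetric] funpow_swap1)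
  qed
  have "\<forall>d\<in>set (c # es). eigenvalue_on X T d"
    using c es(1) Y(2) by (auto simp: eigenvalue_on_def)
  then show ?case
    by (intro exI[of _ "c # es"] conjI impI nil) (use tr1 tr2 es in auto)
qed

lemma ctrace_nonzero_eigenvalue:
  assumes "cvs.subspace X" "fin_dim X" "endo_on X T" "ctrace X T \<noteq> 0"
  shows "\<exists>c. c \<noteq> 0 \<and> eigenvalue_on X T c"
proof -
  obtain es where es: "\<forall>c\<in>set es. eigenvalue_on X T c" "ctrace X T = sum_list es"
    using trace_eigenvalues[OF assms(1-3)] by blast
  have "\<exists>c\<in>set es. c \<noteq> 0"
  proof (rule ccontr)
    assume "\<not> ?thesis"
    then have "sum_list es = 0" by (induction es) auto
    then show False using es(2) assms(4) by simp
  qed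
  then show ?thesis using es(1) by blast
qed

text \<open>A vanishing sum of squares of real numbers has only zero terms. That the eigenvalues are
  real will come from \<open>sl2\<close> theory.\<close>

lemma nilpotent_if_ctrace_square_zero:
  assumes "cvs.subspace X" "fin_dim X" "endo_on X T" "\<And>c. eigenvalue_on X T c \<Longrightarrow> c \<in> \<real>"
    and "ctrace X (\<lambda>x. T (T x)) = 0" "x \<in> X"
  shows "(T ^^ cvs.dim X) x = 0"
proof -
  obtain es where es: "\<forall>c\<in>set es. eigenvalue_on X T c" "ctrace X (\<lambda>x. T (T x)) = (\<Sum>c\<leftarrow>es. c\<^sup>2)"
    "set es \<subseteq> {0} \<Longrightarrow> \<forall>x\<in>X. (T ^^ cvs.dim X) x = 0"
    using trace_eigenvalues[OF assms(1-3)] by blast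
  have "(\<Sum>c\<leftarrow>es. c\<^sup>2) = of_real (\<Sum>c\<leftarrow>es. (Re c)\<^sup>2)" if "set es \<subseteq> \<real>" for es
    using that by (induction es) (auto elim!: Reals_cases)
  moreover have "set es \<subseteq> \<real>" using es(1) assms(4) by blast
  ultimately have "(\<Sum>c\<leftarrow>es. (Re c)\<^sup>2) = 0" using es(2) assms(5) by (metis of_real_eq_0_iff)
  then have "\<forall>c\<in>set es. Re c = 0" by (subst (asm) sum_list_nonneg_eq_0_iff) auto
  then have "set es \<subseteq> {0}" using \<open>set es \<subseteq> \<real>\<close> by (auto simp: complex_eq_iff complex_is_Real_iff)
  then show ?thesis using es(3) assms(6) by blast
qed

section \<open>Simple Lie algebras and their finite-dimensional modules\<close>

lemma span_UN_sum:
  assumes V: "\<And>i. i \<in> I \<Longrightarrow> cvs.subspace (V i)" and "x \<in> cvs.span (\<Union>i\<in>I. V i)"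
  shows "\<exists>C f. finite C \<and> C \<subseteq> I \<and> (\<forall>i\<in>C. f i \<in> V i) \<and> x = (\<Sum>i\<in>C. f i)"
  using assms(2)
proof (induction rule: cvs.span_induct_alt)
  case base
  show ?case by (intro exI[of _ "{}"]) simp
next
  case (step a x y)
  then obtain k C f where k: "k \<in> I" "x \<in> V k"
    and C: "finite C" "C \<subseteq> I" "\<forall>i\<in>C. f i \<in> V i" "y = (\<Sum>i\<in>C. f i)" by blast
  let ?g = "\<lambda>i. (if i = k then a *\<^sub>C x else 0) + (if i \<in> C then f i else 0)"
  have "(\<Sum>i\<in>insert k C. if i \<in> C then f i else 0) = y"
    unfolding C(4) by (rule sum.mono_neutral_cong_right) (use C(1) in auto)
  then have "a *\<^sub>C x + y = (\<Sum>i\<in>insert k C. ?g i)"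
    using C(1) by (simp add: sum.distrib sum.delta del: sum.insert)
  moreover have "?g i \<in> V i" if i: "i \<in> insert k C" for i
  proof (rule cvs.subspace_add)
    show s: "cvs.subspace (V i)" using V i k C by blast
    show "(if i = k then a *\<^sub>C x else 0) \<in> V i"
      using k(2) cvs.subspace_0[OF s] cvs.subspace_scale[OF s] by auto
    show "(if i \<in> C then f i else 0) \<in> V i" using C(3) cvs.subspace_0[OF s] by simp
  qed
  ultimately show ?case
    using C k by (intro exI[of _ "insert k C"] exI[of _ ?g]) simp
qed

text \<open>Decompose a joint eigenvector of \<open>F\<close> into \<open>T k\<close>-eigenvectors.
  Each \<open>T h - w h\<close> with \<open>h\<close> in \<open>F\<close> commutes with
  \<open>T k\<close>, so it kills the components separately: they are joint eigenvectors of the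
  larger family.\<close>

lemma simultaneous_diagonalization:
  fixes T :: "'h \<Rightarrow> 'a::complex_vector \<Rightarrow> 'a"
  assumes "finite F" "\<And>h. h \<in> F \<Longrightarrow> clinear (T h)"
    and "\<And>h k x. h \<in> F \<Longrightarrow> k \<in> F \<Longrightarrow> T h (T k x) = T k (T h x)"
    and "\<And>h. h \<in> F \<Longrightarrow> cvs.span {x. \<exists>c. T h x = c *\<^sub>C x} = UNIV"
  shows "cvs.span {x. \<forall>h\<in>F. \<exists>c. T h x = c *\<^sub>C x} = UNIV"
  using assms
proof (induction F rule: finite_induct)
  case empty
  then show ?case by (auto intro: cvs.span_base)
next
  case (insert k F)
  let ?E = "\<lambda>F. {x. \<forall>h\<in>F. \<exists>c. T h x = c *\<^sub>C x}"
  let ?V = "\<lambda>c. {x. T k x = c *\<^sub>C x}"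
  have k: "clinear (T k)" using insert by blast
  have sV: "cvs.subspace (?V c)" for c
    using clinear_kernel_subspace[OF clinear_minus[OF k clinear_scale] cvs.subspace_UNIV, of c] by simp
  have "?E F \<subseteq> cvs.span (?E (insert k F))"
  proof
    fix x assume x: "x \<in> ?E F"
    then obtain w where w: "\<And>h. h \<in> F \<Longrightarrow> T h x = w h *\<^sub>C x" by simp metis
    have "(\<Union>c\<in>UNIV. ?V c) = {x. \<exists>c. T k x = c *\<^sub>C x}" by blast
    then have "x \<in> cvs.span (\<Union>c\<in>UNIV. ?V c)" using insert.prems(3)[of k] by simp
    then obtain C f where C: "finite C" "\<forall>c\<in>C. f c \<in> ?V c" "x = (\<Sum>c\<in>C. f c)"
      using span_UN_sum[of UNIV ?V x] sV by blast
    have fh: "T h (f c) = w h *\<^sub>C f c" if h: "h \<in> F" and c: "c \<in> C" for h c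
    proof -
      have lh: "clinear (T h)" using h insert by blast
      let ?y = "\<lambda>c. T h (f c) - w h *\<^sub>C f c"
      have "(\<Sum>c\<in>C. ?y c) = T h x - w h *\<^sub>C x"
        unfolding C(3) by (simp add: clinear_sum[OF lh] cvs.scale_sum_right sum_subtractf)
      then have s: "(\<Sum>c\<in>C. ?y c) = 0" using w[OF h] by simp
      have e: "T k (?y c) = c *\<^sub>C ?y c" if "c \<in> C" for c
      proof -
        have "T k (T h (f c)) = T h (T k (f c))" using insert.prems(2) h by blast
        also have "\<dots> = c *\<^sub>C T h (f c)" using C(2) that by (simp add: clinear_scaleC[OF lh])
        finally show ?thesis
          using C(2) that by (simp add: clinear_diff[OF k] clinear_scaleC[OF k] cvs.scale_right_diff_distrib mult.commute)
      qed
      have "\<forall>c\<in>C. ?y c = 0"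
        by (rule eigenvectors_independent[OF C(1), of "{k}" T ?y "\<lambda>c _. c"]) (use k e s in auto)
      then show ?thesis using c by simp
    qed
    have "f c \<in> ?E (insert k F)" if "c \<in> C" for c
      using fh[OF _ that] C(2) that by auto
    then show "x \<in> cvs.span (?E (insert k F))"
      unfolding C(3) by (intro cvs.span_sum cvs.span_base) blast
  qed
  moreover have "cvs.span (?E F) = UNIV" using insert by blast
  ultimately have "UNIV \<subseteq> cvs.span (?E (insert k F))"
    using cvs.span_minimal[of "?E F" "cvs.span (?E (insert k F))"] by auto
  then show ?case by blast
qed

text \<open>Eigenvectors for distinct eigenvalues are independent, so there are at most as many
  eigenvalues as the dimension.\<close>

lemma finite_eigenvalues:
  assumes X: "cvs.subspace X" "fin_dim X" and T: "endo_on X T"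
  shows "finite {c. eigenvalue_on X T c}"
proof (rule ccontr)
  assume "infinite {c. eigenvalue_on X T c}"
  then obtain I where I: "finite I" "card I = Suc (cvs.dim X)" "I \<subseteq> {c. eigenvalue_on X T c}"
    by (meson infinite_arbitrarily_large)
  then have "\<forall>c\<in>I. \<exists>v. v \<in> X \<and> v \<noteq> 0 \<and> T v = c *\<^sub>C v" unfolding eigenvalue_on_def by blast
  then obtain v where v: "\<And>c. c \<in> I \<Longrightarrow> v c \<in> X \<and> v c \<noteq> 0 \<and> T (v c) = c *\<^sub>C v c" by metis
  note cT = endo_on_clinear[OF T]
  have inj: "inj_on v I"
    by (rule inj_onI) (metis v cvs.scale_right_imp_eq)
  have "cvs.independent (v ` I)"
  proof (rule cvs.independent_if_scalars_zero)
    fix f x assume s: "(\<Sum>x\<in>v ` I. f x *\<^sub>C x) = 0" and x: "x \<in> v ` I"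
    have "(\<Sum>c\<in>I. f (v c) *\<^sub>C v c) = 0" using s by (simp add: sum.reindex[OF inj] o_def)
    then have "\<forall>c\<in>I. f (v c) *\<^sub>C v c = 0"
      using v cT
      by (intro eigenvectors_independent[OF I(1), of "{()}" "\<lambda>_. T" _ "\<lambda>c _. c"])
        (auto simp: clinear_scaleC mult.commute)
    then show "f x = 0" using x v by auto
  qed (use I in simp)
  moreover have "v ` I \<subseteq> X" using v by blast
  ultimately obtain B where B: "finite B" "v ` I \<subseteq> B" "card B = cvs.dim X"
    using fin_dim_extend_basis[OF X(2,1)] by metis
  then show False using card_mono[OF B(1,2)] card_image[OF inj] I(2) by simp
qed

section \<open>Finite-dimensional representations of \<open>sl2\<close>\<close>

locale sl2_rep = fd_subspace X for X :: "'x::complex_vector set" +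
  fixes T E F :: "'x \<Rightarrow> 'x"
  assumes T: "endo_on X T" and E: "endo_on X E" and F: "endo_on X F"
    and TE: "\<And>x. x \<in> X \<Longrightarrow> T (E x) - E (T x) = 2 *\<^sub>C E x"
    and TF: "\<And>x. x \<in> X \<Longrightarrow> T (F x) - F (T x) = (-2) *\<^sub>C F x"
    and EF: "\<And>x. x \<in> X \<Longrightarrow> E (F x) - F (E x) = T x"
begin

lemma funpow_in: "endo_on X S \<Longrightarrow> v \<in> X \<Longrightarrow> (S ^^ k) v \<in> X"
  by (induction k) (auto dest: endo_on_in)

text \<open>Stated for a general step \<open>d\<close>, since it serves \<open>E\<close> with
  \<open>d = 2\<close> and \<open>F\<close> with \<open>d = -2\<close>.\<close>

lemma weight_shift:
  assumes S: "endo_on X S" and TS: "\<And>x. x \<in> X \<Longrightarrow> T (S x) - S (T x) = d *\<^sub>C S x"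
    and v: "v \<in> X" "T v = c *\<^sub>C v"
  shows "T ((S ^^ k) v) = (c + of_nat k * d) *\<^sub>C (S ^^ k) v"
proof (induction k)
  case (Suc k)
  let ?u = "(S ^^ k) v"
  have "T (S ?u) = S (T ?u) + d *\<^sub>C S ?u"
    using TS[OF funpow_in[OF S v(1)], of k] by (simp add: algebra_simps)
  also have "\<dots> = (c + of_nat (Suc k) * d) *\<^sub>C S ?u"
    unfolding Suc clinear_scaleC[OF endo_on_clinear[OF S]] scaleC_add_left[symmetric]
    by (simp add: algebra_simps)
  finally show ?case by simp
qed (simp add: v)

text \<open>Otherwise the numbers \<open>c + k d\<close> would be infinitely many
  eigenvalues.\<close>

lemma funpow_vanishes:
  assumes S: "endo_on X S" and TS: "\<And>x. x \<in> X \<Longrightarrow> T (S x) - S (T x) = d *\<^sub>C S x" "d \<noteq> 0"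
    and v: "v \<in> X" "T v = c *\<^sub>C v"
  shows "\<exists>k. (S ^^ k) v = 0"
proof (rule ccontr)
  assume "\<not> ?thesis"
  then have "c + of_nat k * d \<in> {c. eigenvalue_on X T c}" for k
    using weight_shift[OF S TS(1) v, of k] funpow_in[OF S v(1), of k] unfolding eigenvalue_on_def by blast
  then have "range (\<lambda>k. c + of_nat k * d) \<subseteq> {c. eigenvalue_on X T c}" by blast
  moreover have "inj (\<lambda>k. c + of_nat k * d)" using TS(2) by (auto simp: inj_def)
  ultimately show False
    using finite_eigenvalues[OF sub fd T] by (meson finite_subset infinite_UNIV_nat range_inj_infinite)
qed

lemma last_nonzero:
  assumes "v \<noteq> 0" "\<exists>k. (S ^^ k) v = 0"
  shows "\<exists>k. (S ^^ k) v \<noteq> 0 \<and> S ((S ^^ k) v) = 0"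
proof -
  define n where "n = (LEAST k. (S ^^ k) v = 0)"
  have n: "(S ^^ n) v = 0" unfolding n_def using assms(2) by (rule LeastI_ex)
  then have "n \<noteq> 0" using assms(1) by (cases n) auto
  then obtain k where k: "n = Suc k" using not0_implies_Suc by blast
  have "(S ^^ k) v \<noteq> 0"
    using not_less_Least[of k "\<lambda>k. (S ^^ k) v = 0"] k unfolding n_def by simp
  then show ?thesis using n k by auto
qed

text \<open>Raise an eigenvector by \<open>E\<close> as long as possible to \<open>w\<close> of
  weight \<open>l = c + 2 k\<close>, then lower it by \<open>F\<close> to the last nonzero vector
  \<open>F^j w\<close>. The relation \<open>E (F^(j+1) w) = (j + 1) (l - j) F^j w\<close> forces
  \<open>l = j\<close>, so \<open>c\<close> is even an integer.\<close>

lemma eigenvalue_real: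
  assumes "eigenvalue_on X T c" shows "c \<in> \<real>"
proof -
  obtain v where v: "v \<in> X" "v \<noteq> 0" "T v = c *\<^sub>C v" using assms unfolding eigenvalue_on_def by blast
  obtain k where k: "(E ^^ k) v \<noteq> 0" "E ((E ^^ k) v) = 0"
    using last_nonzero[OF v(2) funpow_vanishes[OF E TE _ v(1,3)]] by auto
  define w where "w = (E ^^ k) v"
  define l where "l = c + of_nat k * 2"
  have w: "w \<in> X" "w \<noteq> 0" "E w = 0" "T w = l *\<^sub>C w"
    using k funpow_in[OF E v(1)] weight_shift[OF E TE v(1,3)] by (simp_all add: w_def l_def)
  obtain j where j: "(F ^^ j) w \<noteq> 0" "F ((F ^^ j) w) = 0"
    using last_nonzero[OF w(2) funpow_vanishes[OF F TF _ w(1,4)]] by auto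
  have e: "E (F ((F ^^ i) w)) = ((of_nat i + 1) * (l - of_nat i)) *\<^sub>C (F ^^ i) w" for i
  proof (induction i)
    case 0
    have "E (F w) = T w + F (E w)" using EF[OF w(1)] by (metis diff_add_cancel)
    then show ?case using w by (simp add: clinear_0[OF endo_on_clinear[OF F]])
  next
    case (Suc i)
    let ?u = "F ((F ^^ i) w)"
    have u: "?u \<in> X" using funpow_in[OF F w(1), of "Suc i"] by simp
    have "E (F ?u) = T ?u + F (E ?u)" using EF[OF u] by (metis diff_add_cancel)
    also have "T ?u = (l + of_nat (Suc i) * (-2)) *\<^sub>C ?u"
      using weight_shift[OF F TF w(1,4), of "Suc i"] by simp
    also have "F (E ?u) = ((of_nat i + 1) * (l - of_nat i)) *\<^sub>C ?u"
      unfolding Suc by (rule clinear_scaleC[OF endo_on_clinear[OF F]])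
    finally have "E (F ?u) = ((l + of_nat (Suc i) * (-2)) + (of_nat i + 1) * (l - of_nat i)) *\<^sub>C ?u"
      by (simp only: scaleC_add_left)
    moreover have "(l + of_nat (Suc i) * (-2)) + (of_nat i + 1) * (l - of_nat i)
        = (of_nat (Suc i) + 1) * (l - of_nat (Suc i))" by (simp add: algebra_simps)
    ultimately show ?case by simp
  qed
  have "((of_nat j + 1) * (l - of_nat j)) *\<^sub>C (F ^^ j) w = 0"
    using e[of j] j(2) clinear_0[OF endo_on_clinear[OF E]] by simp
  then have "(of_nat j + 1) * (l - of_nat j) = 0" using j(1) by simp
  moreover have "(of_nat j + 1 :: complex) \<noteq> 0" by (metis of_nat_Suc of_nat_eq_0_iff add.commute nat.distinct(1))
  ultimately have "l = of_nat j" by simp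
  then have "c = of_nat j - of_nat k * 2" unfolding l_def by (simp add: algebra_simps)
  then show ?thesis by simp
qed

text \<open>\<open>T\<close> is nilpotent. If \<open>E (T u) = 0\<close>, then
  \<open>T (E u) = 2 E u\<close>, and nilpotency gives \<open>E u = 0\<close>. This removes the
  powers of \<open>T\<close> one at a time, starting from \<open>T^n = 0\<close>.\<close>

lemma trivial_if_ctrace_square_zero:
  assumes tr: "ctrace X (\<lambda>x. T (T x)) = 0" and x: "x \<in> X"
  shows "E x = 0"
proof -
  define n where "n = cvs.dim X"
  have nil: "(T ^^ n) x = 0" if "x \<in> X" for x
    unfolding n_def using nilpotent_if_ctrace_square_zero[OF sub fd T eigenvalue_real tr that] .
  have "E ((T ^^ (n - i)) x) = 0" if "x \<in> X" for i x
    using that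
  proof (induction i arbitrary: x)
    case 0
    then show ?case using nil by (simp add: clinear_0[OF endo_on_clinear[OF E]])
  next
    case (Suc i)
    show ?case
    proof (cases "i < n")
      case True
      let ?u = "(T ^^ (n - Suc i)) x"
      have u: "?u \<in> X" using funpow_in[OF T Suc.prems] .
      have "Suc (n - Suc i) = n - i" using True by simp
      then have "T ?u = (T ^^ (n - i)) x" by (metis funpow.simps(2) comp_apply)
      then have "E (T ?u) = 0" using Suc by simp
      then have e: "T (E ?u) = 2 *\<^sub>C E ?u" using TE[OF u] by simp
      have "(T ^^ k) (E ?u) = (2 ^ k) *\<^sub>C E ?u" for k
        by (induction k) (simp_all add: clinear_scaleC[OF endo_on_clinear[OF T]] e mult.commute)
      from this[of n] show ?thesis using nil[OF endo_on_in[OF E u]] by simp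
    next
      \<comment> \<open>Subtraction is truncated: both exponents are 0 and nothing changes.\<close>
      case False
      then have "n - Suc i = n - i" by simp
      then show ?thesis using Suc by simp
    qed
  qed
  from this[OF x, of n] show ?thesis by simp
qed

end

section \<open>Ideals of a simple Lie algebra\<close>

locale simple_lie =
  fixes lb :: "'g::complex_vector \<Rightarrow> 'g \<Rightarrow> 'g"
  assumes simple: "simple_lie_algebra lb"
begin

lemma lie: "lie_algebra lb" and fin_dim_UNIV: "fin_dim (UNIV :: 'g set)"
  and nonabelian: "\<exists>x y. lb x y \<noteq> 0" and ideal_cases: "lie_ideal lb I \<Longrightarrow> I = {0} \<or> I = UNIV"
  using simple unfolding simple_lie_algebra_def by (elim conjE, (assumption | iprover))+

lemma lb_left: "clinear (\<lambda>x. lb x y)" and lb_right: "clinear (lb x)" and lb_self: "lb x x = 0"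
  and jacobi: "lb x (lb y z) + lb y (lb z x) + lb z (lb x y) = 0"
  using lie unfolding lie_algebra_def by (elim conjE, iprover)+

lemma lb_anti: "lb y x = - lb x y"
proof -
  have "lb (x + y) (x + y) = 0" by (rule lb_self)
  then have "lb x y + lb y x = 0"
    unfolding clinear_add[OF lb_left] clinear_add[OF lb_right] by (simp add: lb_self add.commute)
  then show ?thesis by (simp add: eq_neg_iff_add_eq_0 add.commute)
qed

lemma jacobi': "lb x (lb y z) = lb (lb x y) z + lb y (lb x z)"
  using jacobi[of x y z] lb_anti[of z "lb x y"] lb_anti[of x z] clinear_neg[OF lb_right, of y "lb x z"]
  by (simp add: algebra_simps)

text \<open>The center is an ideal, and it is proper because some bracket is nonzero.\<close>

lemma center_trivial: assumes "\<And>z. lb t z = 0" shows "t = 0"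
proof -
  have "lie_ideal lb {t. \<forall>z. lb t z = 0}"
    unfolding lie_ideal_def
  proof (intro conjI allI ballI)
    show "cvs.subspace {t. \<forall>z. lb t z = 0}"
      unfolding cvs.subspace_def
      by (simp add: clinear_0[OF lb_left] clinear_add[OF lb_left] clinear_scaleC[OF lb_left])
    fix x y assume "y \<in> {t. \<forall>z. lb t z = 0}"
    then have "lb x y = 0" using lb_anti[of x y] by simp
    then show "lb x y \<in> {t. \<forall>z. lb t z = 0}" by (simp add: clinear_0[OF lb_left])
  qed
  then have "{t. \<forall>z. lb t z = 0} = {0}" using ideal_cases nonabelian by blast
  then show ?thesis using assms by blast
qed

text \<open>The derived algebra is a nonzero ideal. This enters twice: the roots must produce every
  element, and cocycles with values in a trivial module must vanish.\<close>

lemma perfect: "cvs.span {lb x y | x y. True} = UNIV"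
proof -
  let ?D = "cvs.span {lb x y | x y. True}"
  have "lie_ideal lb ?D"
    unfolding lie_ideal_def by (auto intro: cvs.span_base)
  moreover have "?D \<noteq> {0}" using nonabelian cvs.span_base[of _ "{lb x y | x y. True}"] by blast
  ultimately show ?thesis using ideal_cases by blast
qed

end

section \<open>Root spaces and an \<open>sl2\<close>-triple\<close>

locale simple_lie_cartan = simple_lie lb for lb :: "'g::complex_vector \<Rightarrow> 'g \<Rightarrow> 'g" +
  fixes H :: "'g set"
  assumes cartan: "cartan_subalgebra lb H"
begin

lemma H_subspace: "cvs.subspace H" and H_abelian: "h \<in> H \<Longrightarrow> k \<in> H \<Longrightarrow> lb h k = 0"
  and H_self_centralizing: "(\<And>h. h \<in> H \<Longrightarrow> lb h x = 0) \<Longrightarrow> x \<in> H"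
  and H_diagonalizable: "h \<in> H \<Longrightarrow> cvs.span {x. \<exists>c. lb h x = c *\<^sub>C x} = UNIV"
  using cartan unfolding cartan_subalgebra_def by blast+

text \<open>The extension by zero guarantees that two distinct weights differ at a point of
  \<open>H\<close>, which is the separation condition of
  \<open>eigenvectors_independent\<close>.\<close>

definition weights :: "('g \<Rightarrow> complex) set" where
  "weights = {\<alpha>. \<forall>x. x \<notin> H \<longrightarrow> \<alpha> x = 0}"

lemma root_spaceI: "(\<And>h. h \<in> H \<Longrightarrow> lb h x = \<alpha> h *\<^sub>C x) \<Longrightarrow> x \<in> root_space lb H \<alpha>"
  and root_spaceD: "x \<in> root_space lb H \<alpha> \<Longrightarrow> h \<in> H \<Longrightarrow> lb h x = \<alpha> h *\<^sub>C x"
  by (auto simp: root_space_def)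

lemma root_space_subspace: "cvs.subspace (root_space lb H \<alpha>)"
  unfolding cvs.subspace_def root_space_def
  by (simp add: clinear_0[OF lb_right] clinear_add[OF lb_right] clinear_scaleC[OF lb_right]
      scaleC_add_right mult.commute)

text \<open>\<open>H\<close> need not be finite, so the simultaneous diagonalization is applied to a
  finite basis \<open>F\<close> of it.\<close>

lemma span_root_spaces: "cvs.span (\<Union>\<alpha>\<in>weights. root_space lb H \<alpha>) = UNIV"
proof -
  obtain F where F: "finite F" "cvs.span F = H"
    using fin_dim_basis[OF fin_dim_subset[OF fin_dim_UNIV subset_UNIV] H_subspace] by metis
  have FH: "F \<subseteq> H" using F(2) cvs.span_superset by blast
  have "cvs.span {x. \<forall>h\<in>F. \<exists>c. lb h x = c *\<^sub>C x} = UNIV"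
  proof (rule simultaneous_diagonalization[OF F(1) lb_right])
    fix h k x assume "h \<in> F" "k \<in> F"
    then show "lb h (lb k x) = lb k (lb h x)"
      using jacobi'[of h k x] H_abelian FH clinear_0[OF lb_left] by (metis add_0 subsetD)
  qed (use FH H_diagonalizable in blast)
  moreover have "{x. \<forall>h\<in>F. \<exists>c. lb h x = c *\<^sub>C x} \<subseteq> (\<Union>\<alpha>\<in>weights. root_space lb H \<alpha>)"
  proof
    fix x assume x: "x \<in> {x. \<forall>h\<in>F. \<exists>c. lb h x = c *\<^sub>C x}"
    \<comment> \<open>The elements that have \<open>x\<close> as an eigenvector form a subspace,
      hence from \<open>F\<close> the property passes to all of \<open>H\<close>.\<close>
    have "cvs.subspace {h. \<exists>c. lb h x = c *\<^sub>C x}"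
      unfolding cvs.subspace_def
    proof (intro conjI ballI allI)
      show "0 \<in> {h. \<exists>c. lb h x = c *\<^sub>C x}" by (auto intro!: exI[of _ 0] simp: clinear_0[OF lb_left])
      fix h k assume "h \<in> {h. \<exists>c. lb h x = c *\<^sub>C x}" "k \<in> {h. \<exists>c. lb h x = c *\<^sub>C x}"
      then obtain c d where "lb h x = c *\<^sub>C x" "lb k x = d *\<^sub>C x" by blast
      then have "lb (h + k) x = (c + d) *\<^sub>C x" by (simp add: clinear_add[OF lb_left] scaleC_add_left)
      then show "h + k \<in> {h. \<exists>c. lb h x = c *\<^sub>C x}" by blast
    next
      fix a h assume "h \<in> {h. \<exists>c. lb h x = c *\<^sub>C x}"
      then obtain c where "lb h x = c *\<^sub>C x" by blast
      then have "lb (a *\<^sub>C h) x = (a * c) *\<^sub>C x" by (simp add: clinear_scaleC[OF lb_left])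
      then show "a *\<^sub>C h \<in> {h. \<exists>c. lb h x = c *\<^sub>C x}" by blast
    qed
    then have "H \<subseteq> {h. \<exists>c. lb h x = c *\<^sub>C x}"
      using cvs.span_minimal[of F "{h. \<exists>c. lb h x = c *\<^sub>C x}"] x F(2) by blast
    then have "\<forall>h\<in>H. \<exists>c. lb h x = c *\<^sub>C x" by blast
    then obtain w where w: "\<forall>h\<in>H. lb h x = w h *\<^sub>C x" by metis
    let ?a = "\<lambda>h. if h \<in> H then w h else 0"
    have "?a \<in> weights" "x \<in> root_space lb H ?a" using w by (auto simp: weights_def root_space_def)
    then show "x \<in> (\<Union>\<alpha>\<in>weights. root_space lb H \<alpha>)" by blast
  qed
  ultimately show ?thesis using cvs.span_mono by blast
qed

lemma root_bracket:
  assumes "x \<in> root_space lb H \<alpha>" "y \<in> root_space lb H \<beta>"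
  shows "lb x y \<in> root_space lb H (\<lambda>h. \<alpha> h + \<beta> h)"
proof (rule root_spaceI)
  fix h assume h: "h \<in> H"
  show "lb h (lb x y) = (\<alpha> h + \<beta> h) *\<^sub>C lb x y"
    unfolding jacobi'[of h x y] root_spaceD[OF assms(1) h] root_spaceD[OF assms(2) h]
    by (simp add: clinear_scaleC[OF lb_left] clinear_scaleC[OF lb_right] scaleC_add_left)
qed

text \<open>Let \<open>t = lb x y\<close>. If \<open>\<alpha> t = 0\<close>, then \<open>t\<close>
  commutes with \<open>x\<close> and \<open>y\<close>, so both act on each eigenspace of
  \<open>ad t\<close>, and there the scalar \<open>t\<close> is their commutator, hence 0 by the
  trace. As \<open>ad t\<close> is diagonalizable, \<open>t\<close> is central.\<close>

lemma opposite_roots: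
  assumes x: "x \<in> root_space lb H \<alpha>" and y: "y \<in> root_space lb H \<beta>"
    and ab: "\<And>h. h \<in> H \<Longrightarrow> \<beta> h = - \<alpha> h" and a0: "\<alpha> (lb x y) = 0"
  shows "lb x y = 0"
proof (rule center_trivial)
  let ?t = "lb x y"
  have tH: "?t \<in> H"
    by (rule H_self_centralizing) (use root_spaceD[OF root_bracket[OF x y]] ab in simp)
  have tx: "lb ?t x = 0" and ty: "lb ?t y = 0"
    using root_spaceD[OF x tH] root_spaceD[OF y tH] ab[OF tH] a0 by simp_all
  have "lb ?t z = 0" if zt: "z \<in> {z. \<exists>c. lb ?t z = c *\<^sub>C z}" for z
  proof -
    obtain c where c: "lb ?t z = c *\<^sub>C z" using zt by blast
    let ?Z = "{z. lb ?t z = c *\<^sub>C z}"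
    interpret fd_subspace ?Z
    proof
      show "cvs.subspace ?Z"
        using clinear_kernel_subspace[OF clinear_minus[OF lb_right clinear_scale] cvs.subspace_UNIV, of ?t c] by simp
      show "fin_dim ?Z" by (rule fin_dim_subset[OF fin_dim_UNIV]) simp
    qed
    have e: "endo_on ?Z (lb u)" if "lb ?t u = 0" for u
      using that jacobi'[of ?t u]
      by (auto simp: endo_on_def lb_right clinear_0[OF lb_left] clinear_scaleC[OF lb_right])
    show ?thesis
    proof (cases "z = 0")
      case True then show ?thesis by (simp add: clinear_0[OF lb_right])
    next
      case False
      have "c = 0"
      proof (rule commutator_scalar[OF e[OF tx] e[OF ty]])
        show "?Z \<noteq> {0}" using False c by blast
        fix z' assume "z' \<in> ?Z"
        then show "lb x (lb y z') - lb y (lb x z') = c *\<^sub>C z'" using jacobi'[of x y z'] by simp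
      qed
      then show ?thesis using c by simp
    qed
  qed
  then show "lb ?t z = 0" for z
    using clinear_eq_on_span[OF lb_right clinear_zero, of "{z. \<exists>c. lb ?t z = c *\<^sub>C z}" ?t z]
      H_diagonalizable[OF tH] by auto
qed

text \<open>Without a triple, brackets of opposite root spaces vanish, so every bracket lies in the
  sum of the root spaces of nonzero weight. By perfectness this sum is everything; since
  \<open>H\<close> has weight zero, independence of weights gives \<open>H = 0\<close>, and then
  self-centralization makes the whole algebra zero.\<close>

lemma sl2_triple_exists:
  "\<exists>t e f. lb t e = 2 *\<^sub>C e \<and> lb t f = (-2) *\<^sub>C f \<and> lb e f = t \<and> e \<noteq> 0"
proof (rule ccontr)
  assume no: "\<not> ?thesis"
  have op: "lb x y = 0" if x: "x \<in> root_space lb H \<alpha>" and y: "y \<in> root_space lb H \<beta>"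
    and ab: "\<And>h. h \<in> H \<Longrightarrow> \<beta> h = - \<alpha> h" for x y \<alpha> \<beta>
  proof (rule ccontr)
    let ?t = "lb x y"
    assume t: "?t \<noteq> 0"
    have tH: "?t \<in> H"
      by (rule H_self_centralizing) (use root_spaceD[OF root_bracket[OF x y]] ab in simp)
    define k where "k = \<alpha> ?t"
    have k: "k \<noteq> 0" using opposite_roots[OF x y ab] t unfolding k_def by blast
    \<comment> \<open>Here \<open>t\<close> has eigenvalue \<open>k\<close> on \<open>x\<close> and
      \<open>- k\<close> on \<open>y\<close>; scaling \<open>t\<close> and \<open>y\<close> by
      \<open>2 / k\<close> normalizes these to 2 and -2 and keeps the bracket relation.\<close>
    have "lb ((2 / k) *\<^sub>C ?t) x = 2 *\<^sub>C x"
      unfolding clinear_scaleC[OF lb_left] root_spaceD[OF x tH] k_def[symmetric] using k by simp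
    moreover have "lb ((2 / k) *\<^sub>C ?t) ((2 / k) *\<^sub>C y) = (-2) *\<^sub>C ((2 / k) *\<^sub>C y)"
      unfolding clinear_scaleC[OF lb_left] clinear_scaleC[OF lb_right] root_spaceD[OF y tH] ab[OF tH] k_def[symmetric]
      using k by simp
    moreover have "lb x ((2 / k) *\<^sub>C y) = (2 / k) *\<^sub>C ?t" by (rule clinear_scaleC[OF lb_right])
    moreover have "x \<noteq> 0" using t clinear_0[OF lb_left] by blast
    ultimately show False using no by blast
  qed
  let ?G = "weights - {\<lambda>_. 0}"
  let ?N = "cvs.span (\<Union>\<gamma>\<in>?G. root_space lb H \<gamma>)"
  let ?R = "\<Union>\<alpha>\<in>weights. root_space lb H \<alpha>"
  have rr: "lb x y \<in> ?N" if x: "x \<in> ?R" and y: "y \<in> ?R" for x y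
  proof -
    obtain \<alpha> \<beta> where a: "\<alpha> \<in> weights" "x \<in> root_space lb H \<alpha>" and b: "\<beta> \<in> weights" "y \<in> root_space lb H \<beta>"
      using x y by blast
    show ?thesis
    \<comment> \<open>The first case includes two vectors of weight zero.\<close>
    proof (cases "\<forall>h. \<alpha> h + \<beta> h = 0")
      case True
      then have "\<beta> h = - \<alpha> h" for h by (metis add_eq_0_iff)
      then have "lb x y = 0" using op[OF a(2) b(2)] by blast
      then show ?thesis by (simp add: cvs.span_zero)
    next
      case False
      then have "(\<lambda>h. \<alpha> h + \<beta> h) \<in> ?G" 
        using False a(1) b(1) unfolding weights_def by (simp add: fun_eq_iff)
      from UN_I[of _ _ _ "root_space lb H", OF this root_bracket[OF a(2) b(2)]]
      show ?thesis by (rule cvs.span_base)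
    qed
  qed
  have "lb x y \<in> ?N" for x y
  proof -
    have 1: "lb x y \<in> ?N" if "x \<in> ?R" for x y
      by (rule clinear_span_image_subset[OF lb_right, of ?R x]) (use rr[OF that] span_root_spaces in auto)
    show ?thesis
      by (rule clinear_span_image_subset[OF lb_left, of ?R y]) (use 1 span_root_spaces in auto)
  qed
  then have "{lb x y | x y. True} \<subseteq> ?N" by blast
  from cvs.span_minimal[OF this cvs.subspace_span] have N: "?N = UNIV" unfolding perfect by (rule top.extremum_uniqueI)
  have H0: "h = 0" if h: "h \<in> H" for h
  proof -
    obtain C f where C: "finite C" "C \<subseteq> ?G" "\<forall>\<gamma>\<in>C. f \<gamma> \<in> root_space lb H \<gamma>" "h = (\<Sum>\<gamma>\<in>C. f \<gamma>)"
      using span_UN_sum[of ?G "root_space lb H" h, OF root_space_subspace] unfolding N by (metis UNIV_I)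
    let ?z = "\<lambda>_::'g. 0::complex"
    \<comment> \<open>Moved to the other side, \<open>h\<close> supplies the weight-zero term
      \<open>- h\<close> of a vanishing sum of root vectors.\<close>
    let ?x = "\<lambda>\<gamma>. if \<gamma> = ?z then - h else f \<gamma>"
    have z: "?z \<notin> C" using C(2) by blast
    have "(\<Sum>\<gamma>\<in>C. ?x \<gamma>) = h" unfolding C(4) by (rule sum.cong) (use z in auto)
    then have s: "(\<Sum>\<gamma>\<in>insert ?z C. ?x \<gamma>) = 0" using C(1) z by simp
    have "\<forall>\<gamma>\<in>insert ?z C. ?x \<gamma> = 0"
    proof (rule eigenvectors_independent[of _ H lb ?x "\<lambda>\<gamma>. \<gamma>", OF _ lb_right _ _ s])
      show "finite (insert ?z C)" using C(1) by simp
      fix \<gamma> k assume g: "\<gamma> \<in> insert ?z C" and k: "k \<in> H"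
      show "lb k (?x \<gamma>) = \<gamma> k *\<^sub>C ?x \<gamma>"
      proof (cases "\<gamma> = ?z")
        case True
        then show ?thesis using H_abelian[OF k h] by (simp add: clinear_neg[OF lb_right])
      next
        case False
        then show ?thesis using g C(3) k root_spaceD by simp
      qed
    next
      fix \<gamma> \<delta> assume gd: "\<gamma> \<in> insert ?z C" "\<delta> \<in> insert ?z C" "\<gamma> \<noteq> \<delta>"
      have "insert ?z C \<subseteq> weights" using C(2) by (auto simp: weights_def)
      then have w: "\<gamma> \<in> weights" "\<delta> \<in> weights" using gd by blast+
      obtain h where h: "\<gamma> h \<noteq> \<delta> h" using gd(3) by (meson ext)
      with w have "h \<in> H" unfolding weights_def mem_Collect_eq by metis
      with h show "\<exists>h\<in>H. \<gamma> h \<noteq> \<delta> h" by blast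
    qed
    from bspec[OF this, of ?z] show ?thesis by simp
  qed
  \<comment> \<open>With \<open>H = 0\<close> the centralizer of \<open>H\<close> is the whole
    algebra.\<close>
  have "x \<in> H" for x
    by (rule H_self_centralizing) (metis H0 clinear_0[OF lb_left])
  then show False using H0 nonabelian by metis
qed

end

subsection \<open>Trace forms and the Casimir operator\<close>

text \<open>The operators are linear on the whole type while the bracket relation is demanded on
  \<open>X\<close>; thus a submodule is given by the same \<open>a\<close> on a smaller
  \<open>X\<close>.\<close>

locale lie_rep = fd_subspace X for X :: "'x::complex_vector set" +
  fixes lb :: "'g::complex_vector \<Rightarrow> 'g \<Rightarrow> 'g" and a :: "'g \<Rightarrow> 'x \<Rightarrow> 'x"
  assumes a_left: "\<And>m. clinear (\<lambda>z. a z m)" and a_endo: "\<And>z. endo_on X (a z)"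
    and a_bracket: "\<And>x y m. m \<in> X \<Longrightarrow> a (lb x y) m = a x (a y m) - a y (a x m)"
begin

lemma a_right: "clinear (a z)"
  by (rule endo_on_clinear[OF a_endo])

lemma a_in: "m \<in> X \<Longrightarrow> a z m \<in> X"
  by (rule endo_on_in[OF a_endo])

definition trace_form :: "'g \<Rightarrow> 'g \<Rightarrow> complex" where
  "trace_form x y = ctrace X (\<lambda>m. a x (a y m))"

lemma endo_aa: "endo_on X (\<lambda>m. a x (a y m))"
  by (rule endo_on_compose[OF a_endo a_endo])

lemma endo_aaa: "endo_on X (\<lambda>m. a x (a y (a z m)))"
  by (rule endo_on_compose[OF a_endo endo_aa])

lemma trace_form_commute: "trace_form x y = trace_form y x"
  unfolding trace_form_def by (rule ctrace_comm[OF a_endo a_endo])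

lemma trace_form_clinear: "clinear (\<lambda>x. trace_form x y)"
proof (rule clinearI)
  show "trace_form (x + x') y = trace_form x y + trace_form x' y" for x x'
    unfolding trace_form_def clinear_add[OF a_left] by (rule ctrace_add[OF endo_aa endo_aa])
  show "trace_form (c *\<^sub>C x) y = c *\<^sub>C trace_form x y" for c x
    unfolding trace_form_def clinear_scaleC[OF a_left] scaleC_complex_def by (rule ctrace_scale[OF endo_aa])
qed

text \<open>Written out as triple products, both sides agree by cyclicity of the trace.\<close>

lemma trace_form_invariant: "trace_form (lb x y) z = trace_form x (lb y z)"
proof -
  have "trace_form (lb x y) z = ctrace X (\<lambda>m. a x (a y (a z m)) - a y (a x (a z m)))"
    unfolding trace_form_def
    by (rule ctrace_cong[OF endo_aa endo_on_diff[OF sub endo_aaa endo_aaa]]) (rule a_bracket[OF a_in])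
  moreover have "trace_form x (lb y z) = ctrace X (\<lambda>m. a x (a y (a z m)) - a x (a z (a y m)))"
    unfolding trace_form_def
    by (rule ctrace_cong[OF endo_aa endo_on_diff[OF sub endo_aaa endo_aaa]])
      (simp add: a_bracket clinear_diff[OF a_right])
  moreover have "ctrace X (\<lambda>m. a y (a x (a z m))) = ctrace X (\<lambda>m. a x (a z (a y m)))"
    by (rule ctrace_comm[OF a_endo endo_aa])
  ultimately show ?thesis
    by (simp add: ctrace_diff[OF endo_aaa endo_aaa])
qed

end

locale simple_lie_rep = simple_lie_cartan lb H + lie_rep X lb a
  for lb :: "'g::complex_vector \<Rightarrow> 'g \<Rightarrow> 'g" and H :: "'g set"
    and X :: "'x::complex_vector set" and a :: "'g \<Rightarrow> 'x \<Rightarrow> 'x"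
begin

text \<open>The kernel of the action is an ideal, and it is proper because the action is
  nontrivial.\<close>

lemma faithful:
  assumes nontriv: "\<exists>z. \<exists>m\<in>X. a z m \<noteq> 0" and e: "\<And>m. m \<in> X \<Longrightarrow> a e m = 0"
  shows "e = 0"
proof -
  let ?I = "{z. \<forall>m\<in>X. a z m = 0}"
  have "lie_ideal lb ?I"
    unfolding lie_ideal_def
  proof (intro conjI allI ballI)
    show "cvs.subspace ?I"
      unfolding cvs.subspace_def
      by (simp add: clinear_0[OF a_left] clinear_add[OF a_left] clinear_scaleC[OF a_left])
    show "lb x y \<in> ?I" if "y \<in> ?I" for x y
      using that by (simp add: a_bracket a_in clinear_0[OF a_right])
  qed
  then have "?I = {0} \<or> ?I = UNIV" by (rule ideal_cases)
  moreover have "?I \<noteq> UNIV" using nontriv by blast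
  ultimately show ?thesis using e by blast
qed

text \<open>By invariance the radical is an ideal. If it were everything, the form would vanish at
  \<open>(t, t)\<close> for an \<open>sl2\<close>-triple, and \<open>e\<close> would act by
  zero.\<close>

lemma trace_form_nondegenerate:
  assumes nontriv: "\<exists>z. \<exists>m\<in>X. a z m \<noteq> 0" and z: "\<And>w. trace_form z w = 0"
  shows "z = 0"
proof -
  let ?I = "{z. \<forall>w. trace_form z w = 0}"
  obtain t e f where tef: "lb t e = 2 *\<^sub>C e" "lb t f = (-2) *\<^sub>C f" "lb e f = t" "e \<noteq> 0"
    using sl2_triple_exists by blast
  interpret sl2_rep X "a t" "a e" "a f"
    by unfold_locales
      (simp_all only: a_endo a_bracket[symmetric] tef clinear_scaleC[OF a_left])
  have "lie_ideal lb ?I"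
    unfolding lie_ideal_def
  proof (intro conjI allI ballI)
    show "cvs.subspace ?I"
      unfolding cvs.subspace_def
      by (simp add: clinear_0[OF trace_form_clinear] clinear_add[OF trace_form_clinear]
          clinear_scaleC[OF trace_form_clinear])
    fix x y assume y: "y \<in> ?I"
    have "trace_form (lb x y) w = 0" for w
    proof -
      have "trace_form (lb x y) w = - trace_form (lb y x) w"
        using lb_anti[of x y] clinear_neg[OF trace_form_clinear] by simp
      also have "\<dots> = 0" unfolding trace_form_invariant using y by simp
      finally show ?thesis .
    qed
    then show "lb x y \<in> ?I" by simp
  qed
  then have "?I = {0} \<or> ?I = UNIV" by (rule ideal_cases)
  moreover have "?I \<noteq> UNIV"
  proof
    assume "?I = UNIV"
    then have "trace_form t t = 0" by blast
    then have "\<And>m. m \<in> X \<Longrightarrow> a e m = 0"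
      unfolding trace_form_def by (rule trivial_if_ctrace_square_zero)
    then show False using faithful[OF nontriv] tef(4) by blast
  qed
  ultimately show ?thesis using z by blast
qed

text \<open>\<open>B \<noteq> {}\<close> is part of the result because the trace of the Casimir
  operator will be the number of dual pairs.\<close>

lemma dual_basis:
  assumes nontriv: "\<exists>z. \<exists>m\<in>X. a z m \<noteq> 0"
  obtains B d where "finite B" "B \<noteq> {}" "\<And>b c. b \<in> B \<Longrightarrow> c \<in> B \<Longrightarrow> trace_form (d b) c = (if b = c then 1 else 0)"
    "\<And>z. z = (\<Sum>c\<in>B. trace_form z c *\<^sub>C d c)" "\<And>z. z = (\<Sum>c\<in>B. trace_form (d c) z *\<^sub>C c)"
proof -
  obtain B where B: "finite B" "cvs.independent B" "cvs.span B = (UNIV :: 'g set)"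
    using fin_dim_basis[OF fin_dim_UNIV cvs.subspace_UNIV] by metis
  note lin = trace_form_clinear
  have lin2: "clinear (trace_form z)" for z
    using lin[of z] unfolding trace_form_commute[of _ z] .
  have zero: "z = 0" if "\<And>b. b \<in> B \<Longrightarrow> trace_form z b = 0" for z
  proof (rule trace_form_nondegenerate[OF nontriv])
    show "trace_form z w = 0" for w
      using clinear_eq_on_span[OF lin2 clinear_zero, of B z w] B(3) that by simp
  qed
  \<comment> \<open>\<open>?P\<close> turns the values of the form on \<open>B\<close> into
    coordinates. Nondegeneracy makes it injective, hence bijective, and the preimage of
    \<open>b\<close> is the dual vector \<open>d b\<close>.\<close>
  let ?P = "\<lambda>z. \<Sum>b\<in>B. trace_form z b *\<^sub>C b"
  have "?P ` UNIV = UNIV"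
  proof (rule inj_imp_surj_on)
    show "clinear ?P" by (intro clinear_sum_fun clinear_scaleC_left lin)
    fix z assume "?P z = 0"
    then have "\<forall>b\<in>B. trace_form z b = 0"
      using cvs.independentD[OF B(2,1) order_refl] by blast
    then show "z = 0" using zero by blast
  qed (rule fin_dim_UNIV cvs.subspace_UNIV subset_UNIV)+
  then have d: "?P (inv ?P b) = b" for b by (rule surj_f_inv_f)
  define d where "d = inv ?P"
  note d = d[folded d_def]
  have db: "trace_form (d b) c = (if b = c then 1 else 0)" if "b \<in> B" "c \<in> B" for b c
  proof -
    have "(\<Sum>c\<in>B. (trace_form (d b) c - (if b = c then 1 else 0)) *\<^sub>C c)
        = ?P (d b) - (\<Sum>c\<in>B. (if b = c then 1 else 0) *\<^sub>C c)"
      by (simp only: cvs.scale_left_diff_distrib sum_subtractf)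
    also have "(\<Sum>c\<in>B. (if b = c then 1 else 0) *\<^sub>C c) = (\<Sum>c\<in>B. if b = c then c else 0)"
      by (rule sum.cong) auto
    also have "\<dots> = b" using B(1) that(1) by simp
    finally have s: "(\<Sum>c\<in>B. (trace_form (d b) c - (if b = c then 1 else 0)) *\<^sub>C c) = 0" by (simp only: d diff_self)
    from cvs.independentD[OF B(2,1) order_refl s that(2)] show ?thesis by simp
  qed
  have e1: "z = (\<Sum>c\<in>B. trace_form z c *\<^sub>C d c)" for z
  proof -
    have "z - (\<Sum>c\<in>B. trace_form z c *\<^sub>C d c) = 0"
    proof (rule zero)
      fix b assume b: "b \<in> B"
      have "trace_form (\<Sum>c\<in>B. trace_form z c *\<^sub>C d c) b = (\<Sum>c\<in>B. trace_form z c * trace_form (d c) b)"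
        by (simp add: clinear_sum[OF lin] clinear_scaleC[OF lin] scaleC_complex_def)
      also have "\<dots> = (\<Sum>c\<in>B. if c = b then trace_form z c else 0)"
        by (rule sum.cong) (use db b in auto)
      also have "\<dots> = trace_form z b" using b B(1) by simp
      finally show "trace_form (z - (\<Sum>c\<in>B. trace_form z c *\<^sub>C d c)) b = 0"
        by (simp add: clinear_diff[OF lin])
    qed
    then show ?thesis by simp
  qed
  have e2: "z = (\<Sum>c\<in>B. trace_form (d c) z *\<^sub>C c)" for z
  proof (rule clinear_eq_on_span[of "\<lambda>z. z" "\<lambda>z. \<Sum>c\<in>B. trace_form (d c) z *\<^sub>C c" B])
    show "clinear (\<lambda>z. \<Sum>c\<in>B. trace_form (d c) z *\<^sub>C c)" by (intro clinear_sum_fun clinear_scaleC_left lin2)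
    fix b assume b: "b \<in> B"
    have "(\<Sum>c\<in>B. trace_form (d c) b *\<^sub>C c) = (\<Sum>c\<in>B. if c = b then c else 0)"
      by (rule sum.cong) (use db b in auto)
    then show "b = (\<Sum>c\<in>B. trace_form (d c) b *\<^sub>C c)" using b B(1) by simp
  qed (use B(3) clinear_id in auto)
  have "B \<noteq> {}"
  proof
    assume "B = {}"
    then have "(UNIV :: 'g set) = {0}" using B(3) by simp
    then show False using nonabelian by (metis UNIV_I singletonD)
  qed
  with B(1) show thesis using db e1 e2 by (rule that)
qed

text \<open>This is the invariance of the tensor \<open>\<Sum> d b \<otimes> b\<close>, tested on an
  arbitrary bilinear map. With \<open>a z (a w m)\<close> it makes the Casimir operator commute with
  the action, with \<open>a z (c w)\<close> it trivializes the product of the Casimir operator and a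
  cocycle.\<close>

lemma dual_basis_invariant:
  fixes \<beta> :: "'g \<Rightarrow> 'g \<Rightarrow> 'y::complex_vector"
  assumes B: "finite B" "\<And>z. z = (\<Sum>c\<in>B. trace_form z c *\<^sub>C d c)" "\<And>z. z = (\<Sum>c\<in>B. trace_form (d c) z *\<^sub>C c)"
    and l: "\<And>w. clinear (\<lambda>z. \<beta> z w)" and r: "\<And>z. clinear (\<beta> z)"
  shows "(\<Sum>b\<in>B. \<beta> (lb x (d b)) b + \<beta> (d b) (lb x b)) = 0"
proof -
  have 1: "(\<Sum>b\<in>B. \<beta> (lb x (d b)) b) = (\<Sum>b\<in>B. \<Sum>c\<in>B. trace_form (lb x (d b)) c *\<^sub>C \<beta> (d c) b)"
    by (rule sum.cong[OF refl], subst B(2)) (simp add: clinear_sum[OF l] clinear_scaleC[OF l])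
  have 2: "(\<Sum>b\<in>B. \<beta> (d b) (lb x b)) = (\<Sum>b\<in>B. \<Sum>c\<in>B. trace_form (d c) (lb x b) *\<^sub>C \<beta> (d b) c)"
    by (rule sum.cong[OF refl], subst B(3)) (simp add: clinear_sum[OF r] clinear_scaleC[OF r])
  have 3: "trace_form (lb x (d b)) c = - trace_form (d b) (lb x c)" for b c
    using lb_anti[of x "d b"] clinear_neg[OF trace_form_clinear, of "lb (d b) x" c]
    by (simp add: trace_form_invariant)
  have "(\<Sum>b\<in>B. \<beta> (d b) (lb x b)) = (\<Sum>b\<in>B. \<Sum>c\<in>B. trace_form (d b) (lb x c) *\<^sub>C \<beta> (d c) b)"
    unfolding 2 by (rule sum.swap)
  then show ?thesis unfolding sum.distrib 1 3 by (simp add: sum_negf)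
qed

text \<open>Let \<open>\<Omega>\<close> be the Casimir operator of the trace form. For a cocycle \<open>c\<close>, the cocycle \<open>\<Omega> c\<close> is the
  coboundary of \<open>\<psi>\<^sub>0 = \<Sum> d b \<cdot> c b\<close> (\<open>b\<close> and \<open>d b\<close> dual bases). Correcting \<open>c\<close> by a coboundary, we may thus assume that it has values
  in the kernel of a power of \<open>\<Omega>\<close>, which is a proper submodule because \<open>\<Omega>\<close> has a nonzero trace.\<close>

lemma cocycle_reduction:
  assumes nontriv: "\<exists>z. \<exists>m\<in>X. a z m \<noteq> 0"
    and c: "clinear c" "\<And>z. c z \<in> X" "\<And>x y. c (lb x y) = a x (c y) - a y (c x)"
  shows "\<exists>Y \<psi>. cvs.subspace Y \<and> Y \<subset> X \<and> (\<forall>z. a z ` Y \<subseteq> Y) \<and> \<psi> \<in> X \<and> (\<forall>z. c z - a z \<psi> \<in> Y)"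
proof -
  obtain B d where B: "finite B" "B \<noteq> {}" "\<And>b c. b \<in> B \<Longrightarrow> c \<in> B \<Longrightarrow> trace_form (d b) c = (if b = c then 1 else 0)"
    "\<And>z. z = (\<Sum>c\<in>B. trace_form z c *\<^sub>C d c)" "\<And>z. z = (\<Sum>c\<in>B. trace_form (d c) z *\<^sub>C c)"
    using dual_basis[OF nontriv] by blast
  note inv = dual_basis_invariant[OF B(1,4,5)]
  define Om where "Om = (\<lambda>m. \<Sum>b\<in>B. a (d b) (a b m))"
  have Om: "endo_on X Om" unfolding Om_def by (rule endo_on_sum[OF sub endo_aa])
  have cOm: "clinear Om" using Om endo_on_clinear by blast
  \<comment> \<open>Every dual pair contributes 1 to the trace.\<close>
  have "ctrace X Om = (\<Sum>b\<in>B. trace_form (d b) b)"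
    unfolding Om_def trace_form_def by (rule ctrace_sum[OF endo_aa])
  also have "\<dots> = of_nat (card B)" using B(3) by simp
  finally have "ctrace X Om \<noteq> 0" using B(1,2) by simp
  then obtain l v where l: "l \<noteq> 0" "v \<in> X" "v \<noteq> 0" "Om v = l *\<^sub>C v"
    using ctrace_nonzero_eigenvalue[OF sub fd Om] unfolding eigenvalue_on_def by blast
  have Oml: "(Om ^^ k) v = (l ^ k) *\<^sub>C v" for k
    by (induction k) (simp_all add: clinear_scaleC[OF cOm] l(4) mult.commute)
  have comm: "Om (a x m) = a x (Om m)" if m: "m \<in> X" for x m
  proof -
    have "a x (Om m) - Om (a x m) = (\<Sum>b\<in>B. a (lb x (d b)) (a b m) + a (d b) (a (lb x b) m))"
      unfolding Om_def clinear_sum[OF a_right] sum_subtractf[symmetric]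
      by (rule sum.cong) (simp_all add: a_bracket m a_in clinear_diff[OF a_right])
    also have "\<dots> = 0"
      by (rule inv[of "\<lambda>z w. a z (a w m)"]) (rule a_left, rule clinear_compose[OF a_right a_left])
    finally show ?thesis by simp
  qed
  have inX: "(Om ^^ k) m \<in> X" if "m \<in> X" for k m
    using that by (induction k) (auto intro: endo_on_in[OF Om])
  have commk: "(Om ^^ k) (a x m) = a x ((Om ^^ k) m)" if m: "m \<in> X" for x k m
    by (induction k) (simp_all add: comm inX m)
  define p where "p = (\<Sum>b\<in>B. a (d b) (c b))"
  have pX: "p \<in> X" unfolding p_def by (intro cvs.subspace_sum[OF sub] a_in c)
  \<comment> \<open>Commute \<open>a x\<close> past \<open>a (d b)\<close> and expand
    \<open>a x (c b) = c (lb x b) + a b (c x)\<close>. The last terms add up to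
    \<open>Om (c x)\<close>, the others cancel by invariance.\<close>
  have ap: "a x p = Om (c x)" for x
  proof -
    have "a x p - Om (c x) = (\<Sum>b\<in>B. a (lb x (d b)) (c b) + a (d b) (c (lb x b)))"
      unfolding p_def Om_def clinear_sum[OF a_right] sum_subtractf[symmetric]
      by (rule sum.cong) (simp_all add: a_bracket c a_in clinear_diff[OF a_right])
    also have "\<dots> = 0"
      by (rule inv[of "\<lambda>z w. a z (c w)"]) (rule a_left, rule clinear_compose[OF a_right c(1)])
    finally show ?thesis by simp
  qed
  \<comment> \<open>The images of the powers of \<open>Om\<close> decrease, so they are stable from
    the exponent \<open>k\<close> of minimal dimension on. This provides \<open>q\<close> with
    \<open>Om^(k+1) q = Om^k p\<close>.\<close>
  let ?V = "\<lambda>k. (Om ^^ k) ` X"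
  obtain k where k: "\<And>j. cvs.dim (?V k) \<le> cvs.dim (?V j)"
    using ex_has_least_nat[of "\<lambda>_. True" _ "\<lambda>k. cvs.dim (?V k)"] by blast
  have sV: "cvs.subspace (?V j)" for j by (rule clinear_image_subspace[OF clinear_funpow[OF cOm] sub])
  have VX: "?V j \<subseteq> X" for j using inX by blast
  have "?V (Suc k) = ?V k"
  proof (rule subspace_eqI_dim[OF fin_dim_subset[OF fd VX] sV sV _ k])
    show "?V (Suc k) \<subseteq> ?V k"
      using endo_on_in[OF Om] by (auto simp: funpow_swap1)
  qed
  then have "(Om ^^ k) p \<in> ?V (Suc k)" using pX by blast
  then obtain q where q: "q \<in> X" "(Om ^^ Suc k) q = (Om ^^ k) p" by (metis imageE)
  define Y where "Y = {v \<in> X. (Om ^^ Suc k) v = 0}"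
  have "cvs.subspace Y" unfolding Y_def by (rule clinear_kernel_subspace[OF clinear_funpow[OF cOm] sub])
  \<comment> \<open>The eigenvector for the nonzero eigenvalue stays outside \<open>Y\<close>, so
    the dimension really drops.\<close>
  moreover have "(Om ^^ Suc k) v \<noteq> 0" unfolding Oml using l by simp
  with l(2) have "Y \<subset> X" unfolding Y_def by blast
  moreover have "a z ` Y \<subseteq> Y" for z
    unfolding Y_def using a_in commk[of _ "Suc k" z] clinear_0[OF a_right] by (auto simp del: funpow.simps)
  moreover have "c z - a z q \<in> Y" for z
  proof -
    \<comment> \<open>Since \<open>Om (c z) = a z p\<close>, applying \<open>Om^k\<close> and moving
      it past \<open>a z\<close> turns \<open>p\<close> into \<open>Om q\<close>; so
      \<open>Om^(k+1)\<close> does not distinguish \<open>c z\<close> from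
      \<open>a z q\<close>.\<close>
    have "(Om ^^ Suc k) (c z) = (Om ^^ k) (a z p)" unfolding ap by (simp add: funpow_swap1)
    also have "\<dots> = (Om ^^ Suc k) (a z q)" unfolding commk[OF pX] commk[OF q(1)] q(2) ..
    finally have "(Om ^^ Suc k) (c z - a z q) = 0"
      unfolding clinear_diff[OF clinear_funpow[OF cOm]] by simp
    then show ?thesis unfolding Y_def using cvs.subspace_diff[OF sub c(2) a_in[OF q(1)]] by blast
  qed
  ultimately show ?thesis using q(1) by blast
qed

end

text \<open>For a nontrivial action, \<open>cocycle_reduction\<close> replaces the cocycle by a
  cohomologous one with values in a proper submodule, and the induction hypothesis gives the rest of
  the primitive.\<close>

lemma (in simple_lie_cartan) whitehead:
  fixes X :: "'x::complex_vector set" and a :: "'g \<Rightarrow> 'x \<Rightarrow> 'x"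
  assumes "lie_rep X lb a"
    and "clinear c" "\<And>z. c z \<in> X" "\<And>x y. c (lb x y) = a x (c y) - a y (c x)"
  shows "\<exists>\<psi>\<in>X. \<forall>z. c z = a z \<psi>"
  using assms
proof (induction "cvs.dim X" arbitrary: X c rule: less_induct)
  case less
  interpret lie_rep X lb a by (rule less)
  interpret simple_lie_rep lb H X a by unfold_locales
  show ?case
  proof (cases "\<exists>z. \<exists>m\<in>X. a z m \<noteq> 0")
    case True
    obtain Y p where Y: "cvs.subspace Y" "Y \<subset> X" "\<And>z. a z ` Y \<subseteq> Y" "p \<in> X" "\<And>z. c z - a z p \<in> Y"
      using cocycle_reduction[OF True less(3-5)] by blast
    have "lie_rep Y lb a"
    proof
      show "cvs.subspace Y" by (rule Y)
      show "fin_dim Y" using fin_dim_subset[OF fd] Y(2) by blast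
      show "endo_on Y (a z)" for z using a_right Y(3) by (simp add: endo_on_def)
    qed (use a_left a_bracket Y(2) in auto)
    moreover have "clinear (\<lambda>z. c z - a z p)" by (rule clinear_minus[OF less(3) a_left])
    moreover have "c (lb x y) - a (lb x y) p = a x (c y - a y p) - a y (c x - a x p)" for x y
      by (simp add: less(5) a_bracket Y(4) clinear_diff[OF a_right])
    ultimately obtain q where q: "q \<in> Y" "\<And>z. c z - a z p = a z q"
      using less(1)[OF dim_less[OF fd sub Y(1,2)], of "\<lambda>z. c z - a z p"] Y(5) by blast
    have "c z = a z (p + q)" for z
      unfolding clinear_add[OF a_right] using q(2)[of z] by (simp add: algebra_simps)
    moreover have "p + q \<in> X" using Y q(1) cvs.subspace_add[OF sub] by blast
    ultimately show ?thesis by blast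
  next
    case False
    \<comment> \<open>For a trivial action the cocycle identity says that \<open>c\<close> vanishes
      on brackets, which span the algebra.\<close>
    have "c z = 0" for z
    proof (rule clinear_eq_on_span[OF less(3) clinear_zero])
      show "z \<in> cvs.span {lb x y | x y. True}" unfolding perfect by simp
      show "c b = 0" if "b \<in> {lb x y | x y. True}" for b
        using that False less(4,5) by auto
    qed
    then show ?thesis using False cvs.subspace_0[OF sub] by (intro bexI[of _ 0]) auto
  qed
qed

text \<open>Whitehead's lemma for \<open>Hom(W, K)\<close>; \<open>cocycle\<close> is the cocycle
  identity for the commutator action on it.\<close>

lemma (in simple_lie_cartan) whitehead_hom:
  fixes W :: "'w::complex_vector set" and K :: "'k::complex_vector set"
  assumes W: "lie_rep W lb b" and K: "lie_rep K lb a"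
    and c: "\<And>w. clinear (\<lambda>z. c z w)" "\<And>z. clinear (c z)" "\<And>z w. w \<in> W \<Longrightarrow> c z w \<in> K"
    and cocycle: "\<And>x y w. w \<in> W \<Longrightarrow>
      c (lb x y) w = (a x (c y w) - c y (b x w)) - (a y (c x w) - c x (b y w))"
  shows "\<exists>\<psi>. clinear \<psi> \<and> (\<forall>w\<in>W. \<psi> w \<in> K) \<and> (\<forall>z. \<forall>w\<in>W. c z w = a z (\<psi> w) - \<psi> (b z w))"
proof -
  interpret W: lie_rep W lb b by (rule W)
  interpret K: lie_rep K lb a by (rule K)
  obtain p where p: "clinear p" "\<And>x. p x \<in> W" "\<And>x. x \<in> W \<Longrightarrow> p x = x"
    using clinear_projection[OF W.sub] by blast
  obtain BW where BW: "finite BW" "cvs.independent BW" "cvs.span BW = W"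
    using fin_dim_basis[OF W.fd W.sub] by metis
  obtain BK where BK: "finite BK" "cvs.independent BK" "cvs.span BK = K"
    using fin_dim_basis[OF K.fd K.sub] by metis
  \<comment> \<open>\<open>Hom(W, K)\<close> is modelled by the maps on the whole type that factor
    through the projection \<open>p\<close> onto \<open>W\<close>. Two such maps are equal iff they
    agree on \<open>W\<close>.\<close>
  define X where "X = {\<phi> :: 'w \<Rightarrow> 'k. clinear \<phi> \<and> (\<forall>w. \<phi> w \<in> K) \<and> (\<forall>w. \<phi> (p w) = \<phi> w)}"
  have X: "cvs.subspace X"
    unfolding cvs.subspace_def X_def
    by (auto intro!: clinear_intros cvs.subspace_0 cvs.subspace_add cvs.subspace_scale K.sub
        simp: plus_fun_def zero_fun_def scaleC_fun_def)
  obtain P :: "('w \<Rightarrow> 'k) \<Rightarrow> 'w \<Rightarrow> 'k"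
    where P: "clinear P" "\<And>\<phi>. P \<phi> \<in> X" "\<And>\<phi>. \<phi> \<in> X \<Longrightarrow> P \<phi> = \<phi>"
    using clinear_projection[OF X] by blast
  have PX: "clinear (P \<phi>)" "P \<phi> w \<in> K" "P \<phi> (p w) = P \<phi> w" for \<phi> w using P(2)[of \<phi>] by (auto simp: X_def)
  \<comment> \<open>The action must be total and linear, hence the projection \<open>P\<close> onto
    \<open>X\<close>; on \<open>X\<close> it is the usual action on linear maps.\<close>
  define A where "A = (\<lambda>z \<phi> w. a z (P \<phi> w) - P \<phi> (b z (p w)))"
  have AA: "A z \<phi> = (\<lambda>w. a z (\<phi> w) - \<phi> (b z (p w)))" if "\<phi> \<in> X" for z \<phi>
    using P(3)[OF that] by (simp add: A_def)
  have pb: "p (b z (p w)) = b z (p w)" for z w by (intro p(3) W.a_in p(2))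
  have AX: "A z \<phi> \<in> X" for z \<phi>
    unfolding X_def A_def
    by (auto intro!: clinear_minus clinear_compose[OF K.a_right PX(1)] cvs.subspace_diff[OF K.sub] K.a_in PX
        clinear_compose[OF PX(1)] clinear_compose[OF W.a_right p(1)] simp: PX p)
  have "lie_rep X lb A"
  proof
    show "cvs.subspace X" by (rule X)
    \<comment> \<open>The elementary matrices for the bases of \<open>W\<close> and
      \<open>K\<close>, precomposed with \<open>p\<close>.\<close>
    let ?E = "\<lambda>(u, k) w. cvs.representation BW (p w) u *\<^sub>C k"
    show "fin_dim X"
      unfolding fin_dim_def
    proof (intro exI conjI subsetI)
      show "finite (?E ` (BW \<times> BK))" using BW(1) BK(1) by simp
      fix \<phi> assume "\<phi> \<in> X"
      then have phi: "clinear \<phi>" "\<And>w. \<phi> w \<in> K" "\<And>w. \<phi> (p w) = \<phi> w" by (auto simp: X_def)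
      have expand: "\<phi> w = (\<Sum>x\<in>BW \<times> BK. cvs.representation BK (\<phi> (fst x)) (snd x) *\<^sub>C ?E x w)" for w
      proof -
        have "\<phi> w = \<phi> (\<Sum>u\<in>BW. cvs.representation BW (p w) u *\<^sub>C u)"
          using cvs.sum_representation_eq[OF BW(2) _ BW(1), of "p w"] p(2) BW(3) phi(3) by simp
        also have "\<dots> = (\<Sum>u\<in>BW. cvs.representation BW (p w) u *\<^sub>C \<phi> u)"
          by (simp add: clinear_sum[OF phi(1)] clinear_scaleC[OF phi(1)])
        also have "\<dots> = (\<Sum>u\<in>BW. cvs.representation BW (p w) u *\<^sub>C
            (\<Sum>k\<in>BK. cvs.representation BK (\<phi> u) k *\<^sub>C k))"
          using cvs.sum_representation_eq[OF BK(2) _ BK(1)] phi(2) BK(3) by simp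
        also have "\<dots> = (\<Sum>u\<in>BW. \<Sum>k\<in>BK. cvs.representation BK (\<phi> u) k *\<^sub>C ?E (u, k) w)"
          by (simp add: cvs.scale_sum_right mult.commute)
        finally show ?thesis by (simp add: sum.cartesian_product split_def)
      qed
      have e: "\<phi> = (\<Sum>x\<in>BW \<times> BK. cvs.representation BK (\<phi> (fst x)) (snd x) *\<^sub>C ?E x)"
        by (rule ext) (simp only: sum_fun_apply scaleC_fun_apply, rule expand)
      show "\<phi> \<in> cvs.span (?E ` (BW \<times> BK))"
        by (subst e) (intro cvs.span_sum cvs.span_scale cvs.span_base imageI)
    qed
    show "clinear (\<lambda>z. A z \<phi>)" for \<phi>
    proof (rule clinearI)
      show "A (x + y) \<phi> = A x \<phi> + A y \<phi>" for x y
        unfolding A_def fun_eq_iff plus_fun_apply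
        by (simp add: clinear_add[OF K.a_left] clinear_add[OF W.a_left] clinear_add[OF PX(1)])
      show "A (d *\<^sub>C x) \<phi> = d *\<^sub>C A x \<phi>" for d x
        unfolding A_def fun_eq_iff scaleC_fun_apply
        by (simp add: clinear_scaleC[OF K.a_left] clinear_scaleC[OF W.a_left] clinear_scaleC[OF PX(1)]
            cvs.scale_right_diff_distrib)
    qed
    show "endo_on X (A z)" for z
      unfolding endo_on_def
    proof (intro conjI clinearI)
      show "A z (\<phi> + \<psi>) = A z \<phi> + A z \<psi>" for \<phi> \<psi>
        unfolding A_def fun_eq_iff plus_fun_apply clinear_add[OF P(1)] clinear_add[OF K.a_right] by simp
      show "A z (d *\<^sub>C \<phi>) = d *\<^sub>C A z \<phi>" for d \<phi>
        unfolding A_def fun_eq_iff scaleC_fun_apply clinear_scaleC[OF P(1)] clinear_scaleC[OF K.a_right]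
        by (simp add: cvs.scale_right_diff_distrib)
      show "A z ` X \<subseteq> X" using AX by blast
    qed
    show "A (lb x y) \<phi> = A x (A y \<phi>) - A y (A x \<phi>)" if phi: "\<phi> \<in> X" for x y \<phi>
    proof -
      have f: "clinear \<phi>" "\<And>w. \<phi> w \<in> K" using phi by (auto simp: X_def)
      show ?thesis
        unfolding AA[OF AX] unfolding AA[OF phi] fun_eq_iff minus_apply
        by (simp add: K.a_bracket f(2) W.a_bracket p(2) pb clinear_diff[OF f(1)] clinear_diff[OF K.a_right])
    qed
  qed
  moreover have "clinear (\<lambda>z w. c z (p w))"
    by (rule clinearI)
      (simp_all add: fun_eq_iff clinear_add[OF c(1)] clinear_scaleC[OF c(1)])
  moreover have cX: "(\<lambda>w. c z (p w)) \<in> X" for z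
    unfolding X_def using clinear_compose[OF c(2) p(1)] c(3) p(2,3) by simp
  moreover have "(\<lambda>w. c (lb x y) (p w)) = A x (\<lambda>w. c y (p w)) - A y (\<lambda>w. c x (p w))" for x y
    unfolding AA[OF cX] fun_eq_iff minus_apply using cocycle[OF p(2)] pb by simp
  ultimately obtain \<psi> where psi: "\<psi> \<in> X" "\<And>z. (\<lambda>w. c z (p w)) = A z \<psi>"
    using whitehead[of X A "\<lambda>z w. c z (p w)"] by blast
  show ?thesis
  proof (intro exI conjI allI ballI)
    show "clinear \<psi>" "\<psi> w \<in> K" for w using psi(1) by (auto simp: X_def)
    show "c z w = a z (\<psi> w) - \<psi> (b z w)" if "w \<in> W" for z w
      using fun_cong[OF psi(2)[unfolded AA[OF psi(1)]], of z w] p(3)[OF that] by simp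
  qed
qed

section \<open>Tensor products, symmetric and exterior algebras\<close>

lemma poly_mapping_expand:
  "p = (\<Sum>k\<in>Poly_Mapping.keys p. Poly_Mapping.lookup p k *\<^sub>C basis_vec k)"
  using lin_ext_basis_vec[of p] by (simp add: lin_ext_def)

text \<open>The common core of extensionality for tensor products, symmetric and exterior algebras;
  \<open>A\<close> stands for the quotient map.\<close>

lemma quotient_eqI:
  fixes A :: "('k \<Rightarrow>\<^sub>0 complex) \<Rightarrow> 'b::complex_vector"
  assumes "clinear A" "clinear f" "clinear g" "\<And>k. f (A (basis_vec k)) = g (A (basis_vec k))"
  shows "f (A p) = g (A p)"
proof -
  have "f (A p) = (\<Sum>k\<in>Poly_Mapping.keys p. Poly_Mapping.lookup p k *\<^sub>C f (A (basis_vec k)))"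
    by (subst poly_mapping_expand)
      (simp only: clinear_sum[OF assms(1)] clinear_scaleC[OF assms(1)] clinear_sum[OF assms(2)] clinear_scaleC[OF assms(2)])
  moreover have "g (A p) = (\<Sum>k\<in>Poly_Mapping.keys p. Poly_Mapping.lookup p k *\<^sub>C g (A (basis_vec k)))"
    by (subst poly_mapping_expand)
      (simp only: clinear_sum[OF assms(1)] clinear_scaleC[OF assms(1)] clinear_sum[OF assms(3)] clinear_scaleC[OF assms(3)])
  ultimately show ?thesis using assms(4) by simp
qed

lemma tensor_eqI:
  assumes "clinear f" "clinear g" "\<And>a b. f (a \<otimes>\<^sub>C b) = g (a \<otimes>\<^sub>C b)"
  shows "f t = g t"
proof -
  obtain p where t: "t = abs_tensor p" by (metis Quotient_abs_rep[OF Quotient_tensor])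
  have "clinear (abs_tensor :: _ \<Rightarrow> ('a, 'b) tensor)"
    by (rule clinearI) (simp_all add: plus_tensor.abs_eq scaleC_tensor.abs_eq)
  from quotient_eqI[OF this assms(1,2)] show ?thesis
    unfolding t using assms(3) by (simp add: tensor_prod.abs_eq split_paired_all)
qed

lemma sym_eqI:
  assumes "clinear f" "clinear g" "\<And>M. f (sym_monom M) = g (sym_monom M)"
  shows "f u = g u"
proof -
  obtain p where u: "u = abs_sym p" by (metis Quotient_abs_rep[OF Quotient_sym])
  have "clinear (abs_sym :: _ \<Rightarrow> 'a sym)"
    by (rule clinearI) (simp_all add: plus_sym.abs_eq scaleC_sym.abs_eq)
  from quotient_eqI[OF this assms(1,2)] show ?thesis
    unfolding u using assms(3) by (simp add: sym_monom.abs_eq)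
qed

lemma ext_eqI:
  assumes "clinear f" "clinear g" "\<And>xs. f (wedge xs) = g (wedge xs)"
  shows "f w = g w"
proof -
  obtain p where w: "w = abs_ext p" by (metis Quotient_abs_rep[OF Quotient_ext])
  have "clinear (abs_ext :: _ \<Rightarrow> 'a ext)"
    by (rule clinearI) (simp_all add: plus_ext.abs_eq scaleC_ext.abs_eq)
  from quotient_eqI[OF this assms(1,2)] show ?thesis
    unfolding w using assms(3) by (simp add: wedge.abs_eq)
qed

text \<open>A lift is a finite sum over a chosen representative of \<open>t\<close>, hence linear in
  the lifted function whether or not that function is bilinear. This and its two analogues handle
  the outer variables of nested lifts.\<close>

lemma tensor_lift_param: "(\<And>a b. clinear (\<lambda>x. f x a b)) \<Longrightarrow> clinear (\<lambda>x. tensor_lift (f x) t)"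
  unfolding tensor_lift_def lin_ext_def
  by (intro clinear_sum_fun clinear_scaleC_fun) (simp add: split_def)

lemma sym_lift_param: "(\<And>M. clinear (\<lambda>x. f x M)) \<Longrightarrow> clinear (\<lambda>x. sym_lift (f x) u)"
  unfolding sym_lift_def lin_ext_def by (intro clinear_sum_fun clinear_scaleC_fun)

lemma ext_lift_param: "(\<And>xs. clinear (\<lambda>x. f x xs)) \<Longrightarrow> clinear (\<lambda>x. ext_lift (f x) w)"
  unfolding ext_lift_def lin_ext_def by (intro clinear_sum_fun clinear_scaleC_fun)

lemma tensor_prod_left: "clinear (\<lambda>a. a \<otimes>\<^sub>C b)"
proof (rule clinearI)
  fix x y and c :: complex
  have "basis_vec (x + y, b) - (basis_vec (x, b) + basis_vec (y, b)) \<in> cvs.span tensor_rel"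
    unfolding tensor_rel_def diff_diff_eq
    by (rule cvs.span_base, rule UnI1, rule UnI1, rule UnI1) (rule CollectI, rule exI[of _ x], rule exI[of _ y], rule exI[of _ b], simp)
  then show "(x + y) \<otimes>\<^sub>C b = x \<otimes>\<^sub>C b + y \<otimes>\<^sub>C b"
    by (simp only: tensor_prod.abs_eq plus_tensor.abs_eq scaleC_tensor.abs_eq tensor.abs_eq_iff)
  have "basis_vec (c *\<^sub>C x, b) - c *\<^sub>C basis_vec (x, b) \<in> cvs.span tensor_rel"
    unfolding tensor_rel_def
    by (rule cvs.span_base, rule UnI1, rule UnI2) (rule CollectI, rule exI[of _ c], rule exI[of _ x], rule exI[of _ b], simp)
  then show "(c *\<^sub>C x) \<otimes>\<^sub>C b = c *\<^sub>C (x \<otimes>\<^sub>C b)"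
    by (simp only: tensor_prod.abs_eq plus_tensor.abs_eq scaleC_tensor.abs_eq tensor.abs_eq_iff)
qed

lemma tensor_prod_right: "clinear (\<lambda>b. a \<otimes>\<^sub>C b)"
proof (rule clinearI)
  fix x y and c :: complex
  have "basis_vec (a, x + y) - (basis_vec (a, x) + basis_vec (a, y)) \<in> cvs.span tensor_rel"
    unfolding tensor_rel_def diff_diff_eq
    by (rule cvs.span_base, rule UnI1, rule UnI1, rule UnI2) (rule CollectI, rule exI[of _ a], rule exI[of _ x], rule exI[of _ y], simp)
  then show "a \<otimes>\<^sub>C (x + y) = a \<otimes>\<^sub>C x + a \<otimes>\<^sub>C y"
    by (simp only: tensor_prod.abs_eq plus_tensor.abs_eq scaleC_tensor.abs_eq tensor.abs_eq_iff)
  have "basis_vec (a, c *\<^sub>C x) - c *\<^sub>C basis_vec (a, x) \<in> cvs.span tensor_rel"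
    unfolding tensor_rel_def
    by (rule cvs.span_base, rule UnI2) (rule CollectI, rule exI[of _ c], rule exI[of _ a], rule exI[of _ x], simp)
  then show "a \<otimes>\<^sub>C (c *\<^sub>C x) = c *\<^sub>C (a \<otimes>\<^sub>C x)"
    by (simp only: tensor_prod.abs_eq plus_tensor.abs_eq scaleC_tensor.abs_eq tensor.abs_eq_iff)
qed

lemmas tensor_prod_simps =
  clinear_add[OF tensor_prod_left] clinear_add[OF tensor_prod_right]
  clinear_diff[OF tensor_prod_left] clinear_diff[OF tensor_prod_right]
  clinear_scaleC[OF tensor_prod_left] clinear_scaleC[OF tensor_prod_right]
  clinear_neg[OF tensor_prod_left] clinear_neg[OF tensor_prod_right]
  clinear_0[OF tensor_prod_left] clinear_0[OF tensor_prod_right]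

lemma tensor_map_bilinear:
  assumes "clinear f" "clinear g"
  shows "clinear (\<lambda>a. f a \<otimes>\<^sub>C g b)" "clinear (\<lambda>b. f a \<otimes>\<^sub>C g b)"
  by (rule clinear_compose[OF tensor_prod_left assms(1)], rule clinear_compose[OF tensor_prod_right assms(2)])

lemma tensor_map_clinear: "clinear f \<Longrightarrow> clinear g \<Longrightarrow> clinear (tensor_map f g)"
  unfolding tensor_map_def by (intro tensor_lift_clinear tensor_map_bilinear)

lemma tensor_map_prod: "clinear f \<Longrightarrow> clinear g \<Longrightarrow> tensor_map f g (a \<otimes>\<^sub>C b) = f a \<otimes>\<^sub>C g b"
  unfolding tensor_map_def by (intro tensor_lift_prod tensor_map_bilinear)

lemma clinear_id': "clinear id"
  using clinear_id by (simp add: id_def)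

lemma tensor_diag_clinear: "clinear f \<Longrightarrow> clinear g \<Longrightarrow> clinear (tensor_diag f g)"
  unfolding tensor_diag_def[abs_def] by (intro clinear_plus tensor_map_clinear clinear_id')

lemma tensor_diag_prod:
  "clinear f \<Longrightarrow> clinear g \<Longrightarrow> tensor_diag f g (a \<otimes>\<^sub>C b) = f a \<otimes>\<^sub>C b + a \<otimes>\<^sub>C g b"
  by (simp add: tensor_diag_def tensor_map_prod clinear_id')

lemma tensor_map_param:
  assumes "\<And>a. clinear (\<lambda>x. f x a)" "clinear g"
  shows "clinear (\<lambda>x. tensor_map (f x) g t)"
  unfolding tensor_map_def
  by (rule tensor_lift_param) (rule clinear_compose[OF tensor_prod_left assms(1)])

lemma tensor_diag_param:
  assumes "\<And>a. clinear (\<lambda>x. f x a)" "\<And>b. clinear (\<lambda>x. g x b)"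
  shows "clinear (\<lambda>x. tensor_diag (f x) (g x) t)"
  unfolding tensor_diag_def tensor_map_def
  by (intro clinear_plus tensor_lift_param)
    (simp_all add: clinear_compose[OF tensor_prod_left assms(1)] clinear_compose[OF tensor_prod_right assms(2)])

lemma fin_dim_tensor:
  assumes "fin_dim A" "fin_dim B"
  shows "fin_dim (cvs.span {a \<otimes>\<^sub>C b | a b. a \<in> A \<and> b \<in> B})"
proof -
  obtain A' B' where A': "finite A'" "A \<subseteq> cvs.span A'" and B': "finite B'" "B \<subseteq> cvs.span B'"
    using assms unfolding fin_dim_def by blast
  let ?G = "(\<lambda>(a, b). a \<otimes>\<^sub>C b) ` (A' \<times> B')"
  have "a \<otimes>\<^sub>C b \<in> cvs.span ?G" if a: "a \<in> A" and b: "b \<in> B" for a b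
  proof (rule clinear_span_image_subset[OF tensor_prod_left])
    show "a \<in> cvs.span A'" using a A'(2) by blast
    fix a' assume a': "a' \<in> A'"
    show "a' \<otimes>\<^sub>C b \<in> cvs.span ?G"
    proof (rule clinear_span_image_subset[OF tensor_prod_right])
      show "b \<in> cvs.span B'" using b B'(2) by blast
      show "a' \<otimes>\<^sub>C b' \<in> cvs.span ?G" if "b' \<in> B'" for b'
        using that a' by (intro cvs.span_base) auto
    qed
  qed
  then have "{a \<otimes>\<^sub>C b | a b. a \<in> A \<and> b \<in> B} \<subseteq> cvs.span ?G" by blast
  from cvs.span_minimal[OF this cvs.subspace_span] show ?thesis
    unfolding fin_dim_def by (intro exI[of _ ?G]) (simp add: A'(1) B'(1))
qed

subsection \<open>The symmetric algebra\<close>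

lemma sym_monom_clinear: "clinear (\<lambda>x. sym_monom (add_mset x M))"
proof (rule clinearI)
  fix x y and c :: complex
  have "basis_vec (add_mset (x + y) M) - (basis_vec (add_mset x M) + basis_vec (add_mset y M)) \<in> cvs.span sym_rel"
    unfolding sym_rel_def diff_diff_eq
    by (rule cvs.span_base, rule UnI1) (rule CollectI, rule exI[of _ x], rule exI[of _ y], rule exI[of _ M], simp)
  then show "sym_monom (add_mset (x + y) M) = sym_monom (add_mset x M) + sym_monom (add_mset y M)"
    by (simp only: sym_monom.abs_eq plus_sym.abs_eq scaleC_sym.abs_eq sym.abs_eq_iff)
  have "basis_vec (add_mset (c *\<^sub>C x) M) - c *\<^sub>C basis_vec (add_mset x M) \<in> cvs.span sym_rel"
    unfolding sym_rel_def
    by (rule cvs.span_base, rule UnI2) (rule CollectI, rule exI[of _ c], rule exI[of _ x], rule exI[of _ M], simp)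
  then show "sym_monom (add_mset (c *\<^sub>C x) M) = c *\<^sub>C sym_monom (add_mset x M)"
    by (simp only: sym_monom.abs_eq plus_sym.abs_eq scaleC_sym.abs_eq sym.abs_eq_iff)
qed

lemma sym_monom_empty: "sym_monom {#} = 1"
  by transfer (simp add: cvs.span_zero flip: single_one)

lemma sym_monom_add: "sym_monom (add_mset y M) = sym_gen y * sym_monom M"
  by transfer (simp add: mult_single cvs.span_zero)

lemma sym_mult_left: "clinear (\<lambda>u. u * v :: 'a::complex_vector sym)"
  by (rule clinearI; transfer) (simp_all add: distrib_right scaleC_mult_poly_mapping cvs.span_zero)

lemma sym_mult_right: "clinear (\<lambda>v. u * v :: 'a::complex_vector sym)"
  unfolding mult.commute[of u] by (rule sym_mult_left)

lemma sym_gen_clinear: "clinear sym_gen"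
  by (rule sym_monom_clinear)

text \<open>A Leibniz rule shared by the adjoint action and the homotopy: the term that removes the
  new factor \<open>y\<close> is \<open>\<delta> y M\<close>, and from all the others
  \<open>y\<close> can be pulled out by \<open>m y\<close>. The second claim is the multilinearity
  that \<open>sym_lift\<close> requires.\<close>

lemma sym_lift_derivation:
  fixes \<delta> :: "'a::complex_vector \<Rightarrow> 'a multiset \<Rightarrow> 'b::complex_vector" and m :: "'a \<Rightarrow> 'b \<Rightarrow> 'b"
  assumes f: "f = (\<lambda>M. \<Sum>y\<in>#M. \<delta> y (M - {#y#}))"
    and d: "\<And>M. clinear (\<lambda>y. \<delta> y M)" and m: "\<And>y. clinear (m y)" "\<And>b. clinear (\<lambda>y. m y b)"
    and dm: "\<And>y z M. \<delta> z (add_mset y M) = m y (\<delta> z M)"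
  shows "f (add_mset y M) = \<delta> y M + m y (f M)" and "clinear (\<lambda>y. f (add_mset y M))"
proof -
  have "(\<Sum>z\<in>#M. \<delta> z (add_mset y M - {#z#})) = (\<Sum>z\<in>#M. m y (\<delta> z (M - {#z#})))" for y
    by (rule arg_cong[of _ _ sum_mset], rule image_mset_cong) (simp add: dm[symmetric] multi_member_split add_mset_commute)
  moreover have "m y (\<Sum>z\<in>#N. g z) = (\<Sum>z\<in>#N. m y (g z))" for N :: "'a multiset" and g y
    by (induction N) (simp_all add: clinear_0[OF m(1)] clinear_add[OF m(1)])
  ultimately have e: "f (add_mset y M) = \<delta> y M + m y (f M)" for y by (simp add: f)
  show "f (add_mset y M) = \<delta> y M + m y (f M)" by (rule e)
  show "clinear (\<lambda>y. f (add_mset y M))" unfolding e by (intro clinear_plus d m)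
qed

text \<open>Scales the part of degree \<open>p\<close> by \<open>f p\<close>. Indicator functions
  give the projections to the graded pieces, reciprocals invert the Euler operator.\<close>

definition sym_weight :: "(nat \<Rightarrow> complex) \<Rightarrow> 'a::complex_vector sym \<Rightarrow> 'a sym" where
  "sym_weight f = sym_lift (\<lambda>M. f (size M) *\<^sub>C sym_monom M)"

lemma sym_weight_cond: "clinear (\<lambda>x. f (size (add_mset x M)) *\<^sub>C sym_monom (add_mset x M))"
  by (simp add: clinear_scaleC_fun sym_monom_clinear)

lemma sym_weight_clinear: "clinear (sym_weight f)"
  unfolding sym_weight_def by (rule sym_lift_clinear) (rule sym_weight_cond)

lemma sym_weight_monom: "sym_weight f (sym_monom M) = f (size M) *\<^sub>C sym_monom M"
  unfolding sym_weight_def by (rule sym_lift_monom) (rule sym_weight_cond)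

lemma sym_monom_in_pow: "sym_monom M \<in> sym_pow (size M)"
  unfolding sym_pow_def by (rule cvs.span_base) blast

lemma sym_gen_mult_pow:
  fixes u :: "'a::complex_vector sym"
  shows "u \<in> sym_pow p \<Longrightarrow> sym_gen y * u \<in> sym_pow (Suc p)"
  unfolding sym_pow_def
proof (erule clinear_span_image_subset[OF sym_mult_right, rotated])
  fix b assume "b \<in> {sym_monom M | M :: 'a multiset. size M = p}"
  then obtain M where "b = sym_monom M" "size M = p" by blast
  then have "sym_gen y * b = sym_monom (add_mset y M)" "size (add_mset y M) = Suc p"
    by (simp_all add: sym_monom_add[symmetric])
  then show "sym_gen y * b \<in> cvs.span {sym_monom M | M. size M = Suc p}"
    by (intro cvs.span_base) blast
qed

lemma fin_dim_sym_pow: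
  assumes "fin_dim (UNIV :: 'a::complex_vector set)"
  shows "fin_dim (sym_pow p :: 'a sym set)"
proof -
  obtain B :: "'a set" where B: "finite B" "cvs.span B = UNIV"
    using fin_dim_basis[OF assms cvs.subspace_UNIV] by metis
  let ?S = "\<lambda>n. (\<lambda>xs. sym_monom (mset xs)) ` {xs. set xs \<subseteq> B \<and> length xs = n}"
  have "sym_monom M \<in> cvs.span (?S (size M))" for M
  proof (induction M)
    case empty
    show ?case by (rule cvs.span_base) (simp add: image_iff)
  next
    case (add y M)
    have "sym_gen b * sym_monom M \<in> cvs.span (?S (Suc (size M)))" if b: "b \<in> B" for b
    proof (rule clinear_span_image_subset[OF sym_mult_right _ add])
      fix u assume "u \<in> ?S (size M)"
      then obtain xs where xs: "set xs \<subseteq> B" "length xs = size M" "u = sym_monom (mset xs)" by blast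
      have "sym_gen b * u = sym_monom (mset (b # xs))" unfolding xs by (simp add: sym_monom_add[symmetric])
      then show "sym_gen b * u \<in> cvs.span (?S (Suc (size M)))"
        by (intro cvs.span_base image_eqI[of _ _ "b # xs"]) (use xs b in auto)
    qed
    then have "sym_gen y * sym_monom M \<in> cvs.span (?S (Suc (size M)))"
      by (rule clinear_span_image_subset[OF clinear_compose[OF sym_mult_left sym_gen_clinear], of B]) (simp_all add: B(2))
    then show ?case by (simp add: sym_monom_add[of y M])
  qed
  then have "sym_pow p \<subseteq> cvs.span (?S p)"
    unfolding sym_pow_def by (intro cvs.span_minimal cvs.subspace_span) blast
  moreover have "finite (?S p)" using finite_lists_length_eq[OF B(1)] by blast
  ultimately show ?thesis unfolding fin_dim_def by blast
qed

subsection \<open>The exterior algebra\<close>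

text \<open>Square-zero operators that depend linearly on \<open>y\<close> anticommute, so iterating them is alternating. A
  function of words that is not itself such an iteration often becomes one when paired with \<open>wedge\<close>.\<close>

lemma ext_fold:
  fixes L :: "'a::complex_vector \<Rightarrow> 'b::complex_vector \<Rightarrow> 'b"
  assumes L: "\<And>b. clinear (\<lambda>y. L y b)" "\<And>y. clinear (L y)" "\<And>y b. L y (L y b) = 0"
    and F: "\<And>y ys. F (y # ys) = L y (F ys)"
  shows "clinear (\<lambda>x. F (xs @ x # ys))" and "\<not> distinct xs \<Longrightarrow> F xs = 0"
proof -
  show "clinear (\<lambda>x. F (xs @ x # ys))"
    by (induction xs) (simp_all add: F L(1) clinear_compose[OF L(2)])
  have anti: "L y (L z b) = - L z (L y b)" for y z b
  proof -
    have "L (y + z) (L (y + z) b) = 0" by (rule L(3))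
    then have "L y (L z b) + L z (L y b) = 0"
      unfolding clinear_add[OF L(1)] clinear_add[OF L(2)] by (simp add: L(3) add.commute)
    then show ?thesis by (simp add: eq_neg_iff_add_eq_0)
  qed
  have mem: "y \<in> set ys \<Longrightarrow> L y (F ys) = 0" for y ys
  proof (induction ys)
    case (Cons z ys)
    then show ?case
      by (cases "y = z") (simp_all add: F L(3) anti[of y z] clinear_0[OF L(2)])
  qed simp
  show "\<not> distinct xs \<Longrightarrow> F xs = 0"
    by (induction xs) (auto simp: F mem clinear_0[OF L(2)])
qed

lemma wedge_clinear: "clinear (\<lambda>x. wedge (xs @ x # ys))"
proof (rule clinearI)
  fix x y and c :: complex
  have "basis_vec (xs @ (x + y) # ys) - (basis_vec (xs @ x # ys) + basis_vec (xs @ y # ys)) \<in> cvs.span ext_rel"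
    unfolding ext_rel_def diff_diff_eq
    by (rule cvs.span_base, rule UnI1, rule UnI1) (rule CollectI, rule exI[of _ x], rule exI[of _ y], rule exI[of _ xs], rule exI[of _ ys], simp)
  then show "wedge (xs @ (x + y) # ys) = wedge (xs @ x # ys) + wedge (xs @ y # ys)"
    by (simp only: wedge.abs_eq plus_ext.abs_eq scaleC_ext.abs_eq ext.abs_eq_iff)
  have "basis_vec (xs @ (c *\<^sub>C x) # ys) - c *\<^sub>C basis_vec (xs @ x # ys) \<in> cvs.span ext_rel"
    unfolding ext_rel_def
    by (rule cvs.span_base, rule UnI1, rule UnI2) (rule CollectI, rule exI[of _ c], rule exI[of _ x], rule exI[of _ xs], rule exI[of _ ys], simp)
  then show "wedge (xs @ (c *\<^sub>C x) # ys) = c *\<^sub>C wedge (xs @ x # ys)"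
    by (simp only: wedge.abs_eq plus_ext.abs_eq scaleC_ext.abs_eq ext.abs_eq_iff)
qed

lemma wedge_not_distinct: "\<not> distinct xs \<Longrightarrow> wedge xs = 0"
  
  by transfer (simp add: ext_rel_def, rule cvs.span_base, blast)

definition ext_mult :: "'a::complex_vector \<Rightarrow> 'a ext \<Rightarrow> 'a ext" where
  "ext_mult y = ext_lift (\<lambda>xs. wedge (y # xs))"

lemma ext_mult_cond:
  "clinear (\<lambda>x. wedge (y # xs @ x # ys))" "\<not> distinct xs \<Longrightarrow> wedge (y # xs) = 0"
  using wedge_clinear[of "y # xs" ys] wedge_not_distinct[of "y # xs"] by simp_all

lemma ext_mult_right: "clinear (ext_mult y)"
  unfolding ext_mult_def by (rule ext_lift_clinear) (fact ext_mult_cond)+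

lemma ext_mult_wedge: "ext_mult y (wedge xs) = wedge (y # xs)"
  unfolding ext_mult_def by (rule ext_lift_wedge) (fact ext_mult_cond)+

lemma ext_mult_left: "clinear (\<lambda>y. ext_mult y w)"
  unfolding ext_mult_def by (rule ext_lift_param) (use wedge_clinear[of "[]"] in simp)

lemma ext_mult_square: "ext_mult y (ext_mult y w) = 0"
  by (rule ext_eqI[OF clinear_compose[OF ext_mult_right ext_mult_right] clinear_zero])
    (simp add: ext_mult_wedge wedge_not_distinct)

lemma ext_mult_anti: "ext_mult y (ext_mult z w) = - ext_mult z (ext_mult y w)"
proof -
  have "ext_mult (y + z) (ext_mult (y + z) w) = 0" by (rule ext_mult_square)
  then have "ext_mult y (ext_mult z w) + ext_mult z (ext_mult y w) = 0"
    unfolding clinear_add[OF ext_mult_left] clinear_add[OF ext_mult_right]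
    by (simp add: ext_mult_square add.commute)
  then show ?thesis by (simp add: eq_neg_iff_add_eq_0)
qed

lemma ext_mult_pow:
  fixes w :: "'a::complex_vector ext"
  shows "w \<in> ext_pow j \<Longrightarrow> ext_mult y w \<in> ext_pow (Suc j)"
  unfolding ext_pow_def
proof (erule clinear_span_image_subset[OF ext_mult_right, rotated])
  fix b assume "b \<in> {wedge xs | xs :: 'a list. length xs = j}"
  then obtain xs where "b = wedge xs" "length xs = j" by blast
  then have "ext_mult y b = wedge (y # xs)" "length (y # xs) = Suc j"
    by (simp_all add: ext_mult_wedge)
  then show "ext_mult y b \<in> cvs.span {wedge xs | xs. length xs = Suc j}"
    by (intro cvs.span_base) blast
qed

lemma wedge_in_pow: "wedge xs \<in> ext_pow (length xs)"
  unfolding ext_pow_def by (rule cvs.span_base) blast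

text \<open>Letters are expanded in \<open>B\<close> one at a time by multilinearity. The
  restriction to words over \<open>B\<close> yields both finite dimension and the vanishing of high
  exterior powers.\<close>

lemma ext_pow_span:
  assumes B: "cvs.span B = (UNIV :: 'a::complex_vector set)"
  shows "ext_pow j \<subseteq> cvs.span (wedge ` {xs. set xs \<subseteq> B \<and> length xs = j})"
proof -
  let ?S = "\<lambda>n. wedge ` {xs. set xs \<subseteq> B \<and> length xs = n}"
  have "wedge xs \<in> cvs.span (?S (length xs))" for xs
  proof (induction xs)
    case Nil
    show ?case by (rule cvs.span_base) simp
  next
    case (Cons y ys)
    have "ext_mult b (wedge ys) \<in> cvs.span (?S (Suc (length ys)))" if b: "b \<in> B" for b
    proof (rule clinear_span_image_subset[OF ext_mult_right _ Cons])
      fix u assume "u \<in> ?S (length ys)"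
      then obtain xs where xs: "set xs \<subseteq> B" "length xs = length ys" "u = wedge xs" by blast
      then show "ext_mult b u \<in> cvs.span (?S (Suc (length ys)))"
        by (intro cvs.span_base image_eqI[of _ _ "b # xs"]) (use b in \<open>auto simp: ext_mult_wedge\<close>)
    qed
    then have "ext_mult y (wedge ys) \<in> cvs.span (?S (Suc (length ys)))"
      by (rule clinear_span_image_subset[OF ext_mult_left, of B]) (simp_all add: B)
    then show ?case by (simp add: ext_mult_wedge)
  qed
  then show ?thesis unfolding ext_pow_def by (intro cvs.span_minimal cvs.subspace_span) blast
qed

lemma fin_dim_ext_pow:
  assumes "fin_dim (UNIV :: 'a::complex_vector set)"
  shows "fin_dim (ext_pow j :: 'a ext set)"
proof -
  obtain B :: "'a set" where B: "finite B" "cvs.span B = UNIV"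
    using fin_dim_basis[OF assms cvs.subspace_UNIV] by metis
  have "finite (wedge ` {xs. set xs \<subseteq> B \<and> length xs = j})"
    using finite_lists_length_eq[OF B(1)] by blast
  then show ?thesis using ext_pow_span[OF B(2)] unfolding fin_dim_def by blast
qed

text \<open>A word over a basis that is longer than the dimension repeats a letter. This is why the
  complex ends at \<open>N\<close>.\<close>

lemma ext_pow_above_dim:
  assumes "fin_dim (UNIV :: 'a::complex_vector set)" "cvs.dim (UNIV :: 'a set) < j"
  shows "(ext_pow j :: 'a ext set) = {0}"
proof -
  obtain B :: "'a set" where B: "finite B" "cvs.span B = UNIV" "card B = cvs.dim (UNIV :: 'a set)"
    using fin_dim_basis[OF assms(1) cvs.subspace_UNIV] by metis
  have "wedge xs = 0" if "set xs \<subseteq> B" "length xs = j" for xs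
  proof (rule wedge_not_distinct)
    show "\<not> distinct xs"
      using card_mono[OF B(1) that(1)] that(2) assms(2) B(3) distinct_card by fastforce
  qed
  then have "wedge ` {xs. set xs \<subseteq> B \<and> length xs = j} \<subseteq> {0}" by blast
  then have "ext_pow j \<subseteq> cvs.span {0 :: 'a ext}"
    using ext_pow_span[OF B(2), of j] cvs.span_mono by blast
  moreover have "0 \<in> ext_pow j" unfolding ext_pow_def by (rule cvs.span_zero)
  ultimately show ?thesis by auto
qed

subsection \<open>The adjoint actions\<close>

context simple_lie
begin

lemma sym_ad_rules:
  shows sym_ad_clinear: "clinear (sym_ad lb x)" and sym_ad_one: "sym_ad lb x 1 = 0"
    and sym_ad_monom: "sym_ad lb x (sym_monom (add_mset y M)) =
      sym_gen (lb x y) * sym_monom M + sym_gen y * sym_ad lb x (sym_monom M)"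
proof -
  let ?f = "\<lambda>M. \<Sum>y\<in>#M. sym_monom (add_mset (lb x y) (M - {#y#}))"
  note D = sym_lift_derivation[of ?f "\<lambda>y M. sym_monom (add_mset (lb x y) M)" "\<lambda>y u. sym_gen y * u",
      OF refl clinear_compose[OF sym_monom_clinear lb_right] sym_mult_right
      clinear_compose[OF sym_mult_left sym_gen_clinear]]
  have "sym_monom (add_mset (lb x z) (add_mset y M)) = sym_gen y * sym_monom (add_mset (lb x z) M)" for z y M
    by (simp only: sym_monom_add[of y "add_mset (lb x z) M", symmetric] add_mset_commute)
  note D = D[OF this]
  show "clinear (sym_ad lb x)" unfolding sym_ad_def by (rule sym_lift_clinear[OF D(2)])
  have m: "sym_ad lb x (sym_monom M) = ?f M" for M unfolding sym_ad_def by (rule sym_lift_monom[OF D(2)])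
  show "sym_ad lb x 1 = 0" using m[of "{#}"] by (simp add: sym_monom_empty)
  show "sym_ad lb x (sym_monom (add_mset y M)) =
      sym_gen (lb x y) * sym_monom M + sym_gen y * sym_ad lb x (sym_monom M)"
    unfolding m using D(1)[of y M] by (simp only: sym_monom_add[of "lb x y" M])
qed

lemma sym_ad_mult: "sym_ad lb x (sym_gen y * u) = sym_gen (lb x y) * u + sym_gen y * sym_ad lb x u"
proof (rule sym_eqI[of "\<lambda>u. sym_ad lb x (sym_gen y * u)"])
  show "clinear (\<lambda>u. sym_ad lb x (sym_gen y * u))" by (rule clinear_compose[OF sym_ad_clinear sym_mult_right])
  show "clinear (\<lambda>u. sym_gen (lb x y) * u + sym_gen y * sym_ad lb x u)"
    by (rule clinear_plus[OF sym_mult_right clinear_compose[OF sym_mult_right sym_ad_clinear]])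
  show "sym_ad lb x (sym_gen y * sym_monom M) = sym_gen (lb x y) * sym_monom M + sym_gen y * sym_ad lb x (sym_monom M)" for M
    using sym_ad_monom[of x y M] by (simp only: sym_monom_add[of y M])
qed

lemma sym_ad_left: "clinear (\<lambda>x. sym_ad lb x u)"
  unfolding sym_ad_def
proof (rule sym_lift_param)
  fix M :: "'g multiset"
  have "clinear (\<lambda>x. \<Sum>y\<in>#N. sym_monom (add_mset (lb x y) (M - {#y#})))" for N
    by (induction N) (simp_all add: clinear_zero clinear_plus clinear_compose[OF sym_monom_clinear lb_left])
  then show "clinear (\<lambda>x. \<Sum>y\<in>#M. sym_monom (add_mset (lb x y) (M - {#y#})))" .
qed

lemma sym_ad_bracket:
  "sym_ad lb (lb x y) u = sym_ad lb x (sym_ad lb y u) - sym_ad lb y (sym_ad lb x u)"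
proof (rule sym_eqI[OF sym_ad_clinear])
  show "clinear (\<lambda>u. sym_ad lb x (sym_ad lb y u) - sym_ad lb y (sym_ad lb x u))"
    by (rule clinear_commutator[OF sym_ad_clinear sym_ad_clinear])
  fix M
  show "sym_ad lb (lb x y) (sym_monom M)
      = sym_ad lb x (sym_ad lb y (sym_monom M)) - sym_ad lb y (sym_ad lb x (sym_monom M))"
  proof (induction M)
    case empty
    then show ?case by (simp add: sym_monom_empty sym_ad_one clinear_0[OF sym_ad_clinear])
  next
    case (add z M)
    have "sym_gen (lb x (lb y z)) = sym_gen (lb (lb x y) z) + sym_gen (lb y (lb x z))"
      using jacobi'[of x y z] by (simp add: clinear_add[OF sym_gen_clinear])
    then show ?case
      unfolding sym_monom_add[of z M] sym_ad_mult clinear_add[OF sym_ad_clinear] add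
      by (simp add: algebra_simps)
  qed
qed

lemma sym_ad_pow: "u \<in> sym_pow p \<Longrightarrow> sym_ad lb x u \<in> sym_pow p"
  unfolding sym_pow_def
proof (erule clinear_span_image_subset[OF sym_ad_clinear, rotated])
  fix b assume "b \<in> {sym_monom M | M :: 'g multiset. size M = p}"
  then obtain M where M: "b = sym_monom M" "size M = p" by blast
  have "sym_ad lb x (sym_monom M) \<in> sym_pow (size M)" for M
  proof (induction M)
    case empty
    then show ?case by (simp add: sym_monom_empty sym_ad_one sym_pow_def cvs.span_zero)
  next
    case (add y M)
    have "sym_gen (lb x y) * sym_monom M \<in> sym_pow (Suc (size M))" by (rule sym_gen_mult_pow[OF sym_monom_in_pow])
    moreover have "sym_gen y * sym_ad lb x (sym_monom M) \<in> sym_pow (Suc (size M))" by (rule sym_gen_mult_pow[OF add])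
    ultimately show ?case unfolding sym_ad_monom size_add_mset sym_pow_def by (rule cvs.span_add)
  qed
  then show "sym_ad lb x b \<in> cvs.span {sym_monom M | M. size M = p}" using M unfolding sym_pow_def by blast
qed

lemma ext_ad_rules:
  shows ext_ad_clinear: "clinear (ext_ad lb x)" and ext_ad_Nil: "ext_ad lb x (wedge []) = 0"
    and ext_ad_mult: "ext_ad lb x (ext_mult y w) = ext_mult (lb x y) w + ext_mult y (ext_ad lb x w)"
proof -
  let ?f = "\<lambda>xs. \<Sum>i<length xs. wedge (xs[i := lb x (xs ! i)])"
  \<comment> \<open>The second component carries the derivative along \<open>x\<close> of the first.
    The square of \<open>?L y\<close> vanishes because wedge multiplications by \<open>y\<close> and
    by \<open>lb x y\<close> anticommute.\<close>
  let ?L = "\<lambda>y p. (ext_mult y (fst p), ext_mult y (snd p) + ext_mult (lb x y) (fst p))"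
  have f: "?f (y # ys) = ext_mult y (?f ys) + ext_mult (lb x y) (wedge ys)" for y ys
    by (simp add: sum.lessThan_Suc_shift ext_mult_wedge clinear_sum[OF ext_mult_right] del: sum.lessThan_Suc)
  let ?F = "\<lambda>xs. (wedge xs, ?f xs)"
  have L1: "clinear (\<lambda>y. ?L y b)" for b
    by (intro clinear_Pair clinear_plus ext_mult_left clinear_compose[OF ext_mult_left lb_right])
  have L2: "clinear (?L y)" for y
    by (intro clinear_Pair clinear_plus clinear_compose[OF ext_mult_right clinear_fst] clinear_compose[OF ext_mult_right clinear_snd])
  have L3: "?L y (?L y b) = 0" for y b
    by (simp add: ext_mult_square clinear_add[OF ext_mult_right] ext_mult_anti[of "lb x y" y] zero_prod_def)
  have L4: "?F (y # ys) = ?L y (?F ys)" for y ys using f by (simp add: ext_mult_wedge)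
  note F = ext_fold[where L = ?L and F = ?F, OF L1 L2 L3 L4]
  have c1: "clinear (\<lambda>x. ?f (xs @ x # ys))" for xs ys
    using clinear_compose[OF clinear_snd F(1)] by simp
  have c2: "?f xs = 0" if "\<not> distinct xs" for xs
    using F(2)[OF that] by (simp add: zero_prod_def)
  show cl: "clinear (ext_ad lb x)" unfolding ext_ad_def by (rule ext_lift_clinear[OF c1 c2])
  have w: "ext_ad lb x (wedge xs) = ?f xs" for xs unfolding ext_ad_def by (rule ext_lift_wedge[OF c1 c2])
  show "ext_ad lb x (wedge []) = 0" by (simp add: w)
  show "ext_ad lb x (ext_mult y w) = ext_mult (lb x y) w + ext_mult y (ext_ad lb x w)"
  proof (rule ext_eqI[of "\<lambda>w. ext_ad lb x (ext_mult y w)"])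
    show "clinear (\<lambda>w. ext_ad lb x (ext_mult y w))" by (rule clinear_compose[OF cl ext_mult_right])
    show "clinear (\<lambda>w. ext_mult (lb x y) w + ext_mult y (ext_ad lb x w))"
      by (rule clinear_plus[OF ext_mult_right clinear_compose[OF ext_mult_right cl]])
    show "ext_ad lb x (ext_mult y (wedge xs)) = ext_mult (lb x y) (wedge xs) + ext_mult y (ext_ad lb x (wedge xs))" for xs
      unfolding ext_mult_wedge[of y] w f by (rule add.commute)
  qed
qed

lemma ext_ad_left: "clinear (\<lambda>x. ext_ad lb x w)"
  unfolding ext_ad_def
  by (intro ext_lift_param clinear_sum_fun)
    (simp add: upd_conv_take_nth_drop clinear_compose[OF wedge_clinear lb_left])

lemma ext_ad_bracket:
  "ext_ad lb (lb x y) w = ext_ad lb x (ext_ad lb y w) - ext_ad lb y (ext_ad lb x w)"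
proof (rule ext_eqI[OF ext_ad_clinear])
  show "clinear (\<lambda>u. ext_ad lb x (ext_ad lb y u) - ext_ad lb y (ext_ad lb x u))"
    by (rule clinear_commutator[OF ext_ad_clinear ext_ad_clinear])
  fix xs
  show "ext_ad lb (lb x y) (wedge xs) = ext_ad lb x (ext_ad lb y (wedge xs)) - ext_ad lb y (ext_ad lb x (wedge xs))"
  proof (induction xs)
    case Nil
    then show ?case by (simp add: ext_ad_Nil clinear_0[OF ext_ad_clinear])
  next
    case (Cons z zs)
    have "ext_mult (lb x (lb y z)) w = ext_mult (lb (lb x y) z) w + ext_mult (lb y (lb x z)) w" for w
      using jacobi'[of x y z] by (simp add: clinear_add[OF ext_mult_left])
    then show ?case
      by (simp add: ext_mult_wedge[symmetric] ext_ad_mult clinear_add[OF ext_ad_clinear] Cons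
          clinear_diff[OF ext_mult_right] algebra_simps)
  qed
qed

lemma ext_ad_pow: "w \<in> ext_pow j \<Longrightarrow> ext_ad lb x w \<in> ext_pow j"
  unfolding ext_pow_def
proof (erule clinear_span_image_subset[OF ext_ad_clinear, rotated])
  fix b assume "b \<in> {wedge xs | xs :: 'g list. length xs = j}"
  then obtain xs where xs: "b = wedge xs" "length xs = j" by blast
  have "ext_ad lb x (wedge xs) \<in> ext_pow (length xs)" for xs
  proof (induction xs)
    case Nil
    then show ?case by (simp add: ext_ad_Nil ext_pow_def cvs.span_zero)
  next
    case (Cons y ys)
    have "ext_mult (lb x y) (wedge ys) \<in> ext_pow (Suc (length ys))" by (rule ext_mult_pow[OF wedge_in_pow])
    moreover have "ext_mult y (ext_ad lb x (wedge ys)) \<in> ext_pow (Suc (length ys))" by (rule ext_mult_pow[OF Cons])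
    ultimately have "ext_ad lb x (ext_mult y (wedge ys)) \<in> ext_pow (Suc (length ys))"
      unfolding ext_ad_mult ext_pow_def by (rule cvs.span_add)
    then show ?case by (simp add: ext_mult_wedge)
  qed
  then show "ext_ad lb x b \<in> cvs.span {wedge xs | xs. length xs = j}" using xs unfolding ext_pow_def by blast
qed

end

section \<open>Graded modules\<close>

locale graded_module = simple_lie lb for lb :: "'g::complex_vector \<Rightarrow> 'g \<Rightarrow> 'g" +
  fixes M :: "('g, 'm::complex_vector) gmod"
  assumes object: "G2_object lb M"
begin

lemma piece_subspace: "cvs.subspace (piece M k)"
  and piece_fin_dim: "fin_dim (piece M k)"
  and act_degree_0: "m \<in> piece M k \<Longrightarrow> act M (x, 0) m \<in> piece M k"
  and act_degree_1: "m \<in> piece M k \<Longrightarrow> act M (0, y) m \<in> piece M (k + 1)"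
  and lie_module: "lie_module_on (sd_bracket lb) (gcarrier M) (act M)"
  using object by (simp_all add: G2_object_def)

lemma direct:
  assumes "\<And>k. k \<le> n \<Longrightarrow> m k \<in> piece M k" "(\<Sum>k\<le>n. m k) = 0" "k \<le> n" shows "m k = 0"
  using object assms unfolding G2_object_def by blast

lemma carrier_subspace: "cvs.subspace (gcarrier M)"
  unfolding gcarrier_def by (rule cvs.subspace_span)

lemma piece_carrier: "m \<in> piece M k \<Longrightarrow> m \<in> gcarrier M"
  unfolding gcarrier_def by (rule cvs.span_base) blast

lemma act_in: "m \<in> gcarrier M \<Longrightarrow> act M a m \<in> gcarrier M"
  and act_add: "m \<in> gcarrier M \<Longrightarrow> m' \<in> gcarrier M \<Longrightarrow> act M a (m + m') = act M a m + act M a m'"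
  and act_scaleC: "m \<in> gcarrier M \<Longrightarrow> act M a (c *\<^sub>C m) = c *\<^sub>C act M a m"
  and act_left: "m \<in> gcarrier M \<Longrightarrow> clinear (\<lambda>a. act M a m)"
  and act_bracket: "m \<in> gcarrier M \<Longrightarrow> act M (sd_bracket lb a b) m = act M a (act M b m) - act M b (act M a m)"
  using lie_module by (simp_all add: lie_module_on_def del: split_paired_All)

lemma act_0: "act M a 0 = 0"
  using act_scaleC[OF cvs.subspace_0[OF carrier_subspace], of a 0] by simp

lemma act_split: "m \<in> gcarrier M \<Longrightarrow> act M (x, y) m = act M (x, 0) m + act M (0, y) m"
  using clinear_add[OF act_left, of m "(x, 0)" "(0, y)"] by simp

lemma sd_bracket_simps:
  "sd_bracket lb (x, 0) (y, 0) = (lb x y, 0)" "sd_bracket lb (x, 0) (0, y) = (0, lb x y)"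
  "sd_bracket lb (0, x) (0, y) = 0"
  by (simp_all add: sd_bracket_def clinear_0[OF lb_right] clinear_0[OF lb_left] zero_prod_def)

lemma act_00: "m \<in> gcarrier M \<Longrightarrow> act M (x, 0) (act M (y, 0) m) - act M (y, 0) (act M (x, 0) m) = act M (lb x y, 0) m"
  and act_01: "m \<in> gcarrier M \<Longrightarrow> act M (x, 0) (act M (0, y) m) = act M (0, lb x y) m + act M (0, y) (act M (x, 0) m)"
  and act_11: "m \<in> gcarrier M \<Longrightarrow> act M (0, x) (act M (0, y) m) = act M (0, y) (act M (0, x) m)"
  using act_bracket[of m "(x, 0)" "(y, 0)"] act_bracket[of m "(x, 0)" "(0, y)"] act_bracket[of m "(0, x)" "(0, y)"]
    clinear_0[OF act_left, of m]
  by (simp_all add: sd_bracket_simps)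

lemma carrier_sum:
  assumes "m \<in> gcarrier M"
  obtains K h where "finite K" "\<And>k. k \<in> K \<Longrightarrow> h k \<in> piece M k" "m = (\<Sum>k\<in>K. h k)"
  using span_UN_sum[of UNIV "piece M" m] piece_subspace assms unfolding gcarrier_def by auto

end

lemma G2_morphism_rules:
  assumes "G2_morphism M N f"
  shows G2_morphism_add: "m \<in> gcarrier M \<Longrightarrow> m' \<in> gcarrier M \<Longrightarrow> f (m + m') = f m + f m'"
    and G2_morphism_scaleC: "m \<in> gcarrier M \<Longrightarrow> f (c *\<^sub>C m) = c *\<^sub>C f m"
    and G2_morphism_act: "m \<in> gcarrier M \<Longrightarrow> f (act M a m) = act N a (f m)"
    and G2_morphism_piece: "m \<in> piece M k \<Longrightarrow> f m \<in> piece N k"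
  using assms unfolding G2_morphism_def by blast+

text \<open>The components of a preimage in degrees other than \<open>s\<close> can be discarded,
  because the pieces of \<open>N\<close> form a direct sum.\<close>

lemma graded_surjective:
  assumes M: "graded_module lb M" and N: "graded_module lb N"
    and e: "G2_morphism M N e" "e ` gcarrier M = gcarrier N" and n: "n \<in> piece N s"
  shows "\<exists>m\<in>piece M s. e m = n"
proof -
  interpret M: graded_module lb M by (rule M)
  interpret N: graded_module lb N by (rule N)
  note eadd = G2_morphism_add[OF e(1)] and escale = G2_morphism_scaleC[OF e(1)] and epiece = G2_morphism_piece[OF e(1)]
  have e0: "e 0 = 0" using escale[OF cvs.subspace_0[OF M.carrier_subspace], of 0] by simp
  obtain m where m: "m \<in> gcarrier M" "n = e m" using N.piece_carrier[OF n] e(2) by blast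
  obtain K h where K: "finite K" "\<And>k. k \<in> K \<Longrightarrow> h k \<in> piece M k" "m = (\<Sum>k\<in>K. h k)"
    using M.carrier_sum[OF m(1)] by blast
  have "e (\<Sum>k\<in>L. h k) = (\<Sum>k\<in>L. e (h k))" if "finite L" "L \<subseteq> K" for L
    using that
  proof (induction L rule: finite_induct)
    case (insert k L)
    have "(\<Sum>k\<in>L. h k) \<in> gcarrier M"
      using insert.prems K(2) M.piece_carrier by (intro cvs.subspace_sum[OF M.carrier_subspace]) blast
    moreover have "h k \<in> gcarrier M" using insert.prems K(2) M.piece_carrier by blast
    ultimately show ?case using insert eadd by simp
  qed (simp add: e0)
  then have n': "n = (\<Sum>k\<in>K. e (h k))" using m(2) K by simp
  define h' where "h' = (\<lambda>k. if k \<in> K then h k else 0)"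
  define b where "b = Max (insert s K)"
  have b: "s \<le> b" "K \<subseteq> {..b}" using K(1) by (auto simp: b_def)
  \<comment> \<open>The homogeneous components of \<open>e m - n\<close>. They sum to 0, so each of
    them vanishes; the one in degree \<open>s\<close> is needed.\<close>
  let ?q = "\<lambda>k. e (h' k) - (if k = s then n else 0)"
  have hp: "h' k \<in> piece M k" for k
    using K(2) cvs.subspace_0[OF M.piece_subspace] by (simp add: h'_def)
  have q: "?q k \<in> piece N k" for k
    using cvs.subspace_diff[OF N.piece_subspace epiece[OF hp]] n cvs.subspace_0[OF N.piece_subspace] by simp
  have "(\<Sum>k\<le>b. e (h' k)) = n"
    unfolding n' by (rule sum.mono_neutral_cong_right) (use b(2) in \<open>auto simp: h'_def e0\<close>)
  then have "(\<Sum>k\<le>b. ?q k) = 0" using b(1) by (simp add: sum_subtractf)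
  from N.direct[of b ?q, OF q this b(1)] have "e (h' s) = n" by simp
  then show ?thesis using hp by blast
qed

subsection \<open>Free modules over the symmetric algebra\<close>

text \<open>The multiplication \<open>m_y\<close> by a degree-one element, on an arbitrary second
  factor.\<close>

definition smul :: "'g::complex_vector \<Rightarrow> ('g sym, 'w::complex_vector) tensor \<Rightarrow> ('g sym, 'w) tensor" where
  "smul y = tensor_map (\<lambda>u. sym_gen y * u) id"

lemma smul_right: "clinear (smul y)"
  unfolding smul_def by (rule tensor_map_clinear[OF sym_mult_right clinear_id'])

lemma smul_prod: "smul y (u \<otimes>\<^sub>C w) = (sym_gen y * u) \<otimes>\<^sub>C w"
  unfolding smul_def by (simp add: tensor_map_prod[OF sym_mult_right clinear_id'])

lemma smul_left: "clinear (\<lambda>y. smul y t)"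
  unfolding smul_def by (rule tensor_map_param[OF clinear_compose[OF sym_mult_left sym_gen_clinear] clinear_id'])

lemma monom_smul: "sym_monom (add_mset y T) \<otimes>\<^sub>C w = smul y (sym_monom T \<otimes>\<^sub>C w)"
  by (simp only: smul_prod sym_monom_add[of y T])

definition weighted :: "(nat \<Rightarrow> complex) \<Rightarrow> ('g::complex_vector sym, 'w::complex_vector) tensor \<Rightarrow> ('g sym, 'w) tensor" where
  "weighted f = tensor_map (sym_weight f) id"

lemma weighted_clinear: "clinear (weighted f)"
  unfolding weighted_def by (rule tensor_map_clinear[OF sym_weight_clinear clinear_id'])

lemma weighted_monom: "weighted f (sym_monom T \<otimes>\<^sub>C w) = f (size T) *\<^sub>C (sym_monom T \<otimes>\<^sub>C w)"
  by (simp add: weighted_def tensor_map_prod[OF sym_weight_clinear clinear_id'] sym_weight_monom tensor_prod_simps)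

text \<open>The action \<open>\<sigma>\<close> lives on the whole type and \<open>W\<close> is an
  invariant subspace, so that all exterior powers can share one action on the exterior
  algebra.\<close>

locale free_module = simple_lie lb for lb :: "'g::complex_vector \<Rightarrow> 'g \<Rightarrow> 'g" +
  fixes W :: "'w::complex_vector set" and \<sigma> :: "'g \<Rightarrow> 'w \<Rightarrow> 'w" and s :: nat
  assumes W_sub: "cvs.subspace W" and W_fd: "fin_dim W"
    and s_left: "\<And>w. clinear (\<lambda>x. \<sigma> x w)" and s_right: "\<And>x. clinear (\<sigma> x)"
    and s_in: "\<And>x w. w \<in> W \<Longrightarrow> \<sigma> x w \<in> W"
    and s_bracket: "\<And>x y w. \<sigma> (lb x y) w = \<sigma> x (\<sigma> y w) - \<sigma> y (\<sigma> x w)"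
begin

abbreviation "P \<equiv> free_gmod lb W \<sigma> s"

definition D :: "'g \<Rightarrow> ('g sym, 'w) tensor \<Rightarrow> ('g sym, 'w) tensor" where
  "D x = tensor_diag (sym_ad lb x) (\<sigma> x)"

lemma act_eq: "act P a t = D (fst a) t + smul (snd a) t"
  by (simp add: free_gmod_def D_def smul_def split_def)

lemma D_right: "clinear (D x)"
  unfolding D_def by (rule tensor_diag_clinear[OF sym_ad_clinear s_right])

lemma D_left: "clinear (\<lambda>x. D x t)"
  unfolding D_def by (rule tensor_diag_param[OF sym_ad_left s_left])

lemma D_prod: "D x (u \<otimes>\<^sub>C w) = sym_ad lb x u \<otimes>\<^sub>C w + u \<otimes>\<^sub>C \<sigma> x w"
  unfolding D_def by (rule tensor_diag_prod[OF sym_ad_clinear s_right])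

lemma D_bracket: "D (lb x y) t = D x (D y t) - D y (D x t)"
proof (rule tensor_eqI[OF D_right])
  show "clinear (\<lambda>t. D x (D y t) - D y (D x t))"
    by (rule clinear_commutator[OF D_right D_right])
qed (simp add: D_prod clinear_add[OF D_right] sym_ad_bracket s_bracket tensor_prod_simps)

text \<open>The derivation rule that expresses the mixed bracket of the semidirect product.\<close>

lemma D_mul: "D x (smul y t) = smul (lb x y) t + smul y (D x t)"
proof (rule tensor_eqI[of "\<lambda>t. D x (smul y t)"])
  show "clinear (\<lambda>t. D x (smul y t))" by (rule clinear_compose[OF D_right smul_right])
  show "clinear (\<lambda>t. smul (lb x y) t + smul y (D x t))"
    by (rule clinear_plus[OF smul_right clinear_compose[OF smul_right D_right]])
qed (simp add: D_prod smul_prod clinear_add[OF smul_right] sym_ad_mult tensor_prod_simps)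

lemma mul_commute: "smul y (smul z t) = smul z (smul y t)"
  by (rule tensor_eqI[OF clinear_compose[OF smul_right smul_right] clinear_compose[OF smul_right smul_right]])
    (simp add: smul_prod mult.left_commute)

lemma piece_eq:
  "piece P k = cvs.span {sym_monom M \<otimes>\<^sub>C w | M w. size M + s = k \<and> w \<in> W}" (is "_ = cvs.span ?G")
proof -
  have eq: "piece P k = cvs.span {u \<otimes>\<^sub>C w | u w. \<exists>p. p + s = k \<and> u \<in> sym_pow p \<and> w \<in> W}" (is "_ = cvs.span ?H")
    by (simp add: free_gmod_def)
  have "?G \<subseteq> ?H" using sym_monom_in_pow by blast
  moreover have "?H \<subseteq> cvs.span ?G"
  proof
    fix t assume "t \<in> ?H"
    then obtain u w p where t: "t = u \<otimes>\<^sub>C w" "p + s = k" "u \<in> sym_pow p" "w \<in> W" by blast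
    show "t \<in> cvs.span ?G"
      unfolding t(1)
    proof (rule clinear_span_image_subset[OF tensor_prod_left])
      show "u \<in> cvs.span {sym_monom M | M. size M = p}" using t(3) by (simp add: sym_pow_def)
      fix b assume "b \<in> {sym_monom M | M :: 'g multiset. size M = p}"
      then show "b \<otimes>\<^sub>C w \<in> cvs.span ?G" using t(2,4) by (intro cvs.span_base) blast
    qed
  qed
  ultimately have "cvs.span ?H = cvs.span ?G"
    by (intro subset_antisym cvs.span_minimal cvs.subspace_span cvs.span_mono)
  then show ?thesis using eq by simp
qed

lemma prod_in_piece: "u \<in> sym_pow p \<Longrightarrow> w \<in> W \<Longrightarrow> p + s = k \<Longrightarrow> u \<otimes>\<^sub>C w \<in> piece P k"
  unfolding free_gmod_def by (auto intro!: cvs.span_base)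

lemma piece_map:
  assumes "t \<in> piece P k" "clinear f" "cvs.subspace Y"
    "\<And>M w. size M + s = k \<Longrightarrow> w \<in> W \<Longrightarrow> f (sym_monom M \<otimes>\<^sub>C w) \<in> Y"
  shows "f t \<in> Y"
proof -
  have "f t \<in> cvs.span Y"
    by (rule clinear_span_image_subset[OF assms(2) _ assms(1)[unfolded piece_eq]])
      (use assms(4) in \<open>auto intro!: cvs.span_base\<close>)
  then show ?thesis unfolding cvs.span_eq_iff[THEN iffD2, OF assms(3)] .
qed

lemma carrier_map:
  assumes t: "t \<in> gcarrier P" and f: "clinear f" and Y: "cvs.subspace Y"
    and gen: "\<And>M w. w \<in> W \<Longrightarrow> f (sym_monom M \<otimes>\<^sub>C w) \<in> Y"
  shows "f t \<in> Y"
proof -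
  have "f t \<in> cvs.span Y"
    by (rule clinear_span_image_subset[OF f _ t[unfolded gcarrier_def]])
      (use piece_map[OF _ f Y] gen in \<open>blast intro: cvs.span_base\<close>)
  then show ?thesis unfolding cvs.span_eq_iff[THEN iffD2, OF Y] .
qed

lemma carrier_eqI:
  assumes "clinear f" "clinear g" "\<And>M w. w \<in> W \<Longrightarrow> f (sym_monom M \<otimes>\<^sub>C w) = g (sym_monom M \<otimes>\<^sub>C w)" "t \<in> gcarrier P"
  shows "f t = g t"
proof -
  have "f t - g t \<in> {0}"
    by (rule carrier_map[OF assms(4) clinear_minus[OF assms(1,2)] cvs.subspace_single_0]) (simp add: assms(3))
  then show ?thesis by simp
qed

lemma piece_sub: "cvs.subspace (piece P k)"
  unfolding piece_eq by (rule cvs.subspace_span)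

lemma D_piece: "t \<in> piece P k \<Longrightarrow> D x t \<in> piece P k"
proof (erule piece_map[OF _ D_right piece_sub])
  fix M :: "'g multiset" and w assume "size M + s = k" "w \<in> W"
  then show "D x (sym_monom M \<otimes>\<^sub>C w) \<in> piece P k"
    unfolding D_prod
    by (intro cvs.subspace_add[OF piece_sub] prod_in_piece[of _ "size M"] sym_ad_pow sym_monom_in_pow s_in)
qed

lemma mul_piece: "t \<in> piece P k \<Longrightarrow> smul y t \<in> piece P (k + 1)"
proof (erule piece_map[OF _ smul_right piece_sub])
  fix M :: "'g multiset" and w assume "size M + s = k" "w \<in> W"
  then show "smul y (sym_monom M \<otimes>\<^sub>C w) \<in> piece P (k + 1)"
    unfolding smul_prod
    by (intro prod_in_piece[of _ "Suc (size M)"] sym_gen_mult_pow sym_monom_in_pow) simp_all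
qed

lemma D_carrier: "t \<in> gcarrier P \<Longrightarrow> D x t \<in> gcarrier P"
  unfolding gcarrier_def
  by (rule clinear_span_image_subset[OF D_right]) (auto intro!: cvs.span_base D_piece)

lemma mul_carrier: "t \<in> gcarrier P \<Longrightarrow> smul y t \<in> gcarrier P"
  unfolding gcarrier_def
proof (erule clinear_span_image_subset[OF smul_right, rotated])
  fix b assume "b \<in> (\<Union>k. piece P k)"
  then obtain k where "b \<in> piece P k" by blast
  from mul_piece[OF this] have "smul y b \<in> (\<Union>k. piece P k)" by blast
  then show "smul y b \<in> cvs.span (\<Union>k. piece P k)" by (rule cvs.span_base)
qed

lemma piece_fd: "fin_dim (piece P k)"
proof (rule fin_dim_subset[OF fin_dim_tensor[OF fin_dim_sym_pow[OF fin_dim_UNIV] W_fd]])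
  show "piece P k \<subseteq> cvs.span {u \<otimes>\<^sub>C w | u w. u \<in> sym_pow (k - s) \<and> w \<in> W}"
    unfolding free_gmod_def by (simp, rule cvs.span_mono, clarsimp) blast
qed

text \<open>These degree projections prove that the sum of the pieces is direct.\<close>

abbreviation proj :: "nat \<Rightarrow> ('g sym, 'w) tensor \<Rightarrow> ('g sym, 'w) tensor" where
  "proj k \<equiv> weighted (\<lambda>p. if p + s = k then 1 else 0)"

lemma proj_piece: assumes "t \<in> piece P j" shows "proj k t = (if j = k then t else 0)"
proof -
  have "clinear (\<lambda>t. if j = k then t else 0 :: ('g sym, 'w) tensor)"
    by (cases "j = k") (simp_all add: clinear_id clinear_zero)
  then show ?thesis
    by (rule clinear_eq_on_span[OF weighted_clinear _ _ assms[unfolded piece_eq]]) (auto simp: weighted_monom)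
qed

lemma free_object: "G2_object lb P"
  unfolding G2_object_def
proof (intro conjI allI ballI impI)
  show "cvs.subspace (piece P k)" "fin_dim (piece P k)" for k by (rule piece_sub piece_fd)+
  fix n m k assume m: "(\<forall>k\<le>n. m k \<in> piece P k) \<and> (\<Sum>k\<le>n. m k) = 0" and k: "k \<le> n"
  have "0 = proj k (\<Sum>k\<le>n. m k)" using m by (simp add: clinear_0[OF weighted_clinear])
  also have "\<dots> = (\<Sum>j\<le>n. if j = k then m j else 0)"
    unfolding clinear_sum[OF weighted_clinear] by (rule sum.cong) (use m proj_piece in auto)
  also have "\<dots> = m k" using k by simp
  finally show "m k = 0" by simp
next
  show "lie_module_on (sd_bracket lb) (gcarrier P) (act P)"
    unfolding lie_module_on_def
  proof (intro conjI allI ballI)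
    show sub: "cvs.subspace (gcarrier P)" unfolding gcarrier_def by (rule cvs.subspace_span)
    show "act P a m \<in> gcarrier P" if "m \<in> gcarrier P" for a m
      unfolding act_eq using that by (intro cvs.subspace_add[OF sub] D_carrier mul_carrier)
    show "act P a (m + m') = act P a m + act P a m'" for a m m'
      by (simp add: act_eq clinear_add[OF D_right] clinear_add[OF smul_right])
    show "act P a (c *\<^sub>C m) = c *\<^sub>C act P a m" for a c m
      by (simp add: act_eq clinear_scaleC[OF D_right] clinear_scaleC[OF smul_right] scaleC_add_right)
    show "clinear (\<lambda>a. act P a m)" for m
      unfolding act_eq
      by (rule clinear_plus[OF clinear_compose[OF D_left clinear_fst] clinear_compose[OF smul_left clinear_snd]])
    show "act P (sd_bracket lb a b) m = act P a (act P b m) - act P b (act P a m)" for a b m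
    proof -
      obtain x y x' y' where ab: "a = (x, y)" "b = (x', y')" by (cases a, cases b)
      \<comment> \<open>The bracket contains \<open>lb y x'\<close>, whereas commuting
        \<open>D x'\<close> past \<open>smul y\<close> produces \<open>lb x' y\<close> with a minus
        sign.\<close>
      have "smul (lb y x') m = - smul (lb x' y) m"
        using lb_anti[of y x'] clinear_neg[OF smul_left] by simp
      then show ?thesis
        by (simp add: ab act_eq sd_bracket_def D_bracket clinear_add[OF D_right] clinear_add[OF smul_right]
            clinear_add[OF smul_left] D_mul mul_commute[of y y'])
    qed
  qed
next
  fix k x m assume "m \<in> piece P k"
  then show "act P (x, 0) m \<in> piece P k" by (simp add: act_eq clinear_0[OF smul_left] D_piece)
next
  fix k y m assume "m \<in> piece P k"
  then show "act P (0, y) m \<in> piece P (k + 1)" using mul_piece[of m k y] by (simp add: act_eq clinear_0[OF D_left])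
qed

end

section \<open>Projectivity of the free modules\<close>

locale free_module_cartan = free_module lb W \<sigma> s + simple_lie_cartan lb H
  for lb :: "'g::complex_vector \<Rightarrow> 'g \<Rightarrow> 'g" and W :: "'w::complex_vector set" and \<sigma> s H
begin

lemma one_prod_piece: "w \<in> W \<Longrightarrow> 1 \<otimes>\<^sub>C w \<in> piece P s"
  using prod_in_piece[OF sym_monom_in_pow, of w "{#}"] by (simp add: sym_monom_empty)

text \<open>A linear lift fails to be equivariant by a cocycle with values in the linear maps from \<open>W\<close> to the
  kernel of \<open>e\<close>, which is a coboundary.\<close>

lemma equivariant_lift:
  fixes M :: "('g, 'm::complex_vector) gmod" and N :: "('g, 'n::complex_vector) gmod"
  assumes M: "graded_module lb M" and N: "graded_module lb N"
    and e: "G2_morphism M N e" "e ` gcarrier M = gcarrier N" and f: "G2_morphism P N f"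
  obtains \<phi> where "clinear \<phi>" "\<And>w. \<phi> w \<in> piece M s"
    "\<And>z w. w \<in> W \<Longrightarrow> act M (z, 0) (\<phi> w) = \<phi> (\<sigma> z w)" "\<And>w. w \<in> W \<Longrightarrow> e (\<phi> w) = f (1 \<otimes>\<^sub>C w)"
proof -
  interpret M: graded_module lb M by (rule M)
  interpret N: graded_module lb N by (rule N)
  interpret PP: graded_module lb P by unfold_locales (rule free_object)
  note eadd = G2_morphism_add[OF e(1)] and escale = G2_morphism_scaleC[OF e(1)]
  note fadd = G2_morphism_add[OF f] and fscale = G2_morphism_scaleC[OF f]
  obtain p where p: "clinear p" "\<And>m. p m \<in> gcarrier M" "\<And>m. m \<in> gcarrier M \<Longrightarrow> p m = m"
    using clinear_projection[OF M.carrier_subspace] by blast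
  obtain q where q: "clinear q" "\<And>w. q w \<in> W" "\<And>w. w \<in> W \<Longrightarrow> q w = w"
    using clinear_projection[OF W_sub] by blast
  define a where "a = (\<lambda>z m. act M (z, 0) (p m))"
  have a_right: "clinear (a z)" for z
    by (rule clinearI) (simp_all add: a_def clinear_add[OF p(1)] clinear_scaleC[OF p(1)] M.act_add M.act_scaleC p(2))
  have a_left: "clinear (\<lambda>z. a z m)" for m
    unfolding a_def
    by (rule clinear_compose[OF M.act_left[OF p(2)] clinear_Pair[OF clinear_id clinear_zero]])
  let ?A = "piece M s"
  have AC: "m \<in> gcarrier M" if "m \<in> ?A" for m using that by (rule M.piece_carrier)
  have a_eq: "a z m = act M (z, 0) m" if "m \<in> ?A" for z m using p(3)[OF AC[OF that]] by (simp add: a_def)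
  have aA: "a z m \<in> ?A" if "m \<in> ?A" for z m unfolding a_eq[OF that] by (rule M.act_degree_0[OF that])
  have a_br: "a (lb x y) m = a x (a y m) - a y (a x m)" if m: "m \<in> ?A" for x y m
    unfolding a_eq[OF aA[OF m]] unfolding a_eq[OF m] by (rule M.act_00[OF AC[OF m], symmetric])
  \<comment> \<open>The kernel is taken in degree \<open>s\<close> only, which makes it
    finite-dimensional.\<close>
  define K where "K = {m \<in> ?A. e m = 0}"
  have e0: "e 0 = 0" using escale[OF cvs.subspace_0[OF M.carrier_subspace], of 0] by simp
  have Krep: "lie_rep K lb a"
  proof
    show "cvs.subspace K"
      unfolding cvs.subspace_def K_def
      by (auto simp: e0 eadd escale AC cvs.subspace_0 cvs.subspace_add cvs.subspace_scale M.piece_subspace)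
    show "fin_dim K" by (rule fin_dim_subset[OF M.piece_fin_dim]) (auto simp: K_def)
    show "endo_on K (a z)" for z
      unfolding endo_on_def
    proof (intro conjI a_right subsetI)
      fix m' assume "m' \<in> a z ` K"
      then obtain m where m: "m' = a z m" "m \<in> ?A" "e m = 0" unfolding K_def by blast
      have "e (a z m) = act N (z, 0) (e m)" unfolding a_eq[OF m(2)] by (rule G2_morphism_act[OF e(1) AC[OF m(2)]])
      then show "m' \<in> K" unfolding K_def m using aA[OF m(2)] m(3) N.act_0 by simp
    qed
    show "clinear (\<lambda>z. a z m)" for m by (rule a_left)
    show "a (lb x y) m = a x (a y m) - a y (a x m)" if "m \<in> K" for x y m
      using that by (intro a_br) (simp add: K_def)
  qed
  have Wrep: "lie_rep W lb \<sigma>"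
    by unfold_locales (auto simp: W_sub W_fd s_left s_right s_in s_bracket endo_on_def)
  have fA: "f (1 \<otimes>\<^sub>C w) \<in> piece N s" if "w \<in> W" for w
    by (rule G2_morphism_piece[OF f one_prod_piece[OF that]])
  have "\<forall>w\<in>W. \<exists>m\<in>?A. e m = f (1 \<otimes>\<^sub>C w)"
    using graded_surjective[OF M N e fA] by blast
  then obtain g where g: "\<And>w. w \<in> W \<Longrightarrow> g w \<in> ?A" "\<And>w. w \<in> W \<Longrightarrow> e (g w) = f (1 \<otimes>\<^sub>C w)" by metis
  \<comment> \<open>Preimages in degree \<open>s\<close> are chosen on a basis of \<open>W\<close>
    and extended linearly.\<close>
  obtain B where B: "cvs.independent B" "cvs.span B = W" using fin_dim_basis[OF W_fd W_sub] by blast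
  have BW: "b \<in> W" if "b \<in> B" for b using cvs.span_base[OF that] B(2) by simp
  obtain \<phi>0 where \<phi>0: "clinear \<phi>0" "\<And>b. b \<in> B \<Longrightarrow> \<phi>0 b = g b" "range \<phi>0 \<subseteq> cvs.span (g ` B)"
    using clinear_extension[OF B(1), of g] by blast
  have "cvs.span (g ` B) \<subseteq> ?A"
    by (rule cvs.span_minimal[OF _ M.piece_subspace]) (use g(1) BW in blast)
  then have \<phi>A: "\<phi>0 w \<in> ?A" for w using \<phi>0(3) by blast
  have oneC: "1 \<otimes>\<^sub>C w \<in> gcarrier P" if "w \<in> W" for w
    by (rule PP.piece_carrier[OF one_prod_piece[OF that]])
  have e\<phi>: "e (\<phi>0 w) = f (1 \<otimes>\<^sub>C q w)" if w: "w \<in> W" for w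
  proof (rule clinear_eq_on_span[of "\<lambda>w. e (\<phi>0 w)" "\<lambda>w. f (1 \<otimes>\<^sub>C q w)" B])
    show "clinear (\<lambda>w. e (\<phi>0 w))"
      by (rule clinearI) (simp_all add: clinear_add[OF \<phi>0(1)] clinear_scaleC[OF \<phi>0(1)] eadd escale AC \<phi>A)
    show "clinear (\<lambda>w. f (1 \<otimes>\<^sub>C q w))"
      by (rule clinearI)
        (simp_all add: clinear_add[OF q(1)] clinear_scaleC[OF q(1)] tensor_prod_simps fadd fscale oneC q(2))
    show "e (\<phi>0 b) = f (1 \<otimes>\<^sub>C q b)" if "b \<in> B" for b
      using g(2)[OF BW[OF that]] \<phi>0(2)[OF that] q(3)[OF BW[OF that]] by simp
    show "w \<in> cvs.span B" using w B(2) by simp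
  qed
  have e\<phi>W: "e (\<phi>0 w) = f (1 \<otimes>\<^sub>C w)" if w: "w \<in> W" for w using e\<phi>[OF w] q(3)[OF w] by simp
  define c where "c = (\<lambda>z w. a z (\<phi>0 w) - \<phi>0 (\<sigma> z w))"
  have "\<exists>\<psi>. clinear \<psi> \<and> (\<forall>w\<in>W. \<psi> w \<in> K) \<and> (\<forall>z. \<forall>w\<in>W. c z w = a z (\<psi> w) - \<psi> (\<sigma> z w))"
  proof (rule whitehead_hom[OF Wrep Krep])
    show "clinear (\<lambda>z. c z w)" for w
      unfolding c_def by (rule clinear_minus[OF a_left clinear_compose[OF \<phi>0(1) s_left]])
    show "clinear (c z)" for z
      unfolding c_def by (rule clinear_minus[OF clinear_compose[OF a_right \<phi>0(1)] clinear_compose[OF \<phi>0(1) s_right]])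
    show "c z w \<in> K" if w: "w \<in> W" for z w
    proof -
      have "e (a z (\<phi>0 w)) = act N (z, 0) (f (1 \<otimes>\<^sub>C w))"
        unfolding a_eq[OF \<phi>A] e\<phi>W[OF w, symmetric] by (rule G2_morphism_act[OF e(1) AC[OF \<phi>A]])
      also have "\<dots> = f (act P (z, 0) (1 \<otimes>\<^sub>C w))" by (rule G2_morphism_act[OF f oneC[OF w], symmetric])
      also have "act P (z, 0) (1 \<otimes>\<^sub>C w) = 1 \<otimes>\<^sub>C \<sigma> z w"
        by (simp add: act_eq clinear_0[OF smul_left] D_prod sym_ad_one tensor_prod_simps)
      also have "f (1 \<otimes>\<^sub>C \<sigma> z w) = e (\<phi>0 (\<sigma> z w))" by (rule e\<phi>W[OF s_in[OF w], symmetric])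
      finally have ee: "e (a z (\<phi>0 w)) = e (\<phi>0 (\<sigma> z w))" .
      have "a z (\<phi>0 w) = c z w + \<phi>0 (\<sigma> z w)" by (simp add: c_def)
      moreover have cA: "c z w \<in> ?A" unfolding c_def by (intro cvs.subspace_diff[OF M.piece_subspace] aA \<phi>A)
      ultimately have "e (c z w) + e (\<phi>0 (\<sigma> z w)) = e (\<phi>0 (\<sigma> z w))"
        using eadd[OF AC[OF cA] AC[OF \<phi>A], of "\<sigma> z w"] ee by simp
      then show ?thesis using cA by (simp add: K_def)
    qed
    show "c (lb x y) w = (a x (c y w) - c y (\<sigma> x w)) - (a y (c x w) - c x (\<sigma> y w))" for x y w
      by (simp add: c_def a_br[OF \<phi>A] s_bracket clinear_diff[OF \<phi>0(1)] clinear_diff[OF a_right])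
  qed
  then obtain \<psi> where \<psi>: "clinear \<psi>" "\<And>w. w \<in> W \<Longrightarrow> \<psi> w \<in> K"
    "\<And>z w. w \<in> W \<Longrightarrow> c z w = a z (\<psi> w) - \<psi> (\<sigma> z w)" by blast
  have \<psi>A: "\<psi> w \<in> ?A" "e (\<psi> w) = 0" if "w \<in> W" for w using \<psi>(2)[OF that] by (simp_all add: K_def)
  show thesis
  \<comment> \<open>Since \<open>\<psi>\<close> is controlled on \<open>W\<close> only, composition
    with \<open>q\<close> ensures that every value of the corrected lift has degree
    \<open>s\<close>.\<close>
  proof (rule that[of "\<lambda>w. \<phi>0 (q w) - \<psi> (q w)"])
    show "clinear (\<lambda>w. \<phi>0 (q w) - \<psi> (q w))"
      by (rule clinear_minus[OF clinear_compose[OF \<phi>0(1) q(1)] clinear_compose[OF \<psi>(1) q(1)]])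
    show "\<phi>0 (q w) - \<psi> (q w) \<in> ?A" for w
      by (rule cvs.subspace_diff[OF M.piece_subspace \<phi>A \<psi>A(1)[OF q(2)]])
    show "act M (z, 0) (\<phi>0 (q w) - \<psi> (q w)) = \<phi>0 (q (\<sigma> z w)) - \<psi> (q (\<sigma> z w))" if w: "w \<in> W" for z w
    proof -
      have "\<phi>0 w - \<psi> w \<in> ?A" by (rule cvs.subspace_diff[OF M.piece_subspace \<phi>A \<psi>A(1)[OF w]])
      from a_eq[OF this] have "act M (z, 0) (\<phi>0 w - \<psi> w) = a z (\<phi>0 w) - a z (\<psi> w)"
        by (simp add: clinear_diff[OF a_right])
      also have "\<dots> = \<phi>0 (\<sigma> z w) - \<psi> (\<sigma> z w)"
        using \<psi>(3)[OF w, of z] by (simp add: c_def algebra_simps)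
      finally show ?thesis by (simp add: q(3)[OF w] q(3)[OF s_in[OF w]])
    qed
    show "e (\<phi>0 (q w) - \<psi> (q w)) = f (1 \<otimes>\<^sub>C w)" if w: "w \<in> W" for w
    proof -
      have d: "\<phi>0 w - \<psi> w \<in> ?A" by (rule cvs.subspace_diff[OF M.piece_subspace \<phi>A \<psi>A(1)[OF w]])
      have "e (\<phi>0 w) = e (\<phi>0 w - \<psi> w) + e (\<psi> w)"
        using eadd[OF AC[OF d] AC[OF \<psi>A(1)[OF w]]] by simp
      then show ?thesis using e\<phi>W[OF w] \<psi>A(2)[OF w] by (simp add: q(3)[OF w])
    qed
  qed
qed

text \<open>An equivariant lift \<open>\<phi>\<close> on the generators extends by
  \<open>y1 ... yk \<otimes> w \<mapsto> y1 (... (yk (\<phi> w)))\<close>, independently of the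
  order because degree-one elements act commutatively. Equivariance and compatibility with
  \<open>e\<close> follow by induction on the monomial.\<close>

theorem free_projective: "G2_projective lb TYPE('m::complex_vector) TYPE('n::complex_vector) P"
  unfolding G2_projective_def
proof (intro conjI allI impI free_object)
  fix M :: "('g, 'm) gmod" and N :: "('g, 'n) gmod" and e f
  assume A: "G2_object lb M \<and> G2_object lb N \<and> G2_morphism M N e \<and> e ` gcarrier M = gcarrier N \<and> G2_morphism P N f"
  interpret M: graded_module lb M by unfold_locales (use A in blast)
  interpret N: graded_module lb N by unfold_locales (use A in blast)
  interpret PP: graded_module lb P by unfold_locales (rule free_object)
  have e: "G2_morphism M N e" "e ` gcarrier M = gcarrier N" and f: "G2_morphism P N f" using A by blast+
  obtain \<phi> where \<phi>: "clinear \<phi>" "\<And>w. \<phi> w \<in> piece M s"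
    "\<And>z w. w \<in> W \<Longrightarrow> act M (z, 0) (\<phi> w) = \<phi> (\<sigma> z w)" "\<And>w. w \<in> W \<Longrightarrow> e (\<phi> w) = f (1 \<otimes>\<^sub>C w)"
    using equivariant_lift[OF M.graded_module_axioms N.graded_module_axioms e f] by blast
  obtain p where p: "clinear p" "\<And>m. p m \<in> gcarrier M" "\<And>m. m \<in> gcarrier M \<Longrightarrow> p m = m"
    using clinear_projection[OF M.carrier_subspace] by blast
  \<comment> \<open>With the projection \<open>p\<close> these operators are linear and commute on
    the whole type, as folding over a multiset requires.\<close>
  define b where "b = (\<lambda>y m. act M (0, y) (p m))"
  have b_right: "clinear (b y)" for y
    by (rule clinearI) (simp_all add: b_def clinear_add[OF p(1)] clinear_scaleC[OF p(1)] M.act_add M.act_scaleC p(2))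
  have b_left: "clinear (\<lambda>y. b y m)" for m
    unfolding b_def by (rule clinear_compose[OF M.act_left[OF p(2)] clinear_Pair[OF clinear_zero clinear_id]])
  have b_eq: "b y m = act M (0, y) m" if "m \<in> gcarrier M" for y m using p(3)[OF that] by (simp add: b_def)
  interpret b: comp_fun_commute b
    by unfold_locales (simp add: fun_eq_iff b_def p(3)[OF M.act_in[OF p(2)]] M.act_11[OF p(2)])
  let ?F = "\<lambda>w T. fold_mset b (\<phi> w) T"
  have Fc: "clinear (\<lambda>y. ?F w (add_mset y T))" for w T by (simp add: b_left)
  have Fw: "clinear (\<lambda>w. ?F w T)" for T
    by (induction T) (simp_all add: \<phi>(1) clinear_compose[OF b_right])
  let ?h = "\<lambda>u w. sym_lift (?F w) u"
  have h1: "clinear (\<lambda>u. ?h u w)" for w by (rule sym_lift_clinear[OF Fc])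
  have h2: "clinear (?h u)" for u by (rule sym_lift_param[OF Fw])
  define g where "g = tensor_lift ?h"
  have g: "clinear g" unfolding g_def by (rule tensor_lift_clinear[OF h1 h2])
  have gm: "g (sym_monom T \<otimes>\<^sub>C w) = ?F w T" for T w
    unfolding g_def tensor_lift_prod[OF h1 h2] by (rule sym_lift_monom[OF Fc])
  have gp: "g (sym_monom T \<otimes>\<^sub>C w) \<in> piece M (size T + s)" for T w
    unfolding gm
  proof (induction T)
    case (add y T)
    then show ?case using M.act_degree_1[of "?F w T"] b_eq[OF M.piece_carrier[OF add]] by simp
  qed (simp add: \<phi>(2))
  have gC: "g t \<in> gcarrier M" if "t \<in> gcarrier P" for t
    by (rule carrier_map[OF that g M.carrier_subspace]) (rule M.piece_carrier[OF gp])
  have gen: "sym_monom T \<otimes>\<^sub>C w \<in> gcarrier P" if "w \<in> W" for T w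
    by (rule PP.piece_carrier[OF prod_in_piece[OF sym_monom_in_pow that refl]])
  have gmul': "g (smul y t) = b y (g t)" for y t
  proof (rule tensor_eqI[of "\<lambda>t. g (smul y t)" "\<lambda>t. b y (g t)"])
    show "clinear (\<lambda>t. g (smul y t))" by (rule clinear_compose[OF g smul_right])
    show "clinear (\<lambda>t. b y (g t))" by (rule clinear_compose[OF b_right g])
    fix u w
    show "g (smul y (u \<otimes>\<^sub>C w)) = b y (g (u \<otimes>\<^sub>C w))"
      by (rule sym_eqI[of "\<lambda>u. g (smul y (u \<otimes>\<^sub>C w))" "\<lambda>u. b y (g (u \<otimes>\<^sub>C w))"])
        (intro clinear_compose[OF clinear_compose[OF g smul_right] tensor_prod_left],
         intro clinear_compose[OF clinear_compose[OF b_right g] tensor_prod_left],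
         simp only: monom_smul[symmetric] gm b.fold_mset_add_mset)
  qed
  have gmul: "g (smul y t) = act M (0, y) (g t)" if "t \<in> gcarrier P" for y t
    unfolding gmul' by (rule b_eq[OF gC[OF that]])
  have ac: "clinear (\<lambda>t. act M a (p t))" for a
    by (rule clinearI) (simp_all add: clinear_add[OF p(1)] clinear_scaleC[OF p(1)] M.act_add M.act_scaleC p(2))
  have gD: "g (D x t) = act M (x, 0) (g t)" if t: "t \<in> gcarrier P" for x t
  proof -
    have "g (D x t) = act M (x, 0) (p (g t))"
    proof (rule carrier_eqI[OF clinear_compose[OF g D_right] clinear_compose[OF ac g] _ t])
      fix T w assume w: "w \<in> W"
      have "g (D x (sym_monom T \<otimes>\<^sub>C w)) = act M (x, 0) (g (sym_monom T \<otimes>\<^sub>C w))"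
      proof (induction T)
        case empty
        have "D x (sym_monom {#} \<otimes>\<^sub>C w) = sym_monom {#} \<otimes>\<^sub>C \<sigma> x w"
          by (simp add: D_prod sym_monom_empty sym_ad_one tensor_prod_simps)
        then show ?case by (simp add: gm \<phi>(3)[OF w])
      next
        case (add y T)
        let ?t = "sym_monom T \<otimes>\<^sub>C w"
        have "g (D x (smul y ?t)) = act M (0, lb x y) (g ?t) + act M (0, y) (act M (x, 0) (g ?t))"
          unfolding D_mul clinear_add[OF g] gmul[OF gen[OF w]] gmul[OF D_carrier[OF gen[OF w]]] add ..
        also have "\<dots> = act M (x, 0) (act M (0, y) (g ?t))" by (rule M.act_01[OF gC[OF gen[OF w]], symmetric])
        finally show ?case unfolding monom_smul gmul[OF gen[OF w]] .
      qed
      then show "g (D x (sym_monom T \<otimes>\<^sub>C w)) = act M (x, 0) (p (g (sym_monom T \<otimes>\<^sub>C w)))"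
        using p(3)[OF gC[OF gen[OF w]]] by simp
    qed
    then show ?thesis using p(3)[OF gC[OF t]] by simp
  qed
  have "G2_morphism P M g"
    unfolding G2_morphism_def
  proof (intro conjI allI ballI subsetI)
    show "g (m + m') = g m + g m'" "g (c *\<^sub>C m) = c *\<^sub>C g m" for c m m'
      by (rule clinear_add[OF g], rule clinear_scaleC[OF g])
    show "g (act P a m) = act M a (g m)" if m: "m \<in> gcarrier P" for a m
    proof (cases a)
      case (Pair x y)
      show ?thesis
        unfolding act_eq clinear_add[OF g] gD[OF m] gmul[OF m] Pair M.act_split[OF gC[OF m], of x y] by simp
    qed
    fix k n assume "n \<in> g ` piece P k"
    then obtain t where t: "t \<in> piece P k" "n = g t" by blast
    show "n \<in> piece M k" unfolding t(2)
      by (rule piece_map[OF t(1) g M.piece_subspace]) (use gp in blast)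
  qed
  moreover have "e (g t) = f t" if t: "t \<in> gcarrier P" for t
  proof -
    note eadd = G2_morphism_add[OF e(1)] and escale = G2_morphism_scaleC[OF e(1)]
    note fadd = G2_morphism_add[OF f] and fscale = G2_morphism_scaleC[OF f]
    \<comment> \<open>\<open>f\<close> is linear on the carrier of \<open>P\<close> only; composing
      with \<open>r\<close> makes both sides total linear maps, as \<open>carrier_eqI\<close>
      demands.\<close>
    obtain r where r: "clinear r" "\<And>m. r m \<in> gcarrier P" "\<And>m. m \<in> gcarrier P \<Longrightarrow> r m = m"
      using clinear_projection[OF PP.carrier_subspace] by blast
    have "e (g (r t)) = f (r t)"
    proof (rule carrier_eqI[OF _ _ _ t, of "\<lambda>t. e (g (r t))" "\<lambda>t. f (r t)"])
      show "clinear (\<lambda>t. e (g (r t)))"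
        by (rule clinearI)
          (simp_all add: clinear_add[OF r(1)] clinear_scaleC[OF r(1)] clinear_add[OF g] clinear_scaleC[OF g]
            eadd escale gC r(2))
      show "clinear (\<lambda>t. f (r t))"
        by (rule clinearI) (simp_all add: clinear_add[OF r(1)] clinear_scaleC[OF r(1)] fadd fscale r(2))
      fix T w assume w: "w \<in> W"
      have "e (g (sym_monom T \<otimes>\<^sub>C w)) = f (sym_monom T \<otimes>\<^sub>C w)"
      proof (induction T)
        case empty
        show ?case unfolding gm by (simp add: \<phi>(4)[OF w] sym_monom_empty)
      next
        case (add y T)
        let ?t = "sym_monom T \<otimes>\<^sub>C w"
        have "e (g (smul y ?t)) = act N (0, y) (e (g ?t))"
          unfolding gmul[OF gen[OF w]] by (rule G2_morphism_act[OF e(1) gC[OF gen[OF w]]])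
        also have "\<dots> = f (act P (0, y) ?t)" unfolding add by (rule G2_morphism_act[OF f gen[OF w], symmetric])
        also have "act P (0, y) ?t = smul y ?t" by (simp add: act_eq clinear_0[OF D_left])
        finally show ?case unfolding monom_smul .
      qed
      then show "e (g (r (sym_monom T \<otimes>\<^sub>C w))) = f (r (sym_monom T \<otimes>\<^sub>C w))"
        using r(3)[OF gen[OF w]] by simp
    qed
    then show ?thesis using r(3)[OF t] by simp
  qed
  ultimately show "\<exists>g. G2_morphism P M g \<and> (\<forall>p\<in>gcarrier P. e (g p) = f p)" by blast
qed

end

section \<open>The Koszul complex\<close>

lemma tensor_map_param_right:
  assumes "clinear f" "\<And>b. clinear (\<lambda>x. g x b)"
  shows "clinear (\<lambda>x. tensor_map f (g x) t)"
  unfolding tensor_map_def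
  by (rule tensor_lift_param) (rule clinear_compose[OF tensor_prod_right assms(2)])

type_synonym ('g, 'v) koszul = "('g sym, ('g ext, 'v) tensor) tensor"

definition emul :: "'g::complex_vector \<Rightarrow> ('g ext, 'v::complex_vector) tensor \<Rightarrow> ('g ext, 'v) tensor" where
  "emul y = tensor_map (ext_mult y) id"

text \<open>The wedge multiplication \<open>l_y\<close> of the overview, acting on the middle
  factor; \<open>emul\<close> is its restriction to the last two factors.\<close>

definition wmul :: "'g::complex_vector \<Rightarrow> ('g, 'v::complex_vector) koszul \<Rightarrow> ('g, 'v) koszul" where
  "wmul y = tensor_map id (emul y)"

definition vac :: "'v::complex_vector \<Rightarrow> ('g::complex_vector, 'v) koszul" where
  "vac v = 1 \<otimes>\<^sub>C (wedge [] \<otimes>\<^sub>C v)"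

lemma emul_right: "clinear (emul y)"
  unfolding emul_def by (rule tensor_map_clinear[OF ext_mult_right clinear_id'])

lemma emul_prod: "emul y (w \<otimes>\<^sub>C v) = ext_mult y w \<otimes>\<^sub>C v"
  unfolding emul_def by (simp add: tensor_map_prod[OF ext_mult_right clinear_id'])

lemma emul_left: "clinear (\<lambda>y. emul y t)"
  unfolding emul_def by (rule tensor_map_param[OF ext_mult_left clinear_id'])

lemma wmul_right: "clinear (wmul y)"
  unfolding wmul_def by (rule tensor_map_clinear[OF clinear_id' emul_right])

lemma wmul_prod: "wmul y (u \<otimes>\<^sub>C w) = u \<otimes>\<^sub>C emul y w"
  unfolding wmul_def by (simp add: tensor_map_prod[OF clinear_id' emul_right])

lemma wmul_left: "clinear (\<lambda>y. wmul y t)"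
  unfolding wmul_def by (rule tensor_map_param_right[OF clinear_id' emul_left])

lemma emul_anti: "emul y (emul z t) = - emul z (emul y t)"
  by (rule tensor_eqI[OF clinear_compose[OF emul_right emul_right]
        clinear_uminus[OF clinear_compose[OF emul_right emul_right]]])
    (simp add: emul_prod ext_mult_anti[of y z] tensor_prod_simps)

lemma emul_square: "emul y (emul y t) = 0"
  by (rule tensor_eqI[OF clinear_compose[OF emul_right emul_right] clinear_zero])
    (simp add: emul_prod ext_mult_square tensor_prod_simps)

lemma wmul_anti: "wmul y (wmul z t) = - wmul z (wmul y t)"
  by (rule tensor_eqI[OF clinear_compose[OF wmul_right wmul_right]
        clinear_uminus[OF clinear_compose[OF wmul_right wmul_right]]])
    (simp add: wmul_prod emul_anti[of y z] tensor_prod_simps)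

lemma wmul_square: "wmul y (wmul y t) = 0"
  by (rule tensor_eqI[OF clinear_compose[OF wmul_right wmul_right] clinear_zero])
    (simp add: wmul_prod emul_square tensor_prod_simps)

lemma smul_wmul: "smul y (wmul z t) = wmul z (smul y t)"
  by (rule tensor_eqI[OF clinear_compose[OF smul_right wmul_right] clinear_compose[OF wmul_right smul_right]])
    (simp add: wmul_prod smul_prod)

abbreviation kmon :: "'g::complex_vector multiset \<Rightarrow> 'g list \<Rightarrow> 'v::complex_vector \<Rightarrow> ('g, 'v) koszul" where
  "kmon T xs v \<equiv> sym_monom T \<otimes>\<^sub>C (wedge xs \<otimes>\<^sub>C v)"

lemma koszul_eqI:
  fixes f g :: "('g::complex_vector, 'v::complex_vector) koszul \<Rightarrow> 'b::complex_vector"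
  assumes f: "clinear f" and g: "clinear g"
    and eq: "\<And>T xs v. f (kmon T xs v) = g (kmon T xs v)"
  shows "f t = g t"
proof (rule tensor_eqI[OF f g])
  fix u w
  show "f (u \<otimes>\<^sub>C w) = g (u \<otimes>\<^sub>C w)"
  proof (rule sym_eqI[OF clinear_compose[OF f tensor_prod_left] clinear_compose[OF g tensor_prod_left]])
    fix T
    show "f (sym_monom T \<otimes>\<^sub>C w) = g (sym_monom T \<otimes>\<^sub>C w)"
    proof (rule tensor_eqI[OF clinear_compose[OF f tensor_prod_right] clinear_compose[OF g tensor_prod_right]])
      fix w v
      show "f (sym_monom T \<otimes>\<^sub>C (w \<otimes>\<^sub>C v)) = g (sym_monom T \<otimes>\<^sub>C (w \<otimes>\<^sub>C v))"
        by (rule ext_eqI[OF clinear_compose[OF clinear_compose[OF f tensor_prod_right] tensor_prod_left]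
            clinear_compose[OF clinear_compose[OF g tensor_prod_right] tensor_prod_left] eq])
    qed
  qed
qed

lemma wedge_wmul: "u \<otimes>\<^sub>C (wedge (y # ys) \<otimes>\<^sub>C v) = wmul y (u \<otimes>\<^sub>C (wedge ys \<otimes>\<^sub>C v))"
  by (simp add: wmul_prod emul_prod ext_mult_wedge)

text \<open>The operators \<open>wmul\<close> create all words and \<open>smul\<close> all monomials
  from the vectors \<open>vac v\<close>. Hence an identity between linear operators follows from
  their commutation rules with these two.\<close>

lemma koszul_generated:
  assumes f: "clinear f" and g: "clinear g"
    and "\<And>v. f (vac v) = g (vac v)"
    and "\<And>y t. f t = g t \<Longrightarrow> f (wmul y t) = g (wmul y t)"
    and "\<And>y t. f t = g t \<Longrightarrow> f (smul y t) = g (smul y t)"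
  shows "f t = g t"
proof (rule koszul_eqI[OF f g])
  fix T xs v
  have "f (1 \<otimes>\<^sub>C (wedge xs \<otimes>\<^sub>C v)) = g (1 \<otimes>\<^sub>C (wedge xs \<otimes>\<^sub>C v))"
    by (induction xs) (simp_all add: assms(3)[unfolded vac_def] wedge_wmul assms(4))
  then show "f (kmon T xs v) = g (kmon T xs v)"
    by (induction T) (simp_all add: sym_monom_empty monom_smul assms(5))
qed

subsection \<open>The differential\<close>

definition dform :: "'g::complex_vector sym \<Rightarrow> 'v::complex_vector \<Rightarrow> 'g list \<Rightarrow> ('g, 'v) koszul" where
  "dform u v xs = (\<Sum>s<length xs. (-1) ^ s *\<^sub>C
     ((u * sym_gen (xs ! s)) \<otimes>\<^sub>C (wedge (take s xs @ drop (Suc s) xs) \<otimes>\<^sub>C v)))"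

lemma dform_Nil: "dform u v [] = 0"
  by (simp add: dform_def)

text \<open>Position 0 gives the first term. The other positions are shifted by one, whence the
  minus sign; this is the relation \<open>d l_y = m_y - l_y d\<close>.\<close>

lemma dform_Cons: "dform u v (y # ys) = smul y (u \<otimes>\<^sub>C (wedge ys \<otimes>\<^sub>C v)) - wmul y (dform u v ys)"
proof -
  have "wmul y (dform u v ys) = (\<Sum>s<length ys. (-1) ^ s *\<^sub>C
      ((u * sym_gen (ys ! s)) \<otimes>\<^sub>C (wedge (y # take s ys @ drop (Suc s) ys) \<otimes>\<^sub>C v)))"
    by (simp add: dform_def clinear_sum[OF wmul_right] clinear_scaleC[OF wmul_right] wedge_wmul)
  then show ?thesis
    by (simp add: dform_def sum.lessThan_Suc_shift smul_prod mult.commute sum_negf del: sum.lessThan_Suc)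
qed

lemma dform_cond:
  shows "clinear (\<lambda>x. dform u v (xs @ x # ys))"
    and "\<not> distinct xs \<Longrightarrow> dform u v xs = 0"
proof -
  \<comment> \<open>The recursion also needs the wedge of the remaining letters, which is kept as
    first component. \<open>?L y\<close> squares to zero because \<open>m_y\<close> and
    \<open>l_y\<close> commute and \<open>l_y\<close> squares to zero.\<close>
  let ?L = "\<lambda>y p. (ext_mult y (fst p), smul y (u \<otimes>\<^sub>C (fst p \<otimes>\<^sub>C v)) - wmul y (snd p))"
  let ?F = "\<lambda>xs. (wedge xs, dform u v xs)"
  have L1: "clinear (\<lambda>y. ?L y b)" for b
    by (intro clinear_Pair clinear_minus ext_mult_left smul_left wmul_left)
  have t: "clinear (\<lambda>w. u \<otimes>\<^sub>C (w \<otimes>\<^sub>C v))" by (rule clinear_compose[OF tensor_prod_right tensor_prod_left])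
  have L2: "clinear (?L y)" for y
    by (rule clinear_Pair[OF clinear_compose[OF ext_mult_right clinear_fst]
          clinear_minus[OF clinear_compose[OF clinear_compose[OF smul_right t] clinear_fst]
            clinear_compose[OF wmul_right clinear_snd]]])
  have L3: "?L y (?L y b) = 0" for y b
    by (simp add: ext_mult_square clinear_diff[OF wmul_right] wmul_square smul_prod wmul_prod emul_prod zero_prod_def)
  have L4: "?F (y # ys) = ?L y (?F ys)" for y ys
    by (simp add: dform_Cons ext_mult_wedge)
  note F = ext_fold[where L = ?L and F = ?F, OF L1 L2 L3 L4]
  show "clinear (\<lambda>x. dform u v (xs @ x # ys))" using clinear_compose[OF clinear_snd F(1)] by simp
  show "\<not> distinct xs \<Longrightarrow> dform u v xs = 0" using F(2)[of xs] by (simp add: zero_prod_def)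
qed

lemma koszul_d_rules:
  shows koszul_d_clinear: "clinear (koszul_d :: ('g::complex_vector, 'v::complex_vector) koszul \<Rightarrow> _)"
    and koszul_d_prod: "koszul_d (u \<otimes>\<^sub>C (wedge xs \<otimes>\<^sub>C v)) = dform (u :: 'g sym) (v :: 'v) xs"
proof -
  let ?e = "\<lambda>u w v. ext_lift (dform u v) w :: ('g, 'v) koszul"
  let ?f = "\<lambda>u. tensor_lift (?e u)"
  have eq: "(koszul_d :: ('g, 'v) koszul \<Rightarrow> _) = tensor_lift ?f"
    by (simp add: koszul_d_def dform_def[abs_def])
  have e1: "clinear (\<lambda>w. ?e u w v)" for u v by (rule ext_lift_clinear[OF dform_cond])
  have e2: "clinear (\<lambda>v. ?e u w v)" for u w
    unfolding dform_def
    by (intro ext_lift_param clinear_sum_fun clinear_scaleC_fun)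
      (rule clinear_compose[OF tensor_prod_right tensor_prod_right])
  have e3: "clinear (\<lambda>u. ?e u w v)" for w v
    unfolding dform_def
    by (intro ext_lift_param clinear_sum_fun clinear_scaleC_fun)
      (rule clinear_compose[OF tensor_prod_left sym_mult_left])
  have f1: "clinear (\<lambda>u. ?f u t)" for t by (rule tensor_lift_param[OF e3])
  have f2: "clinear (?f u)" for u by (rule tensor_lift_clinear[OF e1 e2])
  show "clinear (koszul_d :: ('g, 'v) koszul \<Rightarrow> _)" unfolding eq by (rule tensor_lift_clinear[OF f1 f2])
  show "koszul_d (u \<otimes>\<^sub>C (wedge xs \<otimes>\<^sub>C v)) = dform u v xs"
    unfolding eq tensor_lift_prod[OF f1 f2] tensor_lift_prod[OF e1 e2] by (rule ext_lift_wedge[OF dform_cond])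
qed

lemma koszul_d_vac: "koszul_d (vac v) = 0"
  by (simp add: vac_def koszul_d_prod dform_Nil)

lemma koszul_d_smul: "koszul_d (smul y t) = smul y (koszul_d t)"
proof (rule koszul_eqI[OF clinear_compose[OF koszul_d_clinear smul_right] clinear_compose[OF smul_right koszul_d_clinear]])
  fix T xs v
  show "koszul_d (smul y (kmon T xs v)) = smul y (koszul_d (kmon T xs v))"
    by (simp add: smul_prod koszul_d_prod dform_def clinear_sum[OF smul_right] clinear_scaleC[OF smul_right] mult.assoc)
qed

lemma koszul_d_wmul: "koszul_d (wmul y t) = smul y t - wmul y (koszul_d t)"
proof (rule koszul_eqI[of "\<lambda>t. koszul_d (wmul y t)"])
  show "clinear (\<lambda>t. koszul_d (wmul y t))" by (rule clinear_compose[OF koszul_d_clinear wmul_right])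
  show "clinear (\<lambda>t. smul y t - wmul y (koszul_d t))"
    by (rule clinear_minus[OF smul_right clinear_compose[OF wmul_right koszul_d_clinear]])
  fix T xs v
  show "koszul_d (wmul y (kmon T xs v))
      = smul y (kmon T xs v) - wmul y (koszul_d (kmon T xs v))"
    unfolding wedge_wmul[symmetric] koszul_d_prod dform_Cons ..
qed

text \<open>On generators \<open>d d l_y = d m_y - d l_y d = l_y d d\<close>, since \<open>d\<close>
  commutes with \<open>m_y\<close>.\<close>

lemma koszul_d_square: "koszul_d (koszul_d t) = 0"
  by (rule koszul_generated[OF clinear_compose[OF koszul_d_clinear koszul_d_clinear] clinear_zero])
    (simp_all add: koszul_d_vac koszul_d_smul koszul_d_wmul clinear_0[OF koszul_d_clinear]
      clinear_diff[OF koszul_d_clinear] clinear_0[OF wmul_right] clinear_0[OF smul_right])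

subsection \<open>The contracting homotopy\<close>

text \<open>A coordinate-free exterior derivative of polynomial differential forms: each factor of
  the monomial in turn becomes a differential. In the same picture \<open>koszul_d\<close> is
  contraction with the Euler vector field.\<close>

definition homotopy :: "('g::complex_vector, 'v::complex_vector) koszul \<Rightarrow> ('g, 'v) koszul" where
  "homotopy = tensor_lift (\<lambda>u t. sym_lift (\<lambda>T. \<Sum>y\<in>#T. sym_monom (T - {#y#}) \<otimes>\<^sub>C emul y t) u)"

lemma homotopy_rules:
  shows homotopy_clinear: "clinear (homotopy :: ('g::complex_vector, 'v::complex_vector) koszul \<Rightarrow> _)"
    and homotopy_one: "homotopy (1 \<otimes>\<^sub>C t) = (0 :: ('g, 'v) koszul)"
    and homotopy_monom: "homotopy (sym_monom (add_mset y T) \<otimes>\<^sub>C t) =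
      wmul y (sym_monom T \<otimes>\<^sub>C t) + smul y (homotopy (sym_monom T \<otimes>\<^sub>C (t :: ('g ext, 'v) tensor)))"
proof -
  let ?f = "\<lambda>t T. \<Sum>y\<in>#T. sym_monom (T - {#y#}) \<otimes>\<^sub>C emul y t"
  have D: "?f t (add_mset y T) = sym_monom T \<otimes>\<^sub>C emul y t + smul y (?f t T)"
    "clinear (\<lambda>y. ?f t (add_mset y T))" for t :: "('g ext, 'v) tensor" and y :: 'g and T
    by (rule sym_lift_derivation[of "?f t" "\<lambda>y T. sym_monom T \<otimes>\<^sub>C emul y t" smul,
          OF refl clinear_compose[OF tensor_prod_right emul_left] smul_right smul_left monom_smul])+
  let ?h = "\<lambda>u t. sym_lift (?f t) u :: ('g, 'v) koszul"
  have h1: "clinear (\<lambda>u. ?h u t)" for t by (rule sym_lift_clinear[OF D(2)])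
  have h2: "clinear (?h u)" for u
  proof (rule sym_lift_param)
    fix T
    have "clinear (\<lambda>t. \<Sum>y\<in>#S. sym_monom (T - {#y#}) \<otimes>\<^sub>C emul y t)" for S
      by (induction S) (simp_all add: clinear_zero clinear_plus clinear_compose[OF tensor_prod_right emul_right])
    then show "clinear (\<lambda>t. ?f t T)" .
  qed
  show "clinear (homotopy :: ('g, 'v) koszul \<Rightarrow> _)" unfolding homotopy_def by (rule tensor_lift_clinear[OF h1 h2])
  have hm: "homotopy (sym_monom T \<otimes>\<^sub>C t) = ?f t T" for T and t :: "('g ext, 'v) tensor"
    unfolding homotopy_def tensor_lift_prod[OF h1 h2] by (rule sym_lift_monom[OF D(2)])
  show "homotopy (1 \<otimes>\<^sub>C t) = (0 :: ('g, 'v) koszul)" using hm[of "{#}"] by (simp add: sym_monom_empty)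
  show "homotopy (sym_monom (add_mset y T) \<otimes>\<^sub>C t) =
      wmul y (sym_monom T \<otimes>\<^sub>C t) + smul y (homotopy (sym_monom T \<otimes>\<^sub>C t))" for t :: "('g ext, 'v) tensor"
    unfolding hm D(1) wmul_prod ..
qed

lemma homotopy_smul: "homotopy (smul y t) = wmul y t + smul y (homotopy t)"
proof (rule koszul_eqI[of "\<lambda>t. homotopy (smul y t)"])
  show "clinear (\<lambda>t. homotopy (smul y t))" by (rule clinear_compose[OF homotopy_clinear smul_right])
  show "clinear (\<lambda>t. wmul y t + smul y (homotopy t))"
    by (rule clinear_plus[OF wmul_right clinear_compose[OF smul_right homotopy_clinear]])
qed (simp only: monom_smul[symmetric] homotopy_monom)

text \<open>By induction on the monomial: each step of the Leibniz rule brings in one more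
  \<open>wmul\<close>, which anticommutes with \<open>wmul y\<close>.\<close>

lemma homotopy_wmul:
  fixes t :: "('g::complex_vector, 'v::complex_vector) koszul"
  shows "homotopy (wmul y t) = - wmul y (homotopy t)"
proof (rule koszul_eqI[of "\<lambda>t. homotopy (wmul y t)"])
  show "clinear (\<lambda>t. homotopy (wmul y t))" by (rule clinear_compose[OF homotopy_clinear wmul_right])
  show "clinear (\<lambda>t. - wmul y (homotopy t))"
    by (rule clinear_uminus[OF clinear_compose[OF wmul_right homotopy_clinear]])
  fix T and xs :: "'g list" and v :: 'v
  let ?w = "wedge xs \<otimes>\<^sub>C v"
  show "homotopy (wmul y (sym_monom T \<otimes>\<^sub>C ?w)) = - wmul y (homotopy (sym_monom T \<otimes>\<^sub>C ?w))"
  proof (induction T)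
    case empty
    show ?case by (simp add: sym_monom_empty wmul_prod homotopy_one clinear_0[OF wmul_right])
  next
    case (add z T)
    then show ?case
      by (simp add: monom_smul smul_wmul[symmetric] homotopy_smul wmul_anti[of z y]
          clinear_add[OF wmul_right] clinear_neg[OF smul_right])
  qed
qed

text \<open>\<open>A = d h + h d\<close> satisfies \<open>A l_y = l_y (A + 1)\<close> and
  \<open>A m_y = m_y (A + 1)\<close> and kills \<open>vac v\<close>, so it counts factors and
  letters. This is Cartan's formula for the Lie derivative along the Euler field.\<close>

lemma koszul_euler:
  "koszul_d (homotopy (kmon T xs v)) + homotopy (koszul_d (kmon T xs v))
    = of_nat (size T + length xs) *\<^sub>C (kmon T xs v)"
proof -
  let ?A = "\<lambda>t. koszul_d (homotopy t) + homotopy (koszul_d t)"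
  have Aw: "?A (wmul y t) = wmul y (?A t) + wmul y t" for y t
    by (simp add: homotopy_wmul koszul_d_wmul homotopy_smul clinear_neg[OF koszul_d_clinear]
        clinear_diff[OF homotopy_clinear] clinear_add[OF wmul_right])
  have As: "?A (smul y t) = smul y (?A t) + smul y t" for y t
    by (simp add: homotopy_smul koszul_d_wmul koszul_d_smul clinear_add[OF koszul_d_clinear] clinear_add[OF smul_right])
  have 1: "?A (1 \<otimes>\<^sub>C (wedge xs \<otimes>\<^sub>C v)) = of_nat (length xs) *\<^sub>C (1 \<otimes>\<^sub>C (wedge xs \<otimes>\<^sub>C v))"
  proof (induction xs)
    case Nil
    show ?case
      by (simp add: koszul_d_vac[unfolded vac_def] homotopy_one clinear_0[OF koszul_d_clinear] clinear_0[OF homotopy_clinear])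
  next
    case (Cons y ys)
    show ?case unfolding wedge_wmul Aw Cons clinear_scaleC[OF wmul_right] by (simp add: scaleC_add_left add.commute)
  qed
  show ?thesis
  proof (induction T)
    case empty
    show ?case using 1 by (simp add: sym_monom_empty)
  next
    case (add y T)
    show ?case unfolding monom_smul As add clinear_scaleC[OF smul_right] by (simp add: scaleC_add_left add.commute)
  qed
qed

text \<open>The differential raises the symmetric degree by one, so the weight shifts. The
  truncation of \<open>n - 1\<close> at 0 is harmless, as the image of the differential has no part
  of symmetric degree 0.\<close>

lemma koszul_d_weighted: "koszul_d (weighted f t) = weighted (\<lambda>n. f (n - 1)) (koszul_d t)"
proof (rule koszul_eqI[OF clinear_compose[OF koszul_d_clinear weighted_clinear]
      clinear_compose[OF weighted_clinear koszul_d_clinear]])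
  fix T xs v
  have "sym_monom T * sym_gen x = sym_monom (add_mset x T)" for x
    by (simp only: sym_monom_add[of x T] mult.commute)
  then show "koszul_d (weighted f (kmon T xs v))
      = weighted (\<lambda>n. f (n - 1)) (koszul_d (kmon T xs v))"
    by (simp add: weighted_monom clinear_scaleC[OF koszul_d_clinear] koszul_d_prod dform_def
        clinear_sum[OF weighted_clinear] clinear_scaleC[OF weighted_clinear] cvs.scale_sum_right mult.commute)
qed

subsection \<open>The resolution\<close>

locale koszul_module = simple_lie_cartan lb H for lb :: "'g::complex_vector \<Rightarrow> 'g \<Rightarrow> 'g" and H +
  fixes \<rho> :: "'g \<Rightarrow> 'v::complex_vector \<Rightarrow> 'v" and r :: nat
  assumes rho: "lie_module_on lb UNIV \<rho>" and V_fd: "fin_dim (UNIV :: 'v set)"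
begin

lemma rho_right: "clinear (\<rho> x)" and rho_left: "clinear (\<lambda>x. \<rho> x v)"
  and rho_bracket: "\<rho> (lb x y) v = \<rho> x (\<rho> y v) - \<rho> y (\<rho> x v)"
  using rho by (simp_all add: lie_module_on_def clinear_def)

abbreviation sigma :: "'g \<Rightarrow> ('g ext, 'v) tensor \<Rightarrow> ('g ext, 'v) tensor" where
  "sigma x \<equiv> tensor_diag (ext_ad lb x) (\<rho> x)"

definition layer :: "nat \<Rightarrow> ('g ext, 'v) tensor set" where
  "layer j = cvs.span {w \<otimes>\<^sub>C v | w v. w \<in> ext_pow j}"

abbreviation "P \<equiv> koszul_P lb \<rho> r"

lemma P_eq: "P j = free_gmod lb (layer j) sigma (j + r)"
  by (simp add: koszul_P_def layer_def)

lemma sigma_right: "clinear (sigma x)"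
  by (rule tensor_diag_clinear[OF ext_ad_clinear rho_right])

lemma sigma_prod: "sigma x (w \<otimes>\<^sub>C v) = ext_ad lb x w \<otimes>\<^sub>C v + w \<otimes>\<^sub>C \<rho> x v"
  by (rule tensor_diag_prod[OF ext_ad_clinear rho_right])

lemma layer_eq: "layer j = cvs.span {wedge xs \<otimes>\<^sub>C v | xs v. length xs = j}" (is "_ = cvs.span ?G")
proof -
  have "w \<otimes>\<^sub>C v \<in> cvs.span ?G" if "w \<in> ext_pow j" for w and v :: 'v
    using that unfolding ext_pow_def
    by (rule clinear_span_image_subset[OF tensor_prod_left, rotated]) (auto intro!: cvs.span_base)
  then have "{w \<otimes>\<^sub>C v | w (v :: 'v). w \<in> ext_pow j} \<subseteq> cvs.span ?G" by blast
  from cvs.span_minimal[OF this cvs.subspace_span] have "layer j \<subseteq> cvs.span ?G" unfolding layer_def .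
  moreover have "?G \<subseteq> {w \<otimes>\<^sub>C v | w v. w \<in> ext_pow j}" using wedge_in_pow by blast
  then have "cvs.span ?G \<subseteq> layer j" unfolding layer_def by (rule cvs.span_mono)
  ultimately show ?thesis by (rule subset_antisym)
qed

lemma layer_sub: "cvs.subspace (layer j)"
  unfolding layer_def by (rule cvs.subspace_span)

lemma wedge_layer: "wedge xs \<otimes>\<^sub>C v \<in> layer (length xs)"
  unfolding layer_eq by (rule cvs.span_base, rule CollectI, rule exI[of _ xs], rule exI[of _ v]) simp

lemma layer_fd: "fin_dim (layer j)"
  using fin_dim_tensor[OF fin_dim_ext_pow[OF fin_dim_UNIV] V_fd] unfolding layer_def by simp

lemma sigma_layer: "w \<in> layer j \<Longrightarrow> sigma x w \<in> layer j"
  unfolding layer_def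
proof (erule clinear_span_image_subset[OF sigma_right, rotated])
  fix b assume "b \<in> {w \<otimes>\<^sub>C v | (w :: 'g ext) (v :: 'v). w \<in> ext_pow j}"
  then obtain w v where b: "b = w \<otimes>\<^sub>C v" "w \<in> ext_pow j" by blast
  then show "sigma x b \<in> cvs.span {w \<otimes>\<^sub>C v | w v. w \<in> ext_pow j}"
    unfolding b(1) sigma_prod using ext_ad_pow[OF b(2), of x] b(2)
    by (intro cvs.span_add cvs.span_base CollectI) auto
qed

lemma sigma_bracket: "sigma (lb x y) w = sigma x (sigma y w) - sigma y (sigma x w)"
proof (rule tensor_eqI[OF sigma_right])
  show "clinear (\<lambda>t. sigma x (sigma y t) - sigma y (sigma x t))"
    by (rule clinear_commutator[OF sigma_right sigma_right])
qed (simp add: sigma_prod clinear_add[OF sigma_right] ext_ad_bracket rho_bracket tensor_prod_simps)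

lemma koszul_free: "free_module_cartan lb (layer j) sigma H"
  by unfold_locales
    (fact layer_sub layer_fd tensor_diag_param[OF ext_ad_left rho_left] sigma_right sigma_layer sigma_bracket)+

text \<open>One instance for each \<open>j\<close>. The operator \<open>Dact\<close> extracted from
  it is the same for all \<open>j\<close>; only the layer and its degree vary.\<close>

sublocale F: free_module_cartan lb "layer j" sigma "j + r" H for j
  by (rule koszul_free)

abbreviation Dact :: "'g \<Rightarrow> ('g, 'v) koszul \<Rightarrow> ('g, 'v) koszul" where
  "Dact \<equiv> free_module.D lb sigma"

lemma act_P: "act (P j) a t = Dact (fst a) t + smul (snd a) t"
  unfolding P_eq by (rule F.act_eq)

lemmas Dact_clinear = F.D_right and Dact_prod = F.D_prod and Dact_smul = F.D_mul

lemma Dact_vac: "Dact x (vac v) = vac (\<rho> x v)"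
  by (simp add: vac_def Dact_prod sym_ad_one sigma_prod ext_ad_Nil tensor_prod_simps)

lemma sigma_emul: "sigma x (emul y t) = emul (lb x y) t + emul y (sigma x t)"
proof (rule tensor_eqI[of "\<lambda>t. sigma x (emul y t)"])
  show "clinear (\<lambda>t. sigma x (emul y t))" by (rule clinear_compose[OF sigma_right emul_right])
  show "clinear (\<lambda>t. emul (lb x y) t + emul y (sigma x t))"
    by (rule clinear_plus[OF emul_right clinear_compose[OF emul_right sigma_right]])
qed (simp add: sigma_prod emul_prod clinear_add[OF emul_right] ext_ad_mult tensor_prod_simps)

lemma Dact_wmul: "Dact x (wmul y t) = wmul (lb x y) t + wmul y (Dact x t)"
proof (rule tensor_eqI[of "\<lambda>t. Dact x (wmul y t)"])
  show "clinear (\<lambda>t. Dact x (wmul y t))" by (rule clinear_compose[OF Dact_clinear wmul_right])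
  show "clinear (\<lambda>t. wmul (lb x y) t + wmul y (Dact x t))"
    by (rule clinear_plus[OF wmul_right clinear_compose[OF wmul_right Dact_clinear]])
qed (simp add: Dact_prod wmul_prod clinear_add[OF wmul_right] sigma_emul tensor_prod_simps)

text \<open>Both sides obey the same commutation rules with \<open>wmul\<close> and
  \<open>smul\<close>, and both vanish on \<open>vac v\<close>.\<close>

lemma koszul_d_Dact: "koszul_d (Dact x t) = Dact x (koszul_d t)"
proof (rule koszul_generated[OF clinear_compose[OF koszul_d_clinear Dact_clinear] clinear_compose[OF Dact_clinear koszul_d_clinear]])
  show "koszul_d (Dact x (vac v)) = Dact x (koszul_d (vac v))" for v
    by (simp add: Dact_vac koszul_d_vac clinear_0[OF Dact_clinear])
next
  fix y t assume "koszul_d (Dact x t) = Dact x (koszul_d t)"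
  then show "koszul_d (Dact x (wmul y t)) = Dact x (koszul_d (wmul y t))"
    "koszul_d (Dact x (smul y t)) = Dact x (koszul_d (smul y t))"
    by (simp_all add: Dact_wmul Dact_smul koszul_d_wmul koszul_d_smul clinear_add[OF koszul_d_clinear]
        clinear_diff[OF Dact_clinear] clinear_add[OF Dact_clinear])
qed

lemma P_piece_map:
  assumes t: "t \<in> piece (P j) k" and f: "clinear f" and Y: "cvs.subspace Y"
    and gen: "\<And>T xs v. size T + (j + r) = k \<Longrightarrow> length xs = j \<Longrightarrow> f (kmon T xs v) \<in> Y"
  shows "f t \<in> Y"
proof (rule F.piece_map[OF t[unfolded P_eq] f Y])
  fix T :: "'g multiset" and w assume T: "size T + (j + r) = k" and w: "w \<in> layer j"
  have "f (sym_monom T \<otimes>\<^sub>C w) \<in> cvs.span Y"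
    by (rule clinear_span_image_subset[OF clinear_compose[OF f tensor_prod_right] _ w[unfolded layer_eq]])
      (use gen[OF T] in \<open>auto intro!: cvs.span_base\<close>)
  then show "f (sym_monom T \<otimes>\<^sub>C w) \<in> Y" unfolding cvs.span_eq_iff[THEN iffD2, OF Y] .
qed

lemma P_carrier_map:
  assumes t: "t \<in> gcarrier (P j)" and f: "clinear f" and Y: "cvs.subspace Y"
    and gen: "\<And>T xs v. length xs = j \<Longrightarrow> f (kmon T xs v) \<in> Y"
  shows "f t \<in> Y"
proof -
  have "f t \<in> cvs.span Y"
    by (rule clinear_span_image_subset[OF f _ t[unfolded gcarrier_def]])
      (use P_piece_map[OF _ f Y] gen in \<open>blast intro: cvs.span_base\<close>)
  then show ?thesis unfolding cvs.span_eq_iff[THEN iffD2, OF Y] .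
qed

lemma P_carrier_eqI:
  assumes t: "t \<in> gcarrier (P j)" and f: "clinear f" "clinear g"
    and gen: "\<And>T xs v. length xs = j \<Longrightarrow> f (kmon T xs v) = g (kmon T xs v)"
  shows "f t = g t"
proof -
  have "f t - g t \<in> {0}"
    by (rule P_carrier_map[OF t clinear_minus[OF f] cvs.subspace_single_0]) (simp add: gen)
  then show ?thesis by simp
qed

lemma P_piece_sub: "cvs.subspace (piece (P j) k)"
  unfolding P_eq by (rule F.piece_sub)

lemma P_carrier_sub: "cvs.subspace (gcarrier (P j))"
  unfolding gcarrier_def by (rule cvs.subspace_span)

lemma monom_in_piece:
  "size T + (length xs + r) = k \<Longrightarrow> kmon T xs v \<in> piece (P (length xs)) k"
  unfolding P_eq by (rule F.prod_in_piece[OF sym_monom_in_pow wedge_layer])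

lemma monom_in_carrier: "kmon T xs v \<in> gcarrier (P (length xs))"
  unfolding gcarrier_def by (rule cvs.span_base) (use monom_in_piece in blast)

lemma koszul_d_piece:
  assumes "t \<in> piece (P (Suc j)) k" shows "koszul_d t \<in> piece (P j) k"
proof (rule P_piece_map[OF assms koszul_d_clinear P_piece_sub])
  fix T :: "'g multiset" and xs :: "'g list" and v :: 'v assume T: "size T + (Suc j + r) = k" and xs: "length xs = Suc j"
  show "koszul_d (kmon T xs v) \<in> piece (P j) k"
    unfolding koszul_d_prod dform_def
  proof (intro cvs.subspace_sum cvs.subspace_scale P_piece_sub)
    fix i assume i: "i \<in> {..<length xs}"
    have m: "sym_monom T * sym_gen (xs ! i) = sym_monom (add_mset (xs ! i) T)"
      by (simp only: sym_monom_add[of _ T] mult.commute)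
    have l: "length (take i xs @ drop (Suc i) xs) = j" using i xs by auto
    show "(sym_monom T * sym_gen (xs ! i)) \<otimes>\<^sub>C (wedge (take i xs @ drop (Suc i) xs) \<otimes>\<^sub>C v) \<in> piece (P j) k"
      unfolding m using monom_in_piece[of "add_mset (xs ! i) T" "take i xs @ drop (Suc i) xs" k v] T
      unfolding l by simp
  qed
qed

lemma koszul_d_carrier: "t \<in> gcarrier (P (Suc j)) \<Longrightarrow> koszul_d t \<in> gcarrier (P j)"
  unfolding gcarrier_def
  by (erule clinear_span_image_subset[OF koszul_d_clinear, rotated]) (use koszul_d_piece in \<open>blast intro: cvs.span_base\<close>)

lemma koszul_d_morphism: "G2_morphism (P (Suc j)) (P j) koszul_d"
  unfolding G2_morphism_def
  by (auto simp: clinear_add[OF koszul_d_clinear] clinear_scaleC[OF koszul_d_clinear] act_P koszul_d_Dact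
      koszul_d_smul koszul_d_piece)

lemma homotopy_carrier:
  assumes "length xs = j"
  shows "homotopy (kmon T xs v) \<in> gcarrier (P (Suc j))"
proof (induction T)
  case empty
  show ?case using cvs.subspace_0[OF P_carrier_sub] by (simp add: sym_monom_empty homotopy_one)
next
  case (add y T)
  have "sym_monom T \<otimes>\<^sub>C (wedge (y # xs) \<otimes>\<^sub>C v) \<in> gcarrier (P (Suc j))"
    using monom_in_carrier[of T "y # xs" v] assms by simp
  moreover have "smul y t \<in> gcarrier (P (Suc j))" if "t \<in> gcarrier (P (Suc j))" for t
    using F.mul_carrier[of t "Suc j" y] that by (simp add: P_eq)
  ultimately show ?case
    unfolding homotopy_monom wedge_wmul[symmetric] using add by (intro cvs.subspace_add[OF P_carrier_sub])
qed

section \<open>The augmentation and exactness\<close>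

abbreviation "V \<equiv> single_degree \<rho> r"

lemma V_piece: "piece V k = (if k = r then UNIV else {0})" and V_act: "act V a v = \<rho> (fst a) v"
  by (simp_all add: single_degree_def split_def)

lemma V_carrier: "gcarrier V = UNIV"
proof -
  have "v \<in> gcarrier V" for v
    unfolding gcarrier_def by (rule cvs.span_base) (auto simp: single_degree_def intro!: exI[of _ r])
  then show ?thesis by blast
qed

lemma V_object: "G2_object lb V"
  unfolding G2_object_def
proof (intro conjI allI ballI impI)
  show "cvs.subspace (piece V k)" for k
    by (auto simp: single_degree_def cvs.subspace_UNIV cvs.subspace_single_0)
  show "fin_dim (piece V k)" for k by (rule fin_dim_subset[OF V_fd]) simp
  fix n m k assume m: "(\<forall>k\<le>n. m k \<in> piece V k) \<and> (\<Sum>k\<le>n. m k) = 0" and k: "k \<le> n"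
  have z: "m i = 0" if "i \<le> n" "i \<noteq> r" for i using m that by (auto simp: single_degree_def)
  show "m k = 0"
  proof (cases "k = r")
    case True
    have "(\<Sum>i\<le>n. m i) = (\<Sum>i\<le>n. if i = r then m i else 0)" by (rule sum.cong) (use z in auto)
    then show ?thesis using m k True by simp
  qed (use z k in blast)
next
  show "lie_module_on (sd_bracket lb) (gcarrier V) (act V)"
    unfolding V_carrier lie_module_on_def
    by (auto simp: single_degree_def sd_bracket_def split_def clinear_add[OF rho_right] clinear_scaleC[OF rho_right]
        rho_bracket intro!: clinear_compose[OF rho_left clinear_fst])
next
  fix k x m assume "m \<in> piece V k"
  then show "act V (x, 0) m \<in> piece V k"
    by (auto simp: single_degree_def clinear_0[OF rho_right] split: if_splits)
next
  fix k y m
  show "act V (0, y) m \<in> piece V (k + 1)"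
    by (auto simp: single_degree_def clinear_0[OF rho_left])
qed

text \<open>The degree-one part acts on \<open>V\<close> by zero, so folding a nonempty monomial
  gives 0 and only the constant term survives.\<close>

lemma koszul_d0_rules:
  shows koszul_d0_clinear: "clinear (koszul_d0 V)"
    and koszul_d0_monom: "koszul_d0 V (kmon T xs v) = (if T = {#} \<and> xs = [] then v else 0)"
proof -
  have a: "(\<lambda>y. act V (0, y)) = (\<lambda>y v. 0)"
    by (simp add: fun_eq_iff single_degree_def clinear_0[OF rho_left])
  interpret z: comp_fun_commute "\<lambda>(y :: 'g) (v :: 'v). 0 :: 'v" by unfold_locales (simp add: fun_eq_iff)
  have fold: "fold_mset (\<lambda>y v. 0) v T = (if T = {#} then v else 0)" for v :: 'v and T :: "'g multiset"
    by (cases T) simp_all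
  let ?s = "\<lambda>u v. sym_action (\<lambda>y. act V (0, y)) u v"
  have s1: "clinear (\<lambda>u. ?s u v)" for v
    unfolding sym_action_def a fold by (rule sym_lift_clinear) (simp add: clinear_zero)
  have s2: "clinear (?s u)" for u
    unfolding sym_action_def a fold
  proof (rule sym_lift_param)
    show "clinear (\<lambda>v :: 'v. if M = {#} then v else 0)" for M :: "'g multiset"
      by (cases "M = {#}") (simp_all add: clinear_id clinear_zero)
  qed
  have sm: "?s (sym_monom T) v = (if T = {#} then v else 0)" for T v
    unfolding sym_action_def a fold by (rule sym_lift_monom) (simp add: clinear_zero)
  let ?g = "\<lambda>u v xs. if xs = [] then ?s u v else 0"
  let ?e = "\<lambda>u w v. ext_lift (?g u v) w"
  have e1: "clinear (\<lambda>w. ?e u w v)" for u v by (rule ext_lift_clinear) (auto simp: clinear_zero)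
  have ew: "?e u (wedge xs) v = ?g u v xs" for u v xs by (rule ext_lift_wedge) (auto simp: clinear_zero)
  have e2: "clinear (\<lambda>v. ?e u w v)" for u w
  proof (rule ext_lift_param)
    show "clinear (\<lambda>v. ?g u v xs)" for xs by (cases "xs = []") (simp_all add: s2 clinear_zero)
  qed
  have e3: "clinear (\<lambda>u. ?e u w v)" for w v
  proof (rule ext_lift_param)
    show "clinear (\<lambda>u. ?g u v xs)" for xs by (cases "xs = []") (simp_all add: s1 clinear_zero)
  qed
  have f1: "clinear (\<lambda>u. tensor_lift (?e u) t)" for t by (rule tensor_lift_param[OF e3])
  have f2: "clinear (tensor_lift (?e u))" for u by (rule tensor_lift_clinear[OF e1 e2])
  show "clinear (koszul_d0 V)" unfolding koszul_d0_def by (rule tensor_lift_clinear[OF f1 f2])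
  show "koszul_d0 V (kmon T xs v) = (if T = {#} \<and> xs = [] then v else 0)"
    unfolding koszul_d0_def tensor_lift_prod[OF f1 f2] unfolding tensor_lift_prod[OF e1 e2] unfolding ew unfolding sm by simp
qed

lemma koszul_d0_vac: "koszul_d0 V (vac v) = v"
  using koszul_d0_monom[of "{#}" "[]" v] by (simp add: vac_def sym_monom_empty)

lemma koszul_d0_smul: "koszul_d0 V (smul y t) = 0"
  by (rule koszul_eqI[OF clinear_compose[OF koszul_d0_clinear smul_right] clinear_zero])
    (simp only: monom_smul[symmetric] koszul_d0_monom, simp)

lemma koszul_d0_wmul: "koszul_d0 V (wmul y t) = 0"
  by (rule koszul_eqI[OF clinear_compose[OF koszul_d0_clinear wmul_right] clinear_zero])
    (simp only: wedge_wmul[symmetric] koszul_d0_monom, simp)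

lemma koszul_d0_Dact: "koszul_d0 V (Dact x t) = \<rho> x (koszul_d0 V t)"
  by (rule koszul_generated[OF clinear_compose[OF koszul_d0_clinear Dact_clinear] clinear_compose[OF rho_right koszul_d0_clinear]])
    (simp_all add: Dact_vac Dact_wmul Dact_smul koszul_d0_vac koszul_d0_wmul koszul_d0_smul
      clinear_add[OF koszul_d0_clinear] clinear_0[OF rho_right])

lemma koszul_d0_d: "koszul_d0 V (koszul_d t) = 0"
  by (rule koszul_generated[OF clinear_compose[OF koszul_d0_clinear koszul_d_clinear] clinear_zero])
    (simp_all add: koszul_d_vac koszul_d_smul koszul_d_wmul koszul_d0_smul koszul_d0_wmul
      clinear_0[OF koszul_d0_clinear] clinear_diff[OF koszul_d0_clinear])

lemma koszul_d0_morphism: "G2_morphism (P 0) V (koszul_d0 V)"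
  unfolding G2_morphism_def
proof (intro conjI allI ballI)
  show "koszul_d0 V (m + m') = koszul_d0 V m + koszul_d0 V m'" "koszul_d0 V (c *\<^sub>C m) = c *\<^sub>C koszul_d0 V m" for m m' c
    by (rule clinear_add[OF koszul_d0_clinear], rule clinear_scaleC[OF koszul_d0_clinear])
  show "koszul_d0 V (act (P 0) a m) = act V a (koszul_d0 V m)" for a m
    by (simp add: act_P clinear_add[OF koszul_d0_clinear] koszul_d0_Dact koszul_d0_smul V_act)
  show "koszul_d0 V ` piece (P 0) k \<subseteq> piece V k" for k
  proof
    fix n assume "n \<in> koszul_d0 V ` piece (P 0) k"
    then obtain t where t: "t \<in> piece (P 0) k" "n = koszul_d0 V t" by blast
    show "n \<in> piece V k"
      unfolding t(2)
      by (rule P_piece_map[OF t(1) koszul_d0_clinear])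
        (auto simp: koszul_d0_monom V_piece cvs.subspace_UNIV cvs.subspace_single_0)
  qed
qed

lemma koszul_d0_surj: "koszul_d0 V ` gcarrier (P 0) = gcarrier V"
proof -
  have "v \<in> koszul_d0 V ` gcarrier (P 0)" for v
  proof (rule image_eqI)
    show "v = koszul_d0 V (vac v)" by (simp add: koszul_d0_vac)
    show "vac v \<in> gcarrier (P 0)" using monom_in_carrier[of "{#}" "[]" v] by (simp add: vac_def sym_monom_empty)
  qed
  then show ?thesis unfolding V_carrier by blast
qed

text \<open>Dividing by the eigenvalues of \<open>d h + h d\<close> before applying \<open>h\<close>
  gives the primitive \<open>h (G p)\<close>.\<close>

lemma cycle_is_boundary:
  assumes p: "p \<in> gcarrier (P j)" and cycle: "if j = 0 then koszul_d0 V p = 0 else koszul_d p = 0"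
  shows "\<exists>q\<in>gcarrier (P (Suc j)). p = koszul_d q"
proof -
  \<comment> \<open>At \<open>n + j = 0\<close> the division by zero yields 0, so for
    \<open>j = 0\<close> the constant part is dropped.\<close>
  define G where "G = (weighted (\<lambda>n. 1 / of_nat (n + j)) :: ('g, 'v) koszul \<Rightarrow> _)"
  have G: "clinear G" unfolding G_def by (rule weighted_clinear)
  have "homotopy (G p) \<in> gcarrier (P (Suc j))"
    by (rule P_carrier_map[OF p clinear_compose[OF homotopy_clinear G] P_carrier_sub])
      (simp add: G_def weighted_monom clinear_scaleC[OF homotopy_clinear] cvs.subspace_scale[OF P_carrier_sub] homotopy_carrier)
  moreover have "p = koszul_d (homotopy (G p))"
  proof (cases "j = 0")
    case True
    let ?v = "\<lambda>v. vac v :: ('g, 'v) koszul"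
    have v: "clinear ?v" unfolding vac_def by (rule clinear_compose[OF tensor_prod_right tensor_prod_right])
    \<comment> \<open>There is no \<open>h d\<close> term on empty words. The constant part dropped
      by \<open>G\<close> is exactly \<open>vac (koszul_d0 V p)\<close>, which vanishes for a
      cycle.\<close>
    have "koszul_d (homotopy (G p)) = p - vac (koszul_d0 V p)"
    proof (rule P_carrier_eqI[OF p])
      show "clinear (\<lambda>p. koszul_d (homotopy (G p)))"
        by (rule clinear_compose[OF koszul_d_clinear clinear_compose[OF homotopy_clinear G]])
      show "clinear (\<lambda>p. p - vac (koszul_d0 V p) :: ('g, 'v) koszul)"
        by (rule clinear_minus[OF clinear_id clinear_compose[OF v koszul_d0_clinear]])
      fix T :: "'g multiset" and xs :: "'g list" and v :: 'v assume "length xs = j"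
      then have xs: "xs = []" using True by simp
      have "koszul_d (homotopy (kmon T [] v)) = of_nat (size T) *\<^sub>C (kmon T [] v)"
        using koszul_euler[of T "[]" v] by (simp add: koszul_d_prod dform_Nil clinear_0[OF homotopy_clinear])
      then show "koszul_d (homotopy (G (kmon T xs v)))
          = kmon T xs v - vac (koszul_d0 V (kmon T xs v))"
        by (simp add: xs True G_def weighted_monom clinear_scaleC[OF homotopy_clinear] clinear_scaleC[OF koszul_d_clinear]
            koszul_d0_monom clinear_0[OF v] vac_def sym_monom_empty tensor_prod_simps)
    qed
    moreover have "vac (koszul_d0 V p) = (0 :: ('g, 'v) koszul)" using cycle True clinear_0[OF v] by simp
    ultimately show ?thesis by simp
  next
    case False
    have "koszul_d (homotopy (G p)) + homotopy (koszul_d (G p)) = p"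
    proof (rule P_carrier_eqI[OF p _ clinear_id])
      show "clinear (\<lambda>p. koszul_d (homotopy (G p)) + homotopy (koszul_d (G p)))"
        by (rule clinear_plus[OF clinear_compose[OF koszul_d_clinear clinear_compose[OF homotopy_clinear G]]
              clinear_compose[OF homotopy_clinear clinear_compose[OF koszul_d_clinear G]]])
      fix T :: "'g multiset" and xs :: "'g list" and v :: 'v assume xs: "length xs = j"
      let ?t = "kmon T xs v"
      have "koszul_d (homotopy (G ?t)) + homotopy (koszul_d (G ?t))
          = (1 / of_nat (size T + j)) *\<^sub>C (koszul_d (homotopy ?t) + homotopy (koszul_d ?t))"
        by (simp only: G_def weighted_monom clinear_scaleC[OF homotopy_clinear] clinear_scaleC[OF koszul_d_clinear] scaleC_add_right)
      also have "\<dots> = ?t" using False unfolding koszul_euler xs by (simp flip: of_nat_add)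
      finally show "koszul_d (homotopy (G ?t)) + homotopy (koszul_d (G ?t)) = ?t" .
    qed
    \<comment> \<open>Rescaling by degree keeps a cycle a cycle, because the differential is
      homogeneous.\<close>
    moreover have "koszul_d (G p) = 0"
      using cycle False by (simp add: G_def koszul_d_weighted clinear_0[OF weighted_clinear])
    ultimately show ?thesis by (simp add: clinear_0[OF homotopy_clinear])
  qed
  ultimately show ?thesis by blast
qed

lemma P_above_dim:
  assumes "cvs.dim (UNIV :: 'g set) < j" shows "gcarrier (P j) = {0}"
proof -
  have "t \<in> {0}" if "t \<in> gcarrier (P j)" for t
  proof (rule P_carrier_map[OF that clinear_id cvs.subspace_single_0])
    fix T :: "'g multiset" and xs :: "'g list" and v :: 'v assume "length xs = j"
    then have "wedge xs \<in> ext_pow j" using wedge_in_pow by blast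
    then have "wedge xs = 0" using ext_pow_above_dim[OF fin_dim_UNIV assms] by blast
    then show "kmon T xs v \<in> {0}" by (simp add: tensor_prod_simps)
  qed
  then show ?thesis using cvs.subspace_0[OF P_carrier_sub] by blast
qed

theorem koszul_resolution:
  "G2_projective_resolution lb TYPE('m::complex_vector) TYPE('n::complex_vector)
    (cvs.dim (UNIV :: 'g set)) P (\<lambda>j. koszul_d) (koszul_d0 V) V"
  unfolding G2_projective_resolution_def
proof (intro conjI allI impI ballI)
  let ?N = "cvs.dim (UNIV :: 'g set)"
  show "G2_object lb V" by (rule V_object)
  show "G2_projective lb TYPE('m) TYPE('n) (P j)" for j unfolding P_eq by (rule F.free_projective)
  show "G2_morphism (P j) (P (j - 1)) koszul_d" if "j \<in> {1..?N}" for j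
    using koszul_d_morphism[of "j - 1"] that by simp
  show "G2_morphism (P 0) V (koszul_d0 V)" by (rule koszul_d0_morphism)
  show "koszul_d0 V ` gcarrier (P 0) = gcarrier V" by (rule koszul_d0_surj)
  fix j assume j: "j \<le> ?N"
  \<comment> \<open>Exactness is shown at every \<open>j\<close> with the image of
    \<open>P (Suc j)\<close>, also at the left end.\<close>
  have "{p \<in> gcarrier (P j). if j = 0 then koszul_d0 V p = 0 else koszul_d p = 0} = koszul_d ` gcarrier (P (Suc j))"
    (is "?Z = ?B")
  proof
    show "?Z \<subseteq> ?B" using cycle_is_boundary by blast
    show "?B \<subseteq> ?Z" by (auto simp: koszul_d0_d koszul_d_square koszul_d_carrier)
  qed
  \<comment> \<open>At \<open>j = N\<close> the next term of the complex is zero, so the last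
    differential is injective.\<close>
  moreover have "koszul_d ` gcarrier (P (Suc j)) = {0}" if "\<not> j < ?N"
    using P_above_dim[of "Suc j"] that by (simp add: clinear_0[OF koszul_d_clinear])
  ultimately show "{p \<in> gcarrier (P j). if j = 0 then koszul_d0 V p = 0 else koszul_d p = 0} =
      (if j < ?N then koszul_d ` gcarrier (P (j + 1)) else {0})" by simp
qed

end

theorem proposition3p1:
  fixes lb :: "'g::complex_vector \<Rightarrow> 'g \<Rightarrow> 'g"
    and H :: "'g set" and \<Delta> :: "('g \<Rightarrow> complex) set" and \<mu> :: "'g \<Rightarrow> complex"
    and \<rho> :: "'g \<Rightarrow> 'v::complex_vector \<Rightarrow> 'v" and r :: nat
  assumes "simple_lie_algebra lb"
    and "cartan_subalgebra lb H"
    and "simple_roots lb H \<Delta>"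
    and "\<mu> \<in> dominant_integral_weights lb H \<Delta>"
    and "is_simple_highest_weight_module lb H \<Delta> \<mu> \<rho>"
  shows "G2_projective_resolution lb TYPE('m::complex_vector) TYPE('n::complex_vector)
           (cvs.dim (UNIV :: 'g set)) (koszul_P lb \<rho> r) (\<lambda>j. koszul_d)
           (koszul_d0 (single_degree \<rho> r)) (single_degree \<rho> r)"
proof -
  interpret koszul_module lb H \<rho> r
    by unfold_locales
      (use assms in \<open>simp_all add: is_simple_highest_weight_module_def simple_module_def\<close>)
  show ?thesis by (rule koszul_resolution)
qed

end
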